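(* Let $n,D\in\mathbb{Z}$ with $n>0$ and $k=\nu_2(D)<n$. Then $$\frac{1}{4\sqrt3\,k}\exp\!\left(\pi\sqrt{\tfrac{2k}{3}}\right)\le L_2(n,D)\le\frac{3}{2\sqrt{51}\,k}\left(\frac{3+\sqrt{17}}{2}\right)^{k}\exp\!\left(\pi\sqrt{\tfrac{2k}{3}}\right).$$
   Context: $L_2(n,D)$ denotes the number of valid $2$-adic genus symbols (in the sense of Conway–Sloane) of rank $n$ and determinant $D$, i.e. the number of isometry classes of nondegenerate $\mathbb{Z}_2$-lattices $L$ of rank $n$ with $B(L,L)\subseteq\mathbb{Z}_2$ whose determinant equals $D$ modulo squares of $2$-adic units. $\nu_2(D)$ is the $2$-adic valuation of $D$.
   Formalization: The case k = 0 (odd D), where both bounds divide by k and are undefined, is excluded: the theorem assumes k > 0 (and D ≠ 0, which ν₂(D) < n already implies). *)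

theory Defs
  imports Complex_Main "HOL-Computational_Algebra.Primes" "Jordan_Normal_Form.Determinant"
begin

text \<open>The ring of 2-adic integers, as the inverse limit of the rings of integers modulo
  \<open>2 ^ i\<close>; each residue class is represented by its least nonnegative element.\<close>

typedef z2adic =
  "{f :: nat \<Rightarrow> int. \<forall>i. f i \<in> {0..<2 ^ i} \<and> f (Suc i) mod 2 ^ i = f i}"
  morphisms residue Abs_z2adic
  by (rule exI[of _ "\<lambda>_. 0"]) simp

setup_lifting type_definition_z2adic

lemma z2_mod_Suc: "(a mod 2 ^ Suc i) mod 2 ^ i = a mod (2 ^ i :: int)"
  by (rule mod_mod_cancel) (simp add: le_imp_power_dvd)

instantiation z2adic :: comm_ring_1
begin

lift_definition zero_z2adic :: z2adic is "\<lambda>_. 0" by simp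

lift_definition one_z2adic :: z2adic is "\<lambda>i. 1 mod 2 ^ i"
  using z2_mod_Suc[of 1] by simp

lift_definition plus_z2adic :: "z2adic \<Rightarrow> z2adic \<Rightarrow> z2adic"
  is "\<lambda>f g i. (f i + g i) mod 2 ^ i"
  by (simp add: z2_mod_Suc del: power_Suc) (metis mod_add_eq)

lift_definition uminus_z2adic :: "z2adic \<Rightarrow> z2adic" is "\<lambda>f i. (- f i) mod 2 ^ i"
  by (simp add: z2_mod_Suc del: power_Suc) (metis mod_minus_eq)

lift_definition times_z2adic :: "z2adic \<Rightarrow> z2adic \<Rightarrow> z2adic"
  is "\<lambda>f g i. (f i * g i) mod 2 ^ i"
  by (simp add: z2_mod_Suc del: power_Suc) (metis mod_mult_eq)

definition minus_z2adic :: "z2adic \<Rightarrow> z2adic \<Rightarrow> z2adic" where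
  "minus_z2adic x y = x + - y"

instance
proof
  fix a b c :: z2adic
  show "a * b * c = a * (b * c)"
    by transfer (simp add: mod_simps mult.assoc)
  show "a * b = b * a"
    by transfer (simp add: mult.commute)
  show "1 * a = a"
    by transfer (rule ext, simp add: mod_mult_left_eq del: mod_less one_mod_2_pow_eq)
  show "a + b + c = a + (b + c)"
    by transfer (simp add: mod_simps add.assoc)
  show "a + b = b + a"
    by transfer (simp add: add.commute)
  show "0 + a = a"
    by transfer (rule ext, simp)
  show "- a + a = 0"
    by transfer (simp add: mod_simps)
  show "a - b = a + - b"
    by (rule minus_z2adic_def)
  show "(a + b) * c = a * c + b * c"
    by transfer (simp add: mod_simps distrib_right)
  show "(0::z2adic) \<noteq> 1"
    by transfer (auto dest: fun_cong[of _ _ 1])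
qed

end

lemma residue_0: "residue 0 i = 0"
  by transfer simp

lemma residue_mult: "residue (x * y) i = (residue x i * residue y i) mod 2 ^ i"
  by transfer simp

lemma residue_of_int: "residue (of_int z) i = z mod 2 ^ i"
proof (induction z rule: int_of_nat_induct)
  have nat: "residue (of_nat m) i = int m mod 2 ^ i" for m
  proof (induction m)
    case (Suc m)
    have "residue (of_nat (Suc m)) i = (residue 1 i + residue (of_nat m) i) mod 2 ^ i"
      by (simp add: plus_z2adic.rep_eq)
    then show ?case
      using Suc by (simp add: one_z2adic.rep_eq mod_simps)
  qed (simp add: residue_0)
  show "residue (of_int (int m)) i = int m mod 2 ^ i" for m
    using nat by simp
  show "residue (of_int (- int (Suc m))) i = (- int (Suc m)) mod 2 ^ i" for m
  proof -
    have "residue (of_int (- int (Suc m))) i = (- residue (of_nat (Suc m)) i) mod 2 ^ i"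
      by (simp only: of_int_minus of_int_of_nat_eq uminus_z2adic.rep_eq)
    then show ?thesis
      unfolding nat by (simp only: mod_minus_eq)
  qed
qed

lemma residue_mod: "j \<le> i \<Longrightarrow> residue x i mod 2 ^ j = residue x j"
proof (induction i rule: dec_induct)
  case base
  show ?case
    using residue[of x] by simp
next
  case (step i)
  have "residue x (Suc i) mod 2 ^ j = (residue x (Suc i) mod 2 ^ i) mod 2 ^ j"
    using step.hyps by (simp add: mod_mod_cancel le_imp_power_dvd)
  also have "residue x (Suc i) mod 2 ^ i = residue x i"
    using residue[of x] by simp
  finally show ?case
    using step.IH by simp
qed

lemma z2adic_eq_0_iff: "x = 0 \<longleftrightarrow> (\<forall>i. residue x i = 0)"
  by transfer auto

instance z2adic :: idom
proof
  fix x y :: z2adic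
  assume "x \<noteq> 0" and "y \<noteq> 0"
  then obtain i j where i: "residue x i \<noteq> 0" and j: "residue y j \<noteq> 0"
    unfolding z2adic_eq_0_iff by blast
  define a b where "a = residue x (i + j)" and "b = residue y (i + j)"
  have a: "\<not> 2 ^ i dvd a" and b: "\<not> 2 ^ j dvd b"
    using i j residue_mod[of i "i + j" x] residue_mod[of j "i + j" y]
    by (auto simp: a_def b_def dvd_eq_mod_eq_0)
  then have nz: "a \<noteq> 0" "b \<noteq> 0"
    by auto
  have "multiplicity 2 a < i" "multiplicity 2 b < j"
    using a b multiplicity_dvd' by (meson not_le)+
  then have "multiplicity 2 (a * b) < i + j"
    using nz by (simp add: prime_elem_multiplicity_mult_distrib)
  then have "\<not> 2 ^ (i + j) dvd a * b"
    using nz by (subst power_dvd_iff_le_multiplicity) auto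
  then have "residue (x * y) (i + j) \<noteq> 0"
    by (simp add: residue_mult a_def b_def dvd_eq_mod_eq_0)
  then show "x * y \<noteq> 0"
    using residue_0 by metis
qed

text \<open>A lattice of rank \<open>n\<close> over the 2-adic integers whose bilinear form takes values in
  the 2-adic integers is given, after the choice of a basis, by its Gram matrix.\<close>

definition integral_z2_lattice :: "nat \<Rightarrow> z2adic mat \<Rightarrow> bool" where
  "integral_z2_lattice n G \<longleftrightarrow>
     G \<in> carrier_mat n n \<and> transpose_mat G = G \<and> det G \<noteq> 0"

definition z2_isometric :: "z2adic mat \<Rightarrow> z2adic mat \<Rightarrow> bool" where
  "z2_isometric G H \<longleftrightarrow>
     (\<exists>U \<in> carrier_mat (dim_row G) (dim_row G). invertible_mat U \<and> H = transpose_mat U * G * U)"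

definition eq_mod_unit_squares :: "z2adic \<Rightarrow> z2adic \<Rightarrow> bool" where
  "eq_mod_unit_squares x y \<longleftrightarrow> (\<exists>u. u dvd 1 \<and> x = y * u ^ 2)"

definition z2_lattices :: "nat \<Rightarrow> int \<Rightarrow> z2adic mat set" where
  "z2_lattices n D =
     {G. integral_z2_lattice n G \<and> eq_mod_unit_squares (det G) (of_int D)}"

definition z2_isometry_rel :: "nat \<Rightarrow> int \<Rightarrow> (z2adic mat \<times> z2adic mat) set" where
  "z2_isometry_rel n D =
     {(G, H). G \<in> z2_lattices n D \<and> H \<in> z2_lattices n D \<and> z2_isometric G H}"

definition L2 :: "nat \<Rightarrow> int \<Rightarrow> nat" where
  "L2 n D = card (z2_lattices n D // z2_isometry_rel n D)"

lemma invertible_matE: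
  assumes "U \<in> carrier_mat n n" and "invertible_mat U"
  obtains V where "V \<in> carrier_mat n n" "U * V = 1\<^sub>m n" "V * U = 1\<^sub>m n"
proof -
  from assms obtain V where UV: "U * V = 1\<^sub>m n" and VU: "V * U = 1\<^sub>m (dim_row V)"
    unfolding invertible_mat_def inverts_mat_def by auto
  have "dim_col V = n"
    using arg_cong[OF UV, of dim_col] by simp
  moreover have "dim_row V = n"
    using arg_cong[OF VU, of dim_col] assms by simp
  ultimately show ?thesis
    using that[of V] UV VU by auto
qed

lemma invertible_matI:
  assumes "U \<in> carrier_mat n n" "V \<in> carrier_mat n n" "U * V = 1\<^sub>m n" "V * U = 1\<^sub>m n"
  shows "invertible_mat U"
  using assms unfolding invertible_mat_def inverts_mat_def by auto

lemma z2_isometric_refl: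
  assumes "G \<in> carrier_mat n n"
  shows "z2_isometric G G"
  unfolding z2_isometric_def
  using assms by (intro bexI[of _ "1\<^sub>m n"])
    (auto simp: invertible_mat_def inverts_mat_def intro!: exI[of _ "1\<^sub>m n"])

lemma z2_isometric_sym:
  assumes G: "G \<in> carrier_mat n n" and "z2_isometric G H"
  shows "z2_isometric H G"
proof -
  from assms obtain U where U: "U \<in> carrier_mat n n" "invertible_mat U"
    and H: "H = transpose_mat U * G * U"
    unfolding z2_isometric_def by auto
  from U obtain V where V: "V \<in> carrier_mat n n" and UV: "U * V = 1\<^sub>m n"
    and VU: "V * U = 1\<^sub>m n"
    by (rule invertible_matE)
  have VtUt: "transpose_mat V * transpose_mat U = 1\<^sub>m n"
    using transpose_mult[OF U(1) V] UV by simp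
  have "transpose_mat V * H * V = (transpose_mat V * transpose_mat U) * G * (U * V)"
    using G U(1) V unfolding H by (simp add: assoc_mult_mat[of _ n n _ n _ n])
  also have "\<dots> = G"
    using G by (simp add: VtUt UV)
  finally have "G = transpose_mat V * H * V" ..
  moreover have "invertible_mat V"
    by (rule invertible_matI[OF V U(1) VU UV])
  moreover have "dim_row H = n"
    using H U by simp
  ultimately show ?thesis
    unfolding z2_isometric_def using V by auto
qed

lemma z2_isometric_trans:
  assumes G: "G \<in> carrier_mat n n" and GH: "z2_isometric G H" and HK: "z2_isometric H K"
  shows "z2_isometric G K"
proof -
  from G GH obtain U where U: "U \<in> carrier_mat n n" "invertible_mat U"
    and H: "H = transpose_mat U * G * U"
    unfolding z2_isometric_def by auto
  have "dim_row H = n"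
    using H U by simp
  with HK obtain V where V: "V \<in> carrier_mat n n" "invertible_mat V"
    and K: "K = transpose_mat V * H * V"
    unfolding z2_isometric_def by auto
  have "K = transpose_mat (U * V) * G * (U * V)"
    unfolding K H transpose_mult[OF U(1) V(1)]
    using G U(1) V(1) by (simp add: assoc_mult_mat[of _ n n _ n _ n])
  moreover have "invertible_mat (U * V)"
  proof -
    obtain U' where U': "U' \<in> carrier_mat n n" "U * U' = 1\<^sub>m n" "U' * U = 1\<^sub>m n"
      using U by (rule invertible_matE)
    obtain V' where V': "V' \<in> carrier_mat n n" "V * V' = 1\<^sub>m n" "V' * V = 1\<^sub>m n"
      using V by (rule invertible_matE)
    have "U * V * (V' * U') = U * (V * V') * U'"
      using U(1) V(1) U'(1) V'(1) by (simp add: assoc_mult_mat[of _ n n _ n _ n])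
    moreover have "V' * U' * (U * V) = V' * (U' * U) * V"
      using U(1) V(1) U'(1) V'(1) by (simp add: assoc_mult_mat[of _ n n _ n _ n])
    ultimately show ?thesis
      using U(1) V(1) U' V' by (intro invertible_matI[of _ n "V' * U'"]) auto
  qed
  ultimately show ?thesis
    unfolding z2_isometric_def using G U(1) V(1) by (intro bexI[of _ "U * V"]) simp_all
qed

lemma equiv_z2_isometry_rel: "equiv (z2_lattices n D) (z2_isometry_rel n D)"
proof (rule equivI)
  have car: "G \<in> carrier_mat n n" if "G \<in> z2_lattices n D" for G
    using that by (simp add: z2_lattices_def integral_z2_lattice_def)
  show "z2_isometry_rel n D \<subseteq> z2_lattices n D \<times> z2_lattices n D"
    by (auto simp: z2_isometry_rel_def)
  show "refl_on (z2_lattices n D) (z2_isometry_rel n D)"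
    using car z2_isometric_refl by (auto simp: refl_on_def z2_isometry_rel_def)
  show "sym (z2_isometry_rel n D)"
    using car z2_isometric_sym by (auto simp: sym_def z2_isometry_rel_def)
  show "trans (z2_isometry_rel n D)"
    using car z2_isometric_trans unfolding trans_def z2_isometry_rel_def by blast
qed

end

theory Submission
  imports Defs "HOL-Computational_Algebra.Formal_Power_Series"
begin

text \<open>
  A lattice over the 2-adic integers is an orthogonal sum of blocks \<open>\<langle>2\<^sup>e u\<rangle>\<close>, \<open>2\<^sup>e H\<close> and \<open>2\<^sup>e N\<close>, where \<open>H\<close> is
  the hyperbolic plane and \<open>N\<close> the anisotropic even plane of determinant 3. Relations between blocks of equal
  scale leave at most 4, 8, 8, 10, 8, 10, \<open>\<dots>\<close> forms of rank 1, 2, 3, 4, 5, 6, \<open>\<dots>\<close> for each Jordan constituent,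
  and the determinant leaves at most 3 choices for the unimodular constituent. Hence the number of classes is
  at most three times a coefficient of \<open>\<Prod>\<^sub>i (1 + 4 x\<^sup>i + 8 x\<^sup>2\<^sup>i + \<dots>)\<close>, which the upper bound exceeds with a wide
  margin except at \<open>k = 1\<close>; there the isometry \<open>\<langle>a, 2 b\<rangle> \<cong> \<langle>a + 2 b, 2 a b (a + 2 b)\<rangle>\<close> saves the estimate.

  The ranks of the Jordan constituents of scale \<open>2\<^sup>i\<close>, \<open>i \<ge> 1\<close>, and their parity types are invariants that
  can be prescribed freely, because \<open>k < n\<close> leaves an odd unimodular part to absorb the determinant. Counting them gives
  the coefficients \<open>a(k)\<close> of \<open>\<Prod>\<^sub>i (1 + x\<^sup>i + x\<^sup>2\<^sup>i) / (1 - x\<^sup>2\<^sup>i)\<close>, which grow like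
  \<open>exp (2 \<surd>(7 \<pi>\<^sup>2 k / 36))\<close>, faster than the partition numbers. Logarithmic differentiation gives a recurrence
  for \<open>a\<close>; comparing its averaged coefficients with those of the recurrence of \<open>exp (5/3 \<cdot> x / (1 - x))\<close> bounds
  \<open>a\<close> from below, and the latter coefficients satisfy a three-term recurrence, whose ratios are easily estimated.
  The cases \<open>k = 1\<close> and \<open>k = 3\<close>, where \<open>a(k)\<close> is too small, need finer invariants.
\<close>

section \<open>The 2-adic integers\<close>

text \<open>The left-hand side of the theorem is the Hardy-Ramanujan main term, which exceeds the
  partition numbers: at \<open>k = 1, 2, 3\<close> it is about 1.88, 2.72 and 4.09, against 1, 2 and
  3. One lattice for each partition of \<open>k\<close> is therefore not enough, and the parity
  types are counted in order to gain in the exponent. The gain is visible in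
  \<open>log_weight\<close>: the sum of \<open>log_weight m / m^2\<close> is (1 + 2/4 - 3/9) pi^2/6
  = 7 pi^2/36, about 1.92, instead of pi^2/6, about 1.645. The rational number 5/3 lies between the
  two, which leaves room on both sides. The comparison cannot be made coefficient by coefficient,
  because \<open>log_coeff\<close> fluctuates: it equals 1 at both 1 and 3, far below 5/3 times the
  index at 3. Its partial sums do dominate from index 9 on. Abel summation moves the comparison to
  these sums; it needs the minorant to be increasing and its differences to grow slowly, so that the
  few negative early terms are outweighed.\<close>

lemma residue_range: "0 \<le> residue x i" "residue x i < 2 ^ i"
  using residue[of x] by auto

lemma z2adic_eqI: "(\<And>i. residue x i = residue y i) \<Longrightarrow> x = y"
  by (simp add: residue_inject[symmetric] fun_eq_iff)

lemma residue_add: "residue (x + y) i = (residue x i + residue y i) mod 2 ^ i"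
  by transfer simp

lemma residue_uminus: "residue (- x) i = (- residue x i) mod 2 ^ i"
  by transfer simp

lemma residue_diff: "residue (x - y) i = (residue x i - residue y i) mod 2 ^ i"
  unfolding diff_conv_add_uminus residue_add residue_uminus by (simp add: mod_simps)

lemma residue_self_mod [simp]: "residue x i mod 2 ^ i = residue x i"
  by (rule residue_mod) simp

lemma residue_diff_eq_0_iff: "residue (x - y) i = 0 \<longleftrightarrow> residue x i = residue y i"
proof -
  have "residue (x - y) i = 0 \<longleftrightarrow> residue x i mod 2 ^ i = residue y i mod 2 ^ i"
    unfolding residue_diff by (metis mod_eq_dvd_iff dvd_eq_mod_eq_0)
  then show ?thesis by simp
qed

text \<open>If the residue at level \<open>i\<close> vanishes, all later residues are divisible by
  \<open>2 ^ i\<close>; their quotients, read at levels shifted by \<open>i\<close>, form a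
  compatible sequence, which is the quotient of \<open>x\<close>.\<close>

lemma residue_eq_0_iff_dvd: "residue x i = 0 \<longleftrightarrow> 2 ^ i dvd x"
proof
  assume "2 ^ i dvd x"
  then obtain y where "x = of_int (2 ^ i) * y" by (auto elim: dvdE)
  then show "residue x i = 0"
    by (simp add: residue_mult residue_of_int del: of_int_power)
next
  assume r: "residue x i = 0"
  have d: "2 ^ i dvd residue x (j + i)" for j
    using residue_mod[of i "j + i" x] r by (auto simp: dvd_eq_mod_eq_0)
  define f where "f j = residue x (j + i) div 2 ^ i" for j
  have fx: "residue x (j + i) = 2 ^ i * f j" for j
    using d[of j] by (simp add: f_def)
  have "f j \<in> {0..<2 ^ j} \<and> f (Suc j) mod 2 ^ j = f j" for j
  proof -
    have "0 \<le> f j" using residue_range(1)[of x "j + i"] fx[of j] by (simp add: zero_le_mult_iff)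
    moreover have "2 ^ i * f j < 2 ^ i * 2 ^ j"
      using residue_range(2)[of x "j + i"] fx[of j] by (simp add: power_add mult.commute)
    moreover have "(2 ^ i * f (Suc j)) mod (2 ^ i * 2 ^ j) = 2 ^ i * f j"
      using residue_mod[of "j + i" "Suc j + i" x] fx[of j] fx[of "Suc j"]
      by (simp add: power_add mult.commute)
    ultimately show ?thesis by (simp add: mult_mod_right[symmetric])
  qed
  then have "residue (Abs_z2adic f) j = f j" for j
    by (subst Abs_z2adic_inverse) auto
  then have "residue (of_int (2 ^ i) * Abs_z2adic f) j = residue x j" for j
    using residue_mod[of j "j + i" x] fx[of j]
    by (simp add: residue_mult residue_of_int mod_mult_left_eq del: of_int_power)
  then have "x = of_int (2 ^ i) * Abs_z2adic f"
    by (metis z2adic_eqI)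
  then show "2 ^ i dvd x" by simp
qed

lemma residue_eq_iff_dvd: "residue x i = residue y i \<longleftrightarrow> 2 ^ i dvd x - y"
  using residue_diff_eq_0_iff residue_eq_0_iff_dvd by metis

text \<open>Banach's fixed point theorem. The iterates of 0 agree modulo \<open>2 ^ n\<close> from
  the \<open>n\<close>-th on, so the \<open>n\<close>-th residue of the limit is read off the
  \<open>n\<close>-th iterate. Inverses of units and roots of quadratic equations are obtained from
  it.\<close>

lemma z2adic_contraction_fixpoint:
  assumes "\<And>x y i. 2 ^ i dvd x - y \<Longrightarrow> 2 ^ Suc i dvd f x - f (y :: z2adic)"
  shows "\<exists>x. f x = x"
proof -
  define s where "s n = (f ^^ n) 0" for n
  have step: "2 ^ n dvd s (Suc n) - s n" for n
  proof (induction n)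
    case (Suc n)
    then show ?case using assms[OF Suc] by (simp add: s_def)
  qed simp
  define g where "g n = residue (s n) n" for n
  have "g n \<in> {0..<2 ^ n} \<and> g (Suc n) mod 2 ^ n = g n" for n
    using residue_range[of "s n" n] step[of n] residue_mod[of n "Suc n" "s (Suc n)"]
    by (simp add: g_def residue_eq_iff_dvd[symmetric])
  then have res: "residue (Abs_z2adic g) n = residue (s n) n" for n
    by (subst Abs_z2adic_inverse) (auto simp: g_def)
  have "residue (f (Abs_z2adic g)) n = residue (Abs_z2adic g) n" for n
  proof -
    have "2 ^ n dvd f (Abs_z2adic g) - f (s n)"
      using assms[of n "Abs_z2adic g" "s n"] res[of n]
      by (metis dvd_trans le_imp_power_dvd le_SucI order_refl residue_eq_iff_dvd)
    moreover have "f (s n) = s (Suc n)" by (simp add: s_def)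
    ultimately have "residue (f (Abs_z2adic g)) n = residue (s (Suc n)) n"
      by (simp add: residue_eq_iff_dvd)
    with step[of n] res[of n] show ?thesis by (simp add: residue_eq_iff_dvd[symmetric])
  qed
  then show ?thesis by (metis z2adic_eqI)
qed

lemma z2adic_two_dvd_or: "2 dvd x \<or> 2 dvd x - (1 :: z2adic)"
proof -
  have "residue x 1 = 0 \<or> residue x 1 = residue 1 1"
    using residue_range[of x 1] by (auto simp: one_z2adic.rep_eq)
  then show ?thesis using residue_eq_0_iff_dvd[of x 1] residue_eq_iff_dvd[of x 1 1] by auto
qed

lemma z2adic_two_not_unit: "\<not> 2 dvd (1 :: z2adic)"
  using residue_eq_0_iff_dvd[of 1 1] by (simp add: one_z2adic.rep_eq)

lemma z2adic_unit_iff: "x dvd 1 \<longleftrightarrow> \<not> 2 dvd (x :: z2adic)"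
proof
  show "x dvd 1 \<Longrightarrow> \<not> 2 dvd x" using z2adic_two_not_unit dvd_trans by blast
next
  assume "\<not> 2 dvd x"
  then obtain g where g: "x - 1 = 2 * g" using z2adic_two_dvd_or by (blast elim: dvdE)
  \<comment> \<open>The inverse \<open>y\<close> of \<open>x = 1 + 2 * g\<close> solves
    \<open>y = 1 - 2 * g * y\<close>, and the factor 2 makes the right side a contraction.\<close>
  have "\<exists>y. 1 - 2 * g * y = y"
  proof (rule z2adic_contraction_fixpoint)
    fix a b :: z2adic and i assume "2 ^ i dvd a - b"
    then have "2 * 2 ^ i dvd 2 * (g * (b - a))"
      by (metis dvd_minus_iff dvd_mult minus_diff_eq mult_dvd_mono dvd_refl)
    then show "2 ^ Suc i dvd (1 - 2 * g * a) - (1 - 2 * g * b)" by (simp add: algebra_simps)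
  qed
  then obtain y where "1 - 2 * g * y = y" ..
  then have "1 = x * y" using g by (simp add: algebra_simps)
  then show "x dvd 1" by (rule dvdI)
qed

text \<open>The substitution \<open>x = 2 * z\<close>, followed by division by 2, turns the equation
  into the fixed point problem \<open>z = - g - 2 * a * z^2\<close>, which is a contraction.\<close>

lemma z2adic_hensel: "\<exists>x :: z2adic. a * x\<^sup>2 + x + 2 * g = 0"
proof -
  have "\<exists>z. - g - 2 * a * z\<^sup>2 = z"
  proof (rule z2adic_contraction_fixpoint)
    fix x y :: z2adic and i assume "2 ^ i dvd x - y"
    then have "2 * 2 ^ i dvd 2 * ((x - y) * - (a * (x + y)))"
      by (intro mult_dvd_mono dvd_mult2) auto
    then show "2 ^ Suc i dvd (- g - 2 * a * x\<^sup>2) - (- g - 2 * a * y\<^sup>2)"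
      by (simp add: algebra_simps power2_eq_square)
  qed
  then obtain z where z: "z = - g - 2 * a * z\<^sup>2" by metis
  have "a * (2 * z)\<^sup>2 + 2 * z + 2 * g = 2 * (z - (- g - 2 * a * z\<^sup>2))"
    by (simp add: algebra_simps power2_eq_square)
  then show ?thesis using z by (metis diff_self mult_zero_right)
qed

text \<open>As \<open>(1 + 2 * x)^2 = 1 + 4 * (x^2 + x)\<close>, a root of \<open>1 + 8 * w\<close>
  amounts to a solution of \<open>x^2 + x = 2 * w\<close>, which \<open>z2adic_hensel\<close>
  supplies.\<close>

lemma unit_square_if_cong_1_mod_8:
  assumes "8 dvd (u :: z2adic) - 1"
  shows "\<exists>v. v dvd 1 \<and> u = v\<^sup>2"
proof -
  obtain w where w: "u - 1 = 8 * w" using assms by (blast elim: dvdE)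
  obtain x where x: "1 * x\<^sup>2 + x + 2 * (- w) = 0" using z2adic_hensel by blast
  have "(1 + 2 * x)\<^sup>2 = u + 4 * (1 * x\<^sup>2 + x + 2 * (- w))"
    using w by (simp add: algebra_simps power2_eq_square)
  then have "u = (1 + 2 * x)\<^sup>2" unfolding x by simp
  moreover have "(1 + 2 * x) dvd 1"
    using z2adic_two_not_unit by (simp add: z2adic_unit_iff dvd_add_left_iff)
  ultimately show ?thesis by blast
qed

lemma z2adic_power2_unit:
  assumes "x \<noteq> 0"
  obtains v u where "x = 2 ^ v * u" "(u :: z2adic) dvd 1"
proof -
  obtain i where i: "\<not> 2 ^ i dvd x"
    using assms z2adic_eq_0_iff residue_eq_0_iff_dvd by blast
  define v where "v = (GREATEST v. 2 ^ v dvd x)"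
  have bound: "j \<le> i" if "2 ^ j dvd x" for j
    using that i by (meson dvd_trans le_imp_power_dvd nat_le_linear)
  have "2 ^ v dvd x"
    unfolding v_def by (rule GreatestI_nat[of _ 0 i]) (auto intro: bound)
  then obtain u where u: "x = 2 ^ v * u" by (blast elim: dvdE)
  have "\<not> 2 ^ Suc v dvd x"
    using Greatest_le_nat[of "\<lambda>v. 2 ^ v dvd x" "Suc v" i] bound unfolding v_def by fastforce
  then have "\<not> 2 dvd u" unfolding u by (auto simp: mult.commute)
  then show ?thesis using that[of v u] u by (simp add: z2adic_unit_iff)
qed

lemma residue_8_unit:
  assumes "(u :: z2adic) dvd 1"
  shows "residue u 3 \<in> {1, 3, 5, 7}"
proof -
  have "residue u 1 \<noteq> 0" using assms residue_eq_0_iff_dvd[of u 1] by (simp add: z2adic_unit_iff)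
  then have "odd (residue u 3)"
    using residue_mod[of 1 3 u] by (auto simp: even_iff_mod_2_eq_zero)
  moreover have "0 \<le> residue u 3" "residue u 3 < 8" using residue_range[of u 3] by auto
  ultimately have "residue u 3 = 1 \<or> residue u 3 = 3 \<or> residue u 3 = 5 \<or> residue u 3 = 7"
    by presburger
  then show ?thesis by blast
qed

text \<open>Odd squares are 1 modulo 8, and every unit that is 1 modulo 8 is a square. Determinants
  modulo unit squares thus become residues modulo 8.\<close>

lemma unit_eq_mod_squares_iff:
  assumes u: "(u :: z2adic) dvd 1" and w: "w dvd 1"
  shows "(\<exists>v. v dvd 1 \<and> u = w * v\<^sup>2) \<longleftrightarrow> residue u 3 = residue w 3"
proof
  assume "\<exists>v. v dvd 1 \<and> u = w * v\<^sup>2"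
  then obtain v where v: "v dvd 1" "u = w * v\<^sup>2" by blast
  have "residue (v\<^sup>2) 3 = 1" using residue_8_unit[OF v(1)]
    by (auto simp: power2_eq_square residue_mult)
  then show "residue u 3 = residue w 3" using v residue_self_mod[of w 3] by (simp add: residue_mult)
next
  assume eq: "residue u 3 = residue w 3"
  obtain w' where w': "1 = w * w'" using w by (blast elim: dvdE)
  have "8 dvd (u - w) * w'" using eq residue_eq_iff_dvd[of u 3 w] by simp
  then have "8 dvd u * w' - 1" using w' by (simp add: algebra_simps)
  then obtain v where "v dvd 1" "u * w' = v\<^sup>2" using unit_square_if_cong_1_mod_8 by blast
  moreover from this have "u = w * v\<^sup>2" using w' by (metis mult.commute mult.left_commute mult_1)
  ultimately show "\<exists>v. v dvd 1 \<and> u = w * v\<^sup>2" by blast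
qed

section \<open>Isometries of Gram matrices\<close>

lemma invertible_mat_if_det_unit:
  assumes U: "U \<in> carrier_mat n n" and "det U dvd (1 :: 'a :: comm_ring_1)"
  shows "invertible_mat U"
proof -
  obtain d where d: "1 = det U * d" using assms(2) by (blast elim: dvdE)
  have adj: "adj_mat U \<in> carrier_mat n n" by (rule adj_mat[OF U])
  have "U * (d \<cdot>\<^sub>m adj_mat U) = 1\<^sub>m n" "(d \<cdot>\<^sub>m adj_mat U) * U = 1\<^sub>m n"
    using mult_smult_distrib[OF U adj, of d] mult_smult_assoc_mat[OF adj U, of d]
      adj_mat(2,3)[OF U] d
    by (auto simp: mult.commute intro!: eq_matI)
  then show ?thesis
    unfolding invertible_mat_def inverts_mat_def using U adj by fastforce
qed

lemma z2_isometricI: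
  assumes "G \<in> carrier_mat n n" "U \<in> carrier_mat n n" "det U dvd 1" "H = transpose_mat U * G * U"
  shows "z2_isometric G H"
  using assms invertible_mat_if_det_unit unfolding z2_isometric_def by auto

lemma z2_isometricE:
  assumes "G \<in> carrier_mat n n" "z2_isometric G H"
  obtains U V where "U \<in> carrier_mat n n" "V \<in> carrier_mat n n" "U * V = 1\<^sub>m n" "V * U = 1\<^sub>m n"
    "H = transpose_mat U * G * U"
proof -
  obtain U where U: "U \<in> carrier_mat n n" "invertible_mat U" "H = transpose_mat U * G * U"
    using assms unfolding z2_isometric_def by auto
  obtain V where "V \<in> carrier_mat n n" "U * V = 1\<^sub>m n" "V * U = 1\<^sub>m n"
    using invertible_matE[OF U(1,2)] by blast
  then show ?thesis using that U by blast
qed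

lemma z2_isometric_carrier:
  "G \<in> carrier_mat n n \<Longrightarrow> z2_isometric G H \<Longrightarrow> H \<in> carrier_mat n n"
  by (erule (1) z2_isometricE) auto

lemma det_congruence:
  assumes "G \<in> carrier_mat n n" "U \<in> carrier_mat n n"
  shows "det (transpose_mat U * G * U) = (det U)\<^sup>2 * det (G :: 'a :: comm_ring_1 mat)"
proof -
  have "det (transpose_mat U * G * U) = det (transpose_mat U) * det G * det U"
    using assms by (metis det_mult mult_carrier_mat transpose_carrier_mat)
  then show ?thesis using det_transpose[OF assms(2)] by (simp add: power2_eq_square ac_simps)
qed

lemma z2_isometric_det:
  assumes "G \<in> carrier_mat n n" "z2_isometric G H"
  obtains u where "u dvd 1" "det H = det G * u\<^sup>2"
proof -
  obtain U V where U: "U \<in> carrier_mat n n" "V \<in> carrier_mat n n" "U * V = 1\<^sub>m n"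
    and H: "H = transpose_mat U * G * U"
    using assms by (rule z2_isometricE)
  have "det U * det V = 1" using det_mult[OF U(1,2)] U(3) by simp
  then have "det U dvd 1" by (metis dvd_triv_left)
  moreover have "det H = det G * (det U)\<^sup>2" unfolding H det_congruence[OF assms(1) U(1)] by simp
  ultimately show ?thesis by (rule that)
qed

text \<open>The determinant of \<open>H\<close> is that of \<open>G\<close> times the square of that
  of \<open>U\<close>, so a unit determinant of \<open>H\<close> forces \<open>U\<close> to be
  invertible. Explicit base changes below need no explicit inverse.\<close>

lemma z2_isometric_if_unimodular:
  assumes "G \<in> carrier_mat n n" "U \<in> carrier_mat n n" "det H dvd 1" "H = transpose_mat U * G * U"
  shows "z2_isometric G H"
proof (rule z2_isometricI[OF assms(1,2) _ assms(4)])
  have "det U dvd det H"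
    unfolding assms(4) det_congruence[OF assms(1,2)] by (simp add: power2_eq_square)
  then show "det U dvd 1" using assms(3) dvd_trans by blast
qed

lemma congruence_index:
  assumes "G \<in> carrier_mat n n" "U \<in> carrier_mat n n" "i < n" "j < n"
  shows "(transpose_mat U * G * U) $$ (i, j) =
    (\<Sum>k = 0..<n. U $$ (k, i) * (\<Sum>l = 0..<n. G $$ (k, l) * (U $$ (l, j) :: 'a :: comm_ring_1)))"
  using assms by (auto simp: scalar_prod_def intro!: sum.cong)

lemma z2_isometric_smult:
  assumes G: "G \<in> carrier_mat n n" and "z2_isometric G H"
  shows "z2_isometric (c \<cdot>\<^sub>m G) (c \<cdot>\<^sub>m H)"
proof -
  obtain U where U: "U \<in> carrier_mat n n" "invertible_mat U" and H: "H = transpose_mat U * G * U"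
    using assms unfolding z2_isometric_def by auto
  have "c \<cdot>\<^sub>m H = transpose_mat U * (c \<cdot>\<^sub>m G) * U"
    unfolding H using G U(1)
    by (metis mult_carrier_mat mult_smult_assoc_mat mult_smult_distrib transpose_carrier_mat)
  then show ?thesis unfolding z2_isometric_def using G U by auto
qed

abbreviation dsum :: "'a :: zero mat \<Rightarrow> 'a mat \<Rightarrow> 'a mat" where
  "dsum A B \<equiv> four_block_mat A (0\<^sub>m (dim_row A) (dim_col B)) (0\<^sub>m (dim_row B) (dim_col A)) B"

lemma dsum_mult:
  assumes "A \<in> carrier_mat n n" "B \<in> carrier_mat m m" "A' \<in> carrier_mat n n" "B' \<in> carrier_mat m m"
  shows "four_block_mat A (0\<^sub>m n m) (0\<^sub>m m n) B * four_block_mat A' (0\<^sub>m n m) (0\<^sub>m m n) B'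
    = four_block_mat (A * A') (0\<^sub>m n m) (0\<^sub>m m n) (B * (B' :: 'a :: comm_ring_1 mat))"
  using assms by (auto simp: mult_four_block_mat[of _ n n _ m _ m _ _ n _ m])

lemma dsum_transpose:
  assumes "A \<in> carrier_mat n n" "B \<in> carrier_mat m m"
  shows "transpose_mat (dsum A B) = dsum (transpose_mat A) (transpose_mat B)"
  using assms by (auto simp: transpose_four_block_mat[of _ n n _ m _ m])

lemma z2_isometric_dsum:
  assumes A: "A \<in> carrier_mat n n" and B: "B \<in> carrier_mat m m"
    and "z2_isometric A A'" "z2_isometric B B'"
  shows "z2_isometric (dsum A B) (dsum A' B')"
proof -
  obtain U U' where U: "U \<in> carrier_mat n n" "U' \<in> carrier_mat n n" "U * U' = 1\<^sub>m n" "U' * U = 1\<^sub>m n"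
    and A': "A' = transpose_mat U * A * U"
    using assms(1,3) by (rule z2_isometricE)
  obtain V V' where V: "V \<in> carrier_mat m m" "V' \<in> carrier_mat m m" "V * V' = 1\<^sub>m m" "V' * V = 1\<^sub>m m"
    and B': "B' = transpose_mat V * B * V"
    using assms(2,4) by (rule z2_isometricE)
  have car: "dsum U V \<in> carrier_mat (n + m) (n + m)" "dsum U' V' \<in> carrier_mat (n + m) (n + m)"
    using U V by auto
  have "dsum U V * dsum U' V' = 1\<^sub>m (n + m)" "dsum U' V' * dsum U V = 1\<^sub>m (n + m)"
    using U V by (simp_all add: dsum_mult[of _ n _ m])
  then have inv: "invertible_mat (dsum U V)" using car by (intro invertible_matI)
  have "dsum A' B' = transpose_mat (dsum U V) * dsum A B * dsum U V"
    unfolding A' B' dsum_transpose[OF U(1) V(1)]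
    using U V A B by (simp add: dsum_mult[of _ n _ m])
  then show ?thesis
    using inv car A B unfolding z2_isometric_def by (intro bexI[of _ "dsum U V"]) auto
qed

lemma z2_isometric_dsum_swap:
  assumes A: "A \<in> carrier_mat n n" and B: "B \<in> carrier_mat m m"
  shows "z2_isometric (dsum A B) (dsum B A)"
proof -
  define U :: "z2adic mat" where "U = four_block_mat (0\<^sub>m n m) (1\<^sub>m n) (1\<^sub>m m) (0\<^sub>m m n)"
  define V :: "z2adic mat" where "V = four_block_mat (0\<^sub>m m n) (1\<^sub>m m) (1\<^sub>m n) (0\<^sub>m n m)"
  have Ut: "transpose_mat U = V"
    unfolding U_def V_def by (subst transpose_four_block_mat[of _ n m _ n _ m]) auto
  have car: "U \<in> carrier_mat (n + m) (n + m)" "V \<in> carrier_mat (n + m) (n + m)"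
    unfolding U_def V_def by auto
  have "U * V = 1\<^sub>m (n + m)" "V * U = 1\<^sub>m (n + m)"
    unfolding U_def V_def
    by (subst mult_four_block_mat[of _ n m _ n _ m _ _ n _ m], auto)
      (subst mult_four_block_mat[of _ m n _ m _ n _ _ m _ n], auto simp: add.commute)
  then have inv: "invertible_mat U" using car by (intro invertible_matI)
  have "V * dsum A B = four_block_mat (0\<^sub>m m n) B A (0\<^sub>m n m)"
    unfolding V_def using A B by (subst mult_four_block_mat[of _ m n _ m _ n _ _ n _ m]) auto
  then have "dsum B A = V * dsum A B * U"
    unfolding U_def using A B by (simp add: mult_four_block_mat[of _ m n _ m _ n _ _ m _ n])
  then show ?thesis
    using inv car A B unfolding z2_isometric_def Ut[symmetric] by (intro bexI[of _ U]) auto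
qed

text \<open>Block elimination: the base change with upper right block \<open>- A' * B\<close> clears
  the mixed blocks and leaves the Schur complement.\<close>

lemma z2_isometric_split:
  assumes A: "A \<in> carrier_mat n n" and B: "B \<in> carrier_mat n m" and C: "C \<in> carrier_mat m m"
    and sym: "transpose_mat A = A" and A': "A' \<in> carrier_mat n n" "A * A' = 1\<^sub>m n" "A' * A = 1\<^sub>m n"
  shows "z2_isometric (four_block_mat A B (transpose_mat B) C) (dsum A (C - transpose_mat B * A' * B))"
proof -
  define X where "X = - (A' * B)"
  define U where "U = four_block_mat (1\<^sub>m n) X (0\<^sub>m m n) (1\<^sub>m m)"
  define V where "V = four_block_mat (1\<^sub>m n) (- X) (0\<^sub>m m n) (1\<^sub>m m)"
  have X: "X \<in> carrier_mat n m" using A' B by (simp add: X_def)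
  have car: "U \<in> carrier_mat (n + m) (n + m)" "V \<in> carrier_mat (n + m) (n + m)"
    unfolding U_def V_def by auto
  have XX: "X + - X = 0\<^sub>m n m" "- X + X = 0\<^sub>m n m" "- 0\<^sub>m m m + 1\<^sub>m m = (1\<^sub>m m :: z2adic mat)"
    using X by (auto intro!: eq_matI)
  have "U * V = 1\<^sub>m (n + m)" "V * U = 1\<^sub>m (n + m)"
    unfolding U_def V_def
    using X XX by (simp_all add: mult_four_block_mat[of _ n n _ m _ m _ _ n _ m])
  then have inv: "invertible_mat U" using car by (intro invertible_matI)
  have Ut: "transpose_mat U = four_block_mat (1\<^sub>m n) (0\<^sub>m n m) (transpose_mat X) (1\<^sub>m m)"
    unfolding U_def using X by (subst transpose_four_block_mat[of _ n n _ m _ m]) auto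
  have AX: "A * X = - B"
    unfolding X_def using A A' B by (simp add: assoc_mult_mat[symmetric, of _ n n _ n _ m])
  have XtA: "transpose_mat X * A = - transpose_mat B"
    using arg_cong[OF AX, of transpose_mat] A X B sym
    by (simp add: transpose_mult[of _ n n _ m] transpose_uminus)
  have BB: "- B + B = 0\<^sub>m n m" "- transpose_mat B + transpose_mat B = 0\<^sub>m m n"
    using B by (auto intro!: eq_matI)
  have 1: "transpose_mat U * four_block_mat A B (transpose_mat B) C
      = four_block_mat A B (0\<^sub>m m n) (transpose_mat X * B + C)"
    unfolding Ut using A B C X XtA BB
    by (simp add: mult_four_block_mat[of _ n n _ m _ m _ _ n _ m])
  have sA': "transpose_mat A' = A'"
  proof -
    have "transpose_mat A' * A = 1\<^sub>m n" using transpose_mult[OF A A'(1)] A'(2) sym by simp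
    then have "transpose_mat A' * A * A' = A'" using A'(1) by simp
    then show ?thesis using A A' by (simp add: assoc_mult_mat[of _ n n _ n _ n])
  qed
  have "transpose_mat X = - (transpose_mat B * A')"
    unfolding X_def using A' B sA' by (simp add: transpose_uminus transpose_mult[of A' n n B m])
  then have XB': "transpose_mat X * B = - (transpose_mat B * A' * B)"
    using A' B by simp
  have "transpose_mat U * four_block_mat A B (transpose_mat B) C * U
      = dsum A (transpose_mat X * B + C)"
    unfolding 1 unfolding U_def using A B C X AX BB
    by (simp add: mult_four_block_mat[of _ n n _ m _ m _ _ n _ m])
  moreover have "transpose_mat X * B + C = C - transpose_mat B * A' * B"
    unfolding XB' using A' B C by (auto intro!: eq_matI)
  ultimately show ?thesis
    using inv car A C unfolding z2_isometric_def by (intro bexI[of _ U]) auto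
qed

lemma z2_isometric_permute:
  assumes G: "G \<in> carrier_mat n n" and p: "p permutes {..<n}"
  shows "z2_isometric G (mat n n (\<lambda>(i, j). G $$ (p i, p j)))"
proof -
  define U :: "z2adic mat" where "U = mat n n (\<lambda>(i, j). if i = p j then 1 else 0)"
  have U: "U \<in> carrier_mat n n" by (simp add: U_def)
  have lt: "p i < n" if "i < n" for i using permutes_in_image[OF p] that by auto
  have inj: "p i = p j \<longleftrightarrow> i = j" for i j using permutes_inj[OF p] by (auto dest: injD)
  have UtU: "transpose_mat U * U = 1\<^sub>m n"
    by (rule eq_matI) (auto simp: U_def scalar_prod_def inj lt if_distrib[of "\<lambda>x. x * _"] cong: if_cong)
  have "det U * det U = 1"
    using det_mult[of "transpose_mat U" n U] det_transpose[OF U] U UtU by simp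
  then have dU: "det U dvd 1" by (metis dvd_triv_left)
  show ?thesis
  proof (rule z2_isometricI[OF G U dU], rule eq_matI)
    fix i j assume ij: "i < dim_row (transpose_mat U * G * U)" "j < dim_col (transpose_mat U * G * U)"
    then have "i < n" "j < n" using U by auto
    then show "mat n n (\<lambda>(i, j). G $$ (p i, p j)) $$ (i, j) = (transpose_mat U * G * U) $$ (i, j)"
      unfolding congruence_index[OF G U \<open>i < n\<close> \<open>j < n\<close>]
      by (simp add: U_def lt if_distrib[of "\<lambda>x. x * _"] if_distrib[of "\<lambda>x. _ * x"] cong: if_cong)
  qed (use U in auto)
qed

section \<open>Binary even lattices and block decompositions\<close>

definition mat2 :: "'a \<Rightarrow> 'a \<Rightarrow> 'a \<Rightarrow> 'a \<Rightarrow> 'a mat" where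
  "mat2 a b c d = mat 2 2 (\<lambda>(i, j). if i = 0 then if j = 0 then a else b else if j = 0 then c else d)"

lemma mat2_carrier [simp]: "mat2 a b c d \<in> carrier_mat 2 2"
  by (simp add: mat2_def)

lemma mat2_dim [simp]: "dim_row (mat2 a b c d) = 2" "dim_col (mat2 a b c d) = 2"
  by (simp_all add: mat2_def)

lemma mat2_eq_iff: "mat2 a b c d = mat2 a' b' c' d' \<longleftrightarrow> a = a' \<and> b = b' \<and> c = c' \<and> d = d'"
proof
  assume eq: "mat2 a b c d = mat2 a' b' c' d'"
  show "a = a' \<and> b = b' \<and> c = c' \<and> d = d'"
    using arg_cong[OF eq, of "\<lambda>M. M $$ (0, 0)"] arg_cong[OF eq, of "\<lambda>M. M $$ (0, 1)"]
      arg_cong[OF eq, of "\<lambda>M. M $$ (1, 0)"] arg_cong[OF eq, of "\<lambda>M. M $$ (1, 1)"]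
    by (simp add: mat2_def)
qed simp

lemma det_mat2: "det (mat2 a b c d) = a * d - b * (c :: 'a :: comm_ring_1)"
proof -
  have "det (mat2 a b c d) = (\<Sum>i<2. mat2 a b c d $$ (i, 0) * cofactor (mat2 a b c d) i 0)"
    by (rule laplace_expansion_column) auto
  then show ?thesis
    by (simp add: numeral_2_eq_2 cofactor_def mat_delete_def mat2_def det_single)
qed

lemma mat2_mult:
  "mat2 a b c d * mat2 a' b' c' d' =
     mat2 (a * a' + b * c') (a * b' + b * d') (c * a' + d * c') (c * b' + d * (d' :: 'a :: comm_ring_1))"
  by (rule eq_matI) (auto simp: mat2_def scalar_prod_def numeral_2_eq_2 less_Suc_eq)

lemma mat2_transpose: "transpose_mat (mat2 a b c d) = mat2 a c b d"
  by (rule eq_matI) (auto simp: mat2_def)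

lemma mat2_isometricI:
  assumes "det (mat2 p q r s) dvd 1"
    and "a * p * p + 2 * b * p * r + c * r * r = a'"
    and "a * p * q + b * (p * s + q * r) + c * r * s = b'"
    and "a * q * q + 2 * b * q * s + c * s * s = c'"
  shows "z2_isometric (mat2 a b b c) (mat2 a' b' b' c')"
proof (rule z2_isometricI[OF _ _ assms(1)])
  show "mat2 a' b' b' c' = transpose_mat (mat2 p q r s) * mat2 a b b c * mat2 p q r s"
    unfolding assms(2-4)[symmetric] mat2_transpose mat2_mult mat2_eq_iff by (simp add: algebra_simps)
qed auto

lemma z2adic_odd_add_2: "\<not> 2 dvd (x :: z2adic) \<Longrightarrow> \<not> 2 dvd x + 2 * y"
  by (simp add: dvd_add_left_iff)

lemma z2adic_odd_mult: "2 dvd x * y \<longleftrightarrow> 2 dvd x \<or> 2 dvd (y :: z2adic)"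
  using z2adic_unit_iff by (metis is_unit_mult_iff)

text \<open>The vector \<open>v = (x, 1)\<close> is isotropic when
  \<open>a * x^2 + x + c = 0\<close>, which is solvable because \<open>c\<close> is even. It pairs
  with the first basis vector to the unit \<open>1 + 2 * a * x\<close>, with inverse
  \<open>b\<close>. So \<open>b\<close> times that vector pairs to 1 with \<open>v\<close>, and
  subtracting \<open>a * b^2 * v\<close> makes it isotropic.\<close>

lemma even_block_to_Hyp:
  assumes "2 dvd c"
  shows "z2_isometric (mat2 (2 * a) 1 1 (2 * c)) (mat2 0 1 1 (0 :: z2adic))"
proof -
  obtain g where g: "c = 2 * g" using assms by blast
  obtain x where x: "a * x\<^sup>2 + x + 2 * g = 0" using z2adic_hensel by blast
  have "\<not> 2 dvd 1 + 2 * (a * x)" using z2adic_two_not_unit by (rule z2adic_odd_add_2)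
  then obtain b where b: "1 = (1 + 2 * (a * x)) * b" using z2adic_unit_iff by (blast elim: dvdE)
  show ?thesis
  proof (rule mat2_isometricI[of x "b - a * b\<^sup>2 * x" 1 "- a * b\<^sup>2"])
    have "det (mat2 x (b - a * b\<^sup>2 * x) 1 (- a * b\<^sup>2)) * (- (1 + 2 * (a * x))) = 1"
      unfolding det_mat2 using b by (simp add: algebra_simps)
    then show "det (mat2 x (b - a * b\<^sup>2 * x) 1 (- a * b\<^sup>2)) dvd 1" by (metis dvd_triv_left)
    have "2 * a * x * x + 2 * 1 * x * 1 + 2 * c * 1 * 1 = 2 * (a * x\<^sup>2 + x + 2 * g)"
      by (simp add: g algebra_simps power2_eq_square)
    then show "2 * a * x * x + 2 * 1 * x * 1 + 2 * c * 1 * 1 = 0" using x by simp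
    have "2 * a * x * (b - a * b\<^sup>2 * x) + 1 * (x * (- a * b\<^sup>2) + (b - a * b\<^sup>2 * x) * 1) + 2 * c * 1 * (- a * b\<^sup>2)
        = (1 + 2 * (a * x)) * b - 2 * a * b\<^sup>2 * (a * x\<^sup>2 + x + 2 * g)"
      by (simp add: g algebra_simps power2_eq_square)
    then show "2 * a * x * (b - a * b\<^sup>2 * x) + 1 * (x * (- a * b\<^sup>2) + (b - a * b\<^sup>2 * x) * 1) + 2 * c * 1 * (- a * b\<^sup>2) = 1"
      using x b by simp
    have "2 * a * (b - a * b\<^sup>2 * x) * (b - a * b\<^sup>2 * x) + 2 * 1 * (b - a * b\<^sup>2 * x) * (- a * b\<^sup>2) + 2 * c * (- a * b\<^sup>2) * (- a * b\<^sup>2)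
        = 2 * a * b\<^sup>2 * (1 - (1 + 2 * (a * x)) * b) + 2 * a\<^sup>2 * b ^ 4 * (a * x\<^sup>2 + x + 2 * g)"
      by (simp add: g algebra_simps power2_eq_square power4_eq_xxxx)
    then show "2 * a * (b - a * b\<^sup>2 * x) * (b - a * b\<^sup>2 * x) + 2 * 1 * (b - a * b\<^sup>2 * x) * (- a * b\<^sup>2) + 2 * c * (- a * b\<^sup>2) * (- a * b\<^sup>2) = 0"
      using x b by simp
  qed
qed

text \<open>The new second basis vector \<open>(t, 1 - 2 * t)\<close> pairs to 1 with the first for
  every \<open>t\<close>. Its norm is \<open>2 * c + 2 * (1 - 4 * c) * (t - t^2)\<close>, and it
  becomes 2 for a root \<open>t\<close> of a quadratic equation; \<open>k\<close> is the inverse of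
  \<open>1 - 4 * c\<close>.\<close>

lemma even_block_to_Ani_aux:
  assumes "\<not> 2 dvd c"
  shows "z2_isometric (mat2 2 1 1 (2 * c)) (mat2 2 1 1 (2 :: z2adic))"
proof -
  have "\<not> 2 dvd 1 + 2 * (- 2 * c)" using z2adic_two_not_unit by (rule z2adic_odd_add_2)
  then obtain k where k: "1 = (1 + 2 * (- 2 * c)) * k" using z2adic_unit_iff by (blast elim: dvdE)
  obtain d where d: "c - 1 = 2 * d" using assms z2adic_two_dvd_or by (blast elim: dvdE)
  obtain t where t: "- 1 * t\<^sup>2 + t + 2 * (k * d) = 0" using z2adic_hensel by blast
  show ?thesis
  proof (rule mat2_isometricI[of 1 t 0 "1 - 2 * t"])
    show "det (mat2 1 t 0 (1 - 2 * t)) dvd 1"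
      unfolding det_mat2 using z2adic_odd_add_2[OF z2adic_two_not_unit, of "- t"]
      by (simp add: z2adic_unit_iff)
    have "2 * t * t + 2 * 1 * t * (1 - 2 * t) + 2 * c * (1 - 2 * t) * (1 - 2 * t)
        = 2 + 2 * (1 + 2 * (- 2 * c)) * (- 1 * t\<^sup>2 + t + k * (c - 1)) + 2 * (c - 1) * (1 - (1 + 2 * (- 2 * c)) * k)"
      by (simp add: algebra_simps power2_eq_square)
    then show "2 * t * t + 2 * 1 * t * (1 - 2 * t) + 2 * c * (1 - 2 * t) * (1 - 2 * t) = 2"
      using t k[symmetric] d by (simp add: mult.left_commute)
  qed (simp_all add: algebra_simps)
qed

lemma even_block_scale:
  assumes "b * b' = 1"
  shows "z2_isometric (mat2 a b b c) (mat2 a 1 1 (c * (b' :: z2adic)\<^sup>2))"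
proof (rule mat2_isometricI[of 1 0 0 b'])
  show "det (mat2 1 0 0 b') dvd 1" unfolding det_mat2 using assms by (simp add: dvd_def) (metis mult.commute)
qed (use assms in \<open>simp_all add: power2_eq_square\<close>)

text \<open>As \<open>c - 1\<close> is even, \<open>a * x^2 + x + (c - 1) = 0\<close> is solvable,
  and then \<open>(x, 1)\<close> has norm 2. With this as first basis vector the auxiliary lemma
  applies.\<close>

lemma even_block_to_Ani:
  assumes "\<not> 2 dvd a" "\<not> 2 dvd c"
  shows "z2_isometric (mat2 (2 * a) 1 1 (2 * c)) (mat2 2 1 1 (2 :: z2adic))"
proof -
  obtain g where g: "c - 1 = 2 * g" using assms(2) z2adic_two_dvd_or by (blast elim: dvdE)
  obtain x where x: "a * x\<^sup>2 + x + 2 * g = 0" using z2adic_hensel by blast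
  have "\<not> 2 dvd 1 + 2 * (a * x)" using z2adic_two_not_unit by (rule z2adic_odd_add_2)
  then obtain b where b: "(1 + 2 * (a * x)) * b = 1" using z2adic_unit_iff by (metis dvdE)
  have 1: "z2_isometric (mat2 (2 * a) 1 1 (2 * c)) (mat2 2 (1 + 2 * (a * x)) (1 + 2 * (a * x)) (2 * a))"
  proof (rule mat2_isometricI[of x 1 1 0])
    have "2 * a * x * x + 2 * 1 * x * 1 + 2 * c * 1 * 1 = 2 * (a * x\<^sup>2 + x + (c - 1)) + 2"
      by (simp add: algebra_simps power2_eq_square)
    then show "2 * a * x * x + 2 * 1 * x * 1 + 2 * c * 1 * 1 = 2" using x g by simp
  qed (simp_all add: det_mat2)
  have 2: "z2_isometric (mat2 2 (1 + 2 * (a * x)) (1 + 2 * (a * x)) (2 * a)) (mat2 2 1 1 (2 * a * b\<^sup>2))"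
    by (rule even_block_scale[OF b])
  have "\<not> 2 dvd b" using b z2adic_unit_iff by (metis dvd_triv_right)
  then have "\<not> 2 dvd a * b\<^sup>2" using assms(1) by (simp add: z2adic_odd_mult power2_eq_square)
  then have 3: "z2_isometric (mat2 2 1 1 (2 * a * b\<^sup>2)) (mat2 2 1 1 2)"
    using even_block_to_Ani_aux[of "a * b\<^sup>2"] by (simp add: mult.assoc)
  show ?thesis by (rule z2_isometric_trans[OF mat2_carrier z2_isometric_trans[OF mat2_carrier 1 2] 3])
qed

text \<open>The determinant \<open>4 * a * c - b^2\<close> is 3 or -1 modulo 8 according to whether
  \<open>a * c\<close> is odd or even; this is what distinguishes the two planes.\<close>

lemma even_unimodular_binary:
  assumes "b dvd (1 :: z2adic)"
  shows "z2_isometric (mat2 (2 * a) b b (2 * c)) (if 2 dvd a * c then mat2 0 1 1 0 else mat2 2 1 1 2)"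
proof -
  obtain b' where b: "b * b' = 1" using assms by (metis dvdE)
  have 1: "z2_isometric (mat2 (2 * a) b b (2 * c)) (mat2 (2 * a) 1 1 (2 * (c * b'\<^sup>2)))"
    using even_block_scale[OF b, of "2 * a" "2 * c"] by (simp add: mult.assoc)
  have nb: "\<not> 2 dvd b'" using b z2adic_unit_iff by (metis dvd_triv_right)
  then have odd: "2 dvd c * b'\<^sup>2 \<longleftrightarrow> 2 dvd c" by (simp add: z2adic_odd_mult power2_eq_square)
  have swap: "z2_isometric (mat2 (2 * a) 1 1 (2 * (c * b'\<^sup>2))) (mat2 (2 * (c * b'\<^sup>2)) 1 1 (2 * a))"
    by (rule mat2_isometricI[of 0 1 1 0]) (simp_all add: det_mat2)
  have "z2_isometric (mat2 (2 * a) 1 1 (2 * (c * b'\<^sup>2)))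
      (if 2 dvd a * c then mat2 0 1 1 0 else mat2 2 1 1 2)"
  proof (cases "2 dvd a * c")
    case True
    then consider "2 dvd c" | "2 dvd a" by (auto simp: z2adic_odd_mult)
    then show ?thesis
    proof cases
      case 1
      then show ?thesis using True odd even_block_to_Hyp by simp
    next
      case 2
      then show ?thesis
        using True z2_isometric_trans[OF mat2_carrier swap even_block_to_Hyp[OF 2]] by simp
    qed
  next
    case False
    then show ?thesis using odd even_block_to_Ani by (simp add: z2adic_odd_mult)
  qed
  then show ?thesis by (rule z2_isometric_trans[OF mat2_carrier 1])
qed

section \<open>Lists of blocks as orthogonal sums\<close>

datatype z2_block = Unary nat int | Hyp nat | Ani nat

fun block_mat :: "z2_block \<Rightarrow> z2adic mat" where
  "block_mat (Unary e u) = mat 1 1 (\<lambda>_. 2 ^ e * of_int u)"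
| "block_mat (Hyp e) = mat2 0 (2 ^ e) (2 ^ e) 0"
| "block_mat (Ani e) = mat2 (2 * 2 ^ e) (2 ^ e) (2 ^ e) (2 * 2 ^ e)"

fun block_rank :: "z2_block \<Rightarrow> nat" where
  "block_rank (Unary e u) = 1" | "block_rank (Hyp e) = 2" | "block_rank (Ani e) = 2"

fun block_scale :: "z2_block \<Rightarrow> nat" where
  "block_scale (Unary e u) = e" | "block_scale (Hyp e) = e" | "block_scale (Ani e) = e"

fun block_unit :: "z2_block \<Rightarrow> int" where
  "block_unit (Unary e u) = u" | "block_unit (Hyp e) = -1" | "block_unit (Ani e) = 3"

fun shift_block :: "nat \<Rightarrow> z2_block \<Rightarrow> z2_block" where
  "shift_block k (Unary e u) = Unary (k + e) u"
| "shift_block k (Hyp e) = Hyp (k + e)"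
| "shift_block k (Ani e) = Ani (k + e)"

definition blocks_mat :: "z2_block list \<Rightarrow> z2adic mat" where
  "blocks_mat xs = diag_block_mat (map block_mat xs)"

definition blocks_rank :: "z2_block list \<Rightarrow> nat" where
  "blocks_rank xs = sum_list (map block_rank xs)"

definition blocks_isometric :: "z2_block list \<Rightarrow> z2_block list \<Rightarrow> bool" (infix "\<approx>" 50) where
  "xs \<approx> ys \<longleftrightarrow> z2_isometric (blocks_mat xs) (blocks_mat ys)"

lemma block_mat_dim [simp]:
  "dim_row (block_mat b) = block_rank b" "dim_col (block_mat b) = block_rank b"
  by (cases b; simp)+

lemma blocks_mat_dim [simp]:
  "dim_row (blocks_mat xs) = blocks_rank xs" "dim_col (blocks_mat xs) = blocks_rank xs"
  by (simp_all add: blocks_mat_def blocks_rank_def dim_diag_block_mat comp_def)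

lemma blocks_mat_carrier [simp]: "blocks_mat xs \<in> carrier_mat (blocks_rank xs) (blocks_rank xs)"
  by (intro carrier_matI) simp_all

lemma blocks_mat_append: "blocks_mat (xs @ ys) = dsum (blocks_mat xs) (blocks_mat ys)"
  by (simp add: blocks_mat_def diag_block_mat_append Let_def)

lemma blocks_mat_singleton: "blocks_mat [b] = block_mat b"
  unfolding blocks_mat_def list.map by (rule diag_block_mat_singleton)

lemma blocks_rank_append [simp]: "blocks_rank (xs @ ys) = blocks_rank xs + blocks_rank ys"
  by (simp add: blocks_rank_def)

lemma blocks_rank_simps [simp]: "blocks_rank [] = 0" "blocks_rank (x # xs) = block_rank x + blocks_rank xs"
  by (simp_all add: blocks_rank_def)

lemma blocks_isometric_refl [simp]: "xs \<approx> xs"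
  unfolding blocks_isometric_def using z2_isometric_refl blocks_mat_carrier by blast

lemma blocks_isometric_sym: "xs \<approx> ys \<Longrightarrow> ys \<approx> xs"
  unfolding blocks_isometric_def using z2_isometric_sym blocks_mat_carrier by blast

lemma blocks_isometric_trans [trans]: "xs \<approx> ys \<Longrightarrow> ys \<approx> zs \<Longrightarrow> xs \<approx> zs"
  unfolding blocks_isometric_def using z2_isometric_trans blocks_mat_carrier by blast

lemma blocks_isometric_append: "xs \<approx> xs' \<Longrightarrow> ys \<approx> ys' \<Longrightarrow> xs @ ys \<approx> xs' @ ys'"
  unfolding blocks_isometric_def blocks_mat_append
  using z2_isometric_dsum blocks_mat_carrier by blast

lemma blocks_isometric_Cons: "xs \<approx> ys \<Longrightarrow> x # xs \<approx> x # ys"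
  using blocks_isometric_append[of "[x]" "[x]" xs ys] by simp

lemma blocks_isometric_swap: "xs @ ys \<approx> ys @ xs"
  unfolding blocks_isometric_def blocks_mat_append
  using z2_isometric_dsum_swap blocks_mat_carrier by blast

lemma blocks_isometric_mset: "mset xs = mset ys \<Longrightarrow> xs \<approx> ys"
proof (induction xs arbitrary: ys)
  case (Cons x xs)
  then have "x \<in> set ys" by (metis list.set_intros(1) set_mset_mset)
  then obtain as bs where ys: "ys = as @ x # bs" by (meson split_list)
  with Cons.prems have "xs \<approx> as @ bs" by (intro Cons.IH) simp
  then have "x # xs \<approx> ([x] @ as) @ bs" using blocks_isometric_Cons by simp
  also have "\<dots> \<approx> (as @ [x]) @ bs"
    by (intro blocks_isometric_append blocks_isometric_swap blocks_isometric_refl)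
  finally show ?case by (simp add: ys)
qed simp

lemma blocks_isometric_rank: "xs \<approx> ys \<Longrightarrow> blocks_rank xs = blocks_rank ys"
  unfolding blocks_isometric_def using z2_isometric_carrier[OF blocks_mat_carrier] blocks_mat_dim
  by (metis carrier_matD(1))

lemma block_mat_shift: "block_mat (shift_block k b) = 2 ^ k \<cdot>\<^sub>m block_mat b"
  by (cases b) (auto simp: mat2_def power_add ac_simps intro!: eq_matI)

lemma blocks_mat_shift: "blocks_mat (map (shift_block k) xs) = 2 ^ k \<cdot>\<^sub>m blocks_mat xs"
proof (induction xs)
  case (Cons x xs)
  have [simp]: "block_rank (shift_block k b) = block_rank b" for b by (cases b) auto
  have [simp]: "blocks_rank (map (shift_block k) xs) = blocks_rank xs"
    by (simp add: blocks_rank_def comp_def)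
  have "blocks_mat (map (shift_block k) ([x] @ xs)) = 2 ^ k \<cdot>\<^sub>m blocks_mat ([x] @ xs)"
    unfolding map_append blocks_mat_append Cons
    by (rule eq_matI) (auto simp: blocks_mat_singleton block_mat_shift)
  then show ?case by simp
qed (auto simp: blocks_mat_def intro!: eq_matI)

text \<open>Multiplying the form by a power of 2 preserves isometries, so a relation between blocks
  of one scale has to be checked at scale 1 only.\<close>

lemma blocks_isometric_shift:
  "xs \<approx> ys \<Longrightarrow> map (shift_block k) xs \<approx> map (shift_block k) ys"
  unfolding blocks_isometric_def blocks_mat_shift
  using z2_isometric_smult blocks_mat_carrier by blast

lemma det_block_mat: "det (block_mat b) = 2 ^ (block_scale b * block_rank b) * of_int (block_unit b)"
  by (cases b) (simp_all add: det_single det_mat2 power_mult power2_eq_square algebra_simps mult_2_right power_add)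

lemma det_blocks_mat:
  "det (blocks_mat xs) = 2 ^ (\<Sum>b\<leftarrow>xs. block_scale b * block_rank b) * of_int (\<Prod>b\<leftarrow>xs. block_unit b)"
proof (induction xs)
  case (Cons x xs)
  have "det (blocks_mat ([x] @ xs)) = det (blocks_mat [x]) * det (blocks_mat xs)"
    unfolding blocks_mat_append
    by (rule det_four_block_mat_upper_right_zero[of _ "block_rank x" _ "blocks_rank xs"])
      (auto simp: blocks_mat_singleton intro: carrier_matI)
  then show ?case by (simp add: blocks_mat_singleton det_block_mat Cons power_add algebra_simps)
qed (simp add: blocks_mat_def)

lemma of_int_unit_iff: "(of_int u :: z2adic) dvd 1 \<longleftrightarrow> odd u"
proof -
  have "2 dvd (of_int u :: z2adic) \<longleftrightarrow> residue (of_int u) 1 = 0"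
    by (simp add: residue_eq_0_iff_dvd)
  also have "\<dots> \<longleftrightarrow> even u" by (simp add: residue_of_int even_iff_mod_2_eq_zero)
  finally show ?thesis by (simp add: z2adic_unit_iff)
qed

lemma unary_mat_isometric:
  assumes "w dvd 1" "odd u" "residue w 3 = u mod 8"
  shows "z2_isometric (mat 1 1 (\<lambda>_. 2 ^ e * w)) (block_mat (Unary e u))"
proof -
  have "residue (of_int u) 3 = residue w 3" using assms(3) by (simp add: residue_of_int)
  then obtain v where v: "v dvd 1" "of_int u = w * v\<^sup>2"
    using unit_eq_mod_squares_iff[of "of_int u" w] assms(1,2) of_int_unit_iff by blast
  show ?thesis
    by (rule z2_isometricI[of _ 1 "mat 1 1 (\<lambda>_. v)"])
      (use v in \<open>auto simp: det_single scalar_prod_def power2_eq_square algebra_simps intro!: eq_matI\<close>)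
qed

lemma Unary_mod_8:
  assumes "odd u" "u mod 8 = v mod 8"
  shows "[Unary e u] \<approx> [Unary e v]"
proof -
  have "odd v" using assms by presburger
  then show ?thesis
    unfolding blocks_isometric_def blocks_mat_singleton block_mat.simps(1)[of e u]
    using assms by (intro unary_mat_isometric) (simp_all add: of_int_unit_iff residue_of_int)
qed

lemma map_Unary_mod_8:
  assumes "list_all2 (\<lambda>u v. odd u \<and> u mod 8 = v mod 8) us vs"
  shows "map (Unary e) us \<approx> map (Unary e) vs"
  using assms
proof induction
  case (Cons u us v vs)
  then show ?case using blocks_isometric_append[OF Unary_mod_8[of u v e] Cons(3)] by simp
qed simp

section \<open>Relations between blocks\<close>

lemma blocks_mat_Unary_pair:
  "blocks_mat [Unary e a, Unary f b] = mat2 (2 ^ e * of_int a) 0 0 (2 ^ f * of_int b)"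
  by (rule eq_matI) (auto simp: blocks_mat_def mat2_def less_Suc_eq numeral_2_eq_2)

text \<open>The vector \<open>(1, 2)\<close> has norm \<open>a + 4 * b\<close>, and its orthogonal
  companion \<open>(- 2 * b, a)\<close> has norm \<open>a * b * (a + 4 * b)\<close>. The base change
  has the odd determinant \<open>a + 4 * b\<close>. Since \<open>4 * b\<close> and
  \<open>4 * a\<close> agree modulo 8 and odd squares are 1, these norms are \<open>5 * a\<close>
  and \<open>5 * b\<close> modulo 8.\<close>

lemma Unary_pair_times_5:
  assumes "odd a" "odd b"
  shows "[Unary e a, Unary e b] \<approx> [Unary e (5 * a), Unary e (5 * b)]"
proof -
  have "[Unary 0 a, Unary 0 b] \<approx> [Unary 0 (a + 4 * b), Unary 0 (a * b * (a + 4 * b))]"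
    unfolding blocks_isometric_def blocks_mat_Unary_pair
  proof (rule mat2_isometricI[of 1 "of_int (- 2 * b)" 2 "of_int a"])
    have "det (mat2 1 (of_int (- 2 * b)) 2 (of_int a)) = (of_int (a + 4 * b) :: z2adic)"
      by (simp add: det_mat2)
    then show "det (mat2 1 (of_int (- 2 * b)) 2 (of_int a)) dvd (1 :: z2adic)"
      using assms by (simp only: of_int_unit_iff) simp
  qed (simp_all add: algebra_simps)
  also have "\<dots> \<approx> [Unary 0 (5 * a), Unary 0 (5 * b)]"
  proof -
    have "(a + 4 * b) mod 8 = (5 * a) mod 8"
    proof -
      have "even (b - a)" using assms by simp
      then obtain c where "b - a = 2 * c" by (rule evenE)
      then have "a + 4 * b - 5 * a = 8 * c" by simp
      then show ?thesis by (simp add: mod_eq_dvd_iff)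
    qed
    moreover have "(a * b * (a + 4 * b)) mod 8 = (5 * b) mod 8"
    proof -
      obtain a' b' where ab: "a = 2 * a' + 1" "b = 2 * b' + 1" using assms by (metis oddE)
      have "even (a' * a' + a')" by simp
      then obtain k where k: "a' * a' + a' = 2 * k" by (rule evenE)
      have "a * b * (a + 4 * b) - 5 * b = 4 * b * (a' * a' + a') + 4 * (a * b * b - b)"
        by (simp add: ab algebra_simps)
      also have "\<dots> = 8 * (b * k + (a' * b * b + b' * b))"
        unfolding k by (simp add: ab algebra_simps)
      finally show ?thesis by (simp add: mod_eq_dvd_iff)
    qed
    moreover have "odd (a + 4 * b)" "odd (a * b * (a + 4 * b))" using assms by simp_all
    ultimately have "list_all2 (\<lambda>u v. odd u \<and> u mod 8 = v mod 8) [a + 4 * b, a * b * (a + 4 * b)] [5 * a, 5 * b]"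
      by (simp only: list_all2_Cons list_all2_Nil simp_thms)
    from map_Unary_mod_8[OF this, of 0] show ?thesis by (simp only: list.map)
  qed
  finally show ?thesis using blocks_isometric_shift[of _ _ e] by fastforce
qed

text \<open>The same argument with \<open>(1, 1)\<close> and its orthogonal companion
  \<open>(- 2 * b, a)\<close>. This relation links two neighbouring scales.\<close>

lemma Unary_adjacent_pair:
  assumes "odd a" "odd b"
  shows "[Unary 0 a, Unary 1 b] \<approx> [Unary 0 (a + 2 * b), Unary 1 (a * b * (a + 2 * b))]"
  unfolding blocks_isometric_def blocks_mat_Unary_pair
proof (rule mat2_isometricI[of 1 "of_int (- 2 * b)" 1 "of_int a"])
  have "det (mat2 1 (of_int (- 2 * b)) 1 (of_int a)) = (of_int (a + 2 * b) :: z2adic)"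
    by (simp add: det_mat2)
  then show "det (mat2 1 (of_int (- 2 * b)) 1 (of_int a)) dvd (1 :: z2adic)"
    using assms by (simp only: of_int_unit_iff) simp
qed (simp_all add: algebra_simps)

lemma congruence_eqI:
  assumes "G \<in> carrier_mat n n" "U \<in> carrier_mat n n" "H \<in> carrier_mat n n"
    and "\<And>i j. i < n \<Longrightarrow> j < n \<Longrightarrow>
      H $$ (i, j) = (\<Sum>k = 0..<n. U $$ (k, i) * (\<Sum>l = 0..<n. G $$ (k, l) * U $$ (l, j)))"
  shows "H = transpose_mat U * G * (U :: 'a :: comm_ring_1 mat)"
  using assms congruence_index[OF assms(1,2)] by (intro eq_matI) auto

lemma all_less_3: "(\<forall>i<3. P i) \<longleftrightarrow> P 0 \<and> P 1 \<and> P (2 :: nat)"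
  by (auto simp: less_Suc_eq numeral_3_eq_3 numeral_2_eq_2)

lemma all_less_4: "(\<forall>i<4. P i) \<longleftrightarrow> P 0 \<and> P 1 \<and> P 2 \<and> P (3 :: nat)"
  by (auto simp: less_Suc_eq eval_nat_numeral)

lemma sum_less_3: "sum f {0..<3} = f 0 + f 1 + f (2 :: nat)"
  by (simp add: eval_nat_numeral)

lemma sum_less_4: "sum f {0..<4} = f 0 + f 1 + f 2 + f (3 :: nat)"
  by (simp add: eval_nat_numeral)

lemma Unary_Hyp:
  assumes "odd a"
  shows "[Unary e a, Hyp e] \<approx> map (Unary e) [a, a, - a]"
proof -
  \<comment> \<open>The columns are pairwise orthogonal vectors of norms \<open>a\<close>,
    \<open>a\<close> and \<open>- a\<close>.\<close>
  define U :: "z2adic mat" where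
    "U = mat_of_rows_list 3 [[1, 1, 1], [1, 0, 1], [0, - of_int a, - of_int a]]"
  have "z2_isometric (blocks_mat [Unary 0 a, Hyp 0]) (blocks_mat (map (Unary 0) [a, a, - a]))"
  proof (rule z2_isometric_if_unimodular[of _ 3 U])
    show "det (blocks_mat (map (Unary 0) [a, a, - a])) dvd 1"
    proof -
      have "det (blocks_mat (map (Unary 0) [a, a, - a])) = of_int (- a * a * a)"
        by (simp add: det_blocks_mat)
      then show ?thesis using assms by (simp only: of_int_unit_iff) simp
    qed
    show "blocks_mat (map (Unary 0) [a, a, - a]) = transpose_mat U * blocks_mat [Unary 0 a, Hyp 0] * U"
    proof (rule congruence_eqI[of _ 3])
      have "\<forall>i<3. \<forall>j<3. blocks_mat (map (Unary 0) [a, a, - a]) $$ (i, j) =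
        (\<Sum>k = 0..<3. U $$ (k, i) * (\<Sum>l = 0..<3. blocks_mat [Unary 0 a, Hyp 0] $$ (k, l) * U $$ (l, j)))"
        unfolding all_less_3 sum_less_3
        by (simp add: blocks_mat_def mat2_def U_def mat_of_rows_list_def)
      then show "blocks_mat (map (Unary 0) [a, a, - a]) $$ (i, j) =
        (\<Sum>k = 0..<3. U $$ (k, i) * (\<Sum>l = 0..<3. blocks_mat [Unary 0 a, Hyp 0] $$ (k, l) * U $$ (l, j)))"
        if "i < 3" "j < 3" for i j using that by blast
    qed (auto simp: U_def mat_of_rows_list_def intro!: carrier_matI)
  qed (auto simp: U_def mat_of_rows_list_def intro!: carrier_matI)
  then have "[Unary 0 a, Hyp 0] \<approx> map (Unary 0) [a, a, - a]"
    by (simp add: blocks_isometric_def)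
  then show ?thesis using blocks_isometric_shift[of _ _ e] by fastforce
qed

lemma scaled_Ani_isometric:
  assumes "odd a"
  shows "z2_isometric (mat2 (2 * of_int a) (of_int a) (of_int a) (2 * of_int a)) (block_mat (Ani 0))"
  using even_unimodular_binary[of "of_int a" "of_int a" "of_int a"] assms of_int_unit_iff[of a]
  by (simp add: z2adic_odd_mult z2adic_unit_iff)

text \<open>Read from right to left: in \<open><b, b, b>\<close> with \<open>b = 3 * a\<close> the
  vector \<open>(1, 1, 1)\<close> has norm \<open>3 * b = 9 * a\<close>, which is \<open>a\<close>
  modulo 8. Its orthogonal complement, spanned by \<open>(1, -1, 0)\<close> and
  \<open>(0, -1, 1)\<close>, is \<open>Ani\<close> multiplied by \<open>b\<close>, hence again
  \<open>Ani\<close>. The base change has determinant -3, a unit.\<close>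

lemma Unary_Ani:
  assumes "odd a"
  shows "[Unary e a, Ani e] \<approx> map (Unary e) [3 * a, 3 * a, 3 * a]"
proof -
  define b where "b = 3 * a"
  have b: "odd b" using assms by (simp add: b_def)
  define U :: "z2adic mat" where
    "U = mat_of_rows_list 3 [[1, 1, 0], [1, -1, -1], [1, 0, 1]]"
  define H :: "z2adic mat" where
    "H = dsum (mat 1 1 (\<lambda>_. of_int (3 * b))) (mat2 (2 * of_int b) (of_int b) (of_int b) (2 * of_int b))"
  have "z2_isometric (blocks_mat (map (Unary 0) [b, b, b])) H"
  proof (rule z2_isometric_if_unimodular[of _ 3 U])
    have "det H = of_int (9 * b * b * b)"
      unfolding H_def by (subst det_four_block_mat_upper_right_zero[of _ 1 _ 2])
        (auto simp: det_single det_mat2 algebra_simps)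
    then show "det H dvd 1" using b by (simp only: of_int_unit_iff) simp
    show "H = transpose_mat U * blocks_mat (map (Unary 0) [b, b, b]) * U"
    proof (rule congruence_eqI[of _ 3])
      have "\<forall>i<3. \<forall>j<3. H $$ (i, j) =
        (\<Sum>k = 0..<3. U $$ (k, i) * (\<Sum>l = 0..<3. blocks_mat (map (Unary 0) [b, b, b]) $$ (k, l) * U $$ (l, j)))"
        unfolding all_less_3 sum_less_3
        by (simp add: blocks_mat_def mat2_def U_def H_def mat_of_rows_list_def)
      then show "H $$ (i, j) =
        (\<Sum>k = 0..<3. U $$ (k, i) * (\<Sum>l = 0..<3. blocks_mat (map (Unary 0) [b, b, b]) $$ (k, l) * U $$ (l, j)))"
        if "i < 3" "j < 3" for i j using that by blast
    qed (auto simp: U_def H_def mat_of_rows_list_def intro!: carrier_matI)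
  qed (auto simp: U_def mat_of_rows_list_def intro!: carrier_matI)
  moreover have "z2_isometric H (dsum (block_mat (Unary 0 (3 * b))) (block_mat (Ani 0)))"
    unfolding H_def
    by (rule z2_isometric_dsum[of _ 1 _ 2])
      (use scaled_Ani_isometric[OF b] z2_isometric_refl[of _ 1] in auto)
  moreover have "dsum (block_mat (Unary 0 (3 * b))) (block_mat (Ani 0)) = blocks_mat [Unary 0 (3 * b), Ani 0]"
    using blocks_mat_append[of "[Unary 0 (3 * b)]" "[Ani 0]"] by (simp only: blocks_mat_singleton) simp
  ultimately have "map (Unary 0) [b, b, b] \<approx> [Unary 0 (3 * b)] @ [Ani 0]"
    unfolding blocks_isometric_def using z2_isometric_trans[OF blocks_mat_carrier] by simp
  also have "\<dots> \<approx> [Unary 0 a] @ [Ani 0]"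
  proof (rule blocks_isometric_append[OF Unary_mod_8])
    show "odd (3 * b)" using b by simp
    show "3 * b mod 8 = a mod 8" by (simp add: mod_eq_dvd_iff b_def)
  qed simp
  finally have "map (shift_block e) ([Unary 0 a] @ [Ani 0]) \<approx> map (shift_block e) (map (Unary 0) [b, b, b])"
    using blocks_isometric_shift blocks_isometric_sym by blast
  then show ?thesis by (simp add: b_def)
qed

text \<open>\<open>Ani\<close> is isometric to its negative, and the sum of a form and its negative
  has many isotropic vectors. The columns of \<open>U\<close> are two isotropic pairs with inner
  product 3 that are orthogonal to each other.\<close>

lemma Ani_pair: "[Ani e, Ani e] \<approx> [Hyp e, Hyp e]"
proof -
  define U :: "z2adic mat" where
    "U = mat_of_rows_list 4 [[1, 1, 0, 0], [0, -1, 1, 1], [1, -1, 0, 1], [0, 0, 1, -1]]"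
  define G where "G = dsum (block_mat (Ani 0)) (mat2 (- 2) (- 1) (- 1) (- 2))"
  define H :: "z2adic mat" where "H = dsum (mat2 0 3 3 0) (mat2 0 3 3 0)"
  have eq: "blocks_mat [x, y] = dsum (block_mat x) (block_mat y)" for x y
    using blocks_mat_append[of "[x]" "[y]"] by (simp only: blocks_mat_singleton) simp
  have unit: "(of_int 3 :: z2adic) dvd 1" "(of_int 81 :: z2adic) dvd 1" "(of_int (- 1) :: z2adic) dvd 1"
    by (simp_all only: of_int_unit_iff) simp_all
  have m: "z2_isometric (mat2 (- 2) (- 1) (- 1) (- 2)) (block_mat (Ani 0))"
    using even_unimodular_binary[of "- 1" "- 1" "- 1"] unit(3) z2adic_two_not_unit by simp
  have h: "z2_isometric (mat2 0 3 3 0) (block_mat (Hyp 0))"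
    using even_unimodular_binary[of 3 0 0] unit(1) by simp
  have "z2_isometric G H"
  proof (rule z2_isometric_if_unimodular[of _ 4 U])
    have "det H = of_int 81"
      unfolding H_def by (subst det_four_block_mat_upper_right_zero[of _ 2 _ 2]) (auto simp: det_mat2)
    then show "det H dvd 1" using unit(2) by simp
    show "H = transpose_mat U * G * U"
    proof (rule congruence_eqI[of _ 4])
      have "\<forall>i<4. \<forall>j<4. H $$ (i, j) =
        (\<Sum>k = 0..<4. U $$ (k, i) * (\<Sum>l = 0..<4. G $$ (k, l) * U $$ (l, j)))"
        unfolding all_less_4 sum_less_4
        by (simp add: mat2_def U_def H_def G_def mat_of_rows_list_def)
      then show "H $$ (i, j) =
        (\<Sum>k = 0..<4. U $$ (k, i) * (\<Sum>l = 0..<4. G $$ (k, l) * U $$ (l, j)))"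
        if "i < 4" "j < 4" for i j using that by blast
    qed (auto simp: U_def H_def G_def mat_of_rows_list_def intro!: carrier_matI)
  qed (auto simp: U_def G_def mat_of_rows_list_def intro!: carrier_matI)
  moreover have "z2_isometric H (blocks_mat [Hyp 0, Hyp 0])"
    unfolding H_def eq by (rule z2_isometric_dsum[OF mat2_carrier mat2_carrier h h])
  moreover have GA: "z2_isometric G (blocks_mat [Ani 0, Ani 0])"
    unfolding G_def eq
    by (rule z2_isometric_dsum[OF _ _ _ m]) (auto intro: z2_isometric_refl[of _ 2])
  moreover have "G \<in> carrier_mat 4 4" by (auto simp: G_def intro!: carrier_matI)
  ultimately have "[Ani 0, Ani 0] \<approx> [Hyp 0, Hyp 0]"
    unfolding blocks_isometric_def
    by (meson blocks_mat_carrier z2_isometric_sym z2_isometric_trans z2_isometric_carrier)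
  then show ?thesis using blocks_isometric_shift[of _ _ e] by fastforce
qed

section \<open>Jordan decomposition\<close>

fun good_block :: "z2_block \<Rightarrow> bool" where
  "good_block (Unary e u) \<longleftrightarrow> odd u" | "good_block (Hyp e) \<longleftrightarrow> True" | "good_block (Ani e) \<longleftrightarrow> True"

lemma z2_isometric_split_upper_left:
  assumes M: "M \<in> carrier_mat n n" and sym: "transpose_mat M = M" and r: "r \<le> n"
    and unit: "det (mat r r (\<lambda>ij. M $$ ij)) dvd 1"
  shows "\<exists>C \<in> carrier_mat (n - r) (n - r). transpose_mat C = C \<and>
    z2_isometric M (dsum (mat r r (\<lambda>ij. M $$ ij)) C)"
proof -
  define A where "A = mat r r (\<lambda>ij. M $$ ij)"
  define B where "B = mat r (n - r) (\<lambda>(i, j). M $$ (i, j + r))"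
  define C where "C = mat (n - r) (n - r) (\<lambda>(i, j). M $$ (i + r, j + r))"
  have A: "A \<in> carrier_mat r r" and B: "B \<in> carrier_mat r (n - r)" and C: "C \<in> carrier_mat (n - r) (n - r)"
    by (auto simp: A_def B_def C_def)
  have Msym: "M $$ (i, j) = M $$ (j, i)" if "i < n" "j < n" for i j
    using that M sym by (metis carrier_matD index_transpose_mat(1))
  have M_eq: "M = four_block_mat A B (transpose_mat B) C"
    using M r by (intro eq_matI) (auto simp: A_def B_def C_def Msym)
  have At: "transpose_mat A = A" and Ct: "transpose_mat C = C"
    using r by (auto simp: A_def C_def Msym intro!: eq_matI)
  obtain A' where A': "A' \<in> carrier_mat r r" "A * A' = 1\<^sub>m r" "A' * A = 1\<^sub>m r"
    using invertible_matE[OF A invertible_mat_if_det_unit[OF A]] unit unfolding A_def by blast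
  define C' where "C' = C - transpose_mat B * A' * B"
  have C': "C' \<in> carrier_mat (n - r) (n - r)" using C A' B by (auto simp: C'_def)
  have iso: "z2_isometric M (dsum A C')"
    unfolding C'_def M_eq by (rule z2_isometric_split[OF A B C At A'])
  moreover have "transpose_mat C' = C'"
  proof -
    have "transpose_mat A' * A = 1\<^sub>m r" using transpose_mult[OF A A'(1)] A'(2) At by simp
    then have "transpose_mat A' * A * A' = A'" using A'(1) by simp
    then have "transpose_mat A' = A'" using A A' by (simp add: assoc_mult_mat[of _ r r _ r _ r])
    then have "transpose_mat (transpose_mat B * A' * B) = transpose_mat B * A' * B"
      using A' B by (simp add: transpose_mult[of _ "n - r" r _ "n - r"] transpose_mult[of _ r r _ "n - r"]
          transpose_mult[of _ "n - r" r _ r] assoc_mult_mat[of _ "n - r" r _ r _ "n - r"])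
    then show ?thesis unfolding C'_def using C A' B Ct by (simp add: transpose_minus[of _ "n - r" "n - r"])
  qed
  ultimately show ?thesis using C' unfolding A_def by blast
qed

lemma z2adic_two_neq_0 [simp]: "(2 :: z2adic) \<noteq> 0"
  using residue_of_int[of 2 2] residue_0[of 2] by auto

lemma exists_unit_multiple:
  assumes G: "G \<in> carrier_mat n n" and sym: "transpose_mat G = G" and det: "det G \<noteq> 0" and n: "0 < n"
  obtains v G' where "G' \<in> carrier_mat n n" "transpose_mat G' = G'" "G = 2 ^ v \<cdot>\<^sub>m G'"
    "\<exists>i<n. \<exists>j<n. G' $$ (i, j) dvd (1 :: z2adic)"
proof -
  let ?P = "\<lambda>v. \<exists>i<n. \<exists>j<n. \<exists>u. u dvd 1 \<and> G $$ (i, j) = 2 ^ v * u"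
  have "\<exists>i<n. \<exists>j<n. G $$ (i, j) \<noteq> 0"
  proof (rule ccontr)
    assume "\<not> ?thesis"
    then have "G = 0\<^sub>m n n" using G by (intro eq_matI) auto
    then show False using det n by simp
  qed
  then obtain i j where ij: "i < n" "j < n" "G $$ (i, j) \<noteq> 0" by blast
  obtain v0 u0 where "G $$ (i, j) = 2 ^ v0 * u0" "u0 dvd 1" using z2adic_power2_unit[OF ij(3)] .
  then have "?P v0" using ij by blast
  define v where "v = (LEAST v. ?P v)"
  have Pv: "?P v" unfolding v_def by (rule LeastI[of ?P, OF \<open>?P v0\<close>])
  have dvd: "2 ^ v dvd G $$ (i, j)" if ij: "i < n" "j < n" for i j
  proof (cases "G $$ (i, j) = 0")
    case False
    obtain w u where w: "G $$ (i, j) = 2 ^ w * u" "u dvd 1" using z2adic_power2_unit[OF False] .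
    then have "?P w" using ij by blast
    then have "v \<le> w" unfolding v_def by (rule Least_le)
    then show ?thesis unfolding w(1) by (simp add: le_imp_power_dvd dvd_mult2)
  qed simp
  define G' where "G' = mat n n (\<lambda>(i, j). SOME x. G $$ (i, j) = 2 ^ v * x)"
  have G': "G $$ (i, j) = 2 ^ v * G' $$ (i, j)" if "i < n" "j < n" for i j
    using someI_ex[of "\<lambda>x. G $$ (i, j) = 2 ^ v * x"] dvd[OF that] that by (auto simp: G'_def elim: dvdE)
  show ?thesis
  proof (rule that[of G' v])
    show car: "G' \<in> carrier_mat n n" by (simp add: G'_def)
    show "G = 2 ^ v \<cdot>\<^sub>m G'" using G car G' by (intro eq_matI) auto
    have "G' $$ (i, j) = G' $$ (j, i)" if "i < n" "j < n" for i j
    proof -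
      have "G $$ (i, j) = G $$ (j, i)" using that G sym by (metis carrier_matD index_transpose_mat(1))
      then have "2 ^ v * G' $$ (i, j) = 2 ^ v * G' $$ (j, i)" using G' that by simp
      then show ?thesis by simp
    qed
    then show "transpose_mat G' = G'" using car by (intro eq_matI) auto
    obtain i j u where "i < n" "j < n" "u dvd 1" "G $$ (i, j) = 2 ^ v * u" using Pv by blast
    then have "G' $$ (i, j) = u" using G' by simp
    then show "\<exists>i<n. \<exists>j<n. G' $$ (i, j) dvd 1" using \<open>i < n\<close> \<open>j < n\<close> \<open>u dvd 1\<close> by blast
  qed
qed

text \<open>A unit on the diagonal yields a block of rank 1. Otherwise the whole diagonal is even,
  and an off-diagonal unit yields an even binary block of odd determinant. A permutation moves the
  block to the upper left corner.\<close>

lemma upper_left_block: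
  assumes G: "G \<in> carrier_mat n n" and sym: "transpose_mat G = G"
    and unit: "\<exists>i<n. \<exists>j<n. G $$ (i, j) dvd (1 :: z2adic)"
  shows "\<exists>M r b. M \<in> carrier_mat n n \<and> transpose_mat M = M \<and> z2_isometric G M \<and> 0 < r \<and> r \<le> n \<and>
    det (mat r r (\<lambda>ij. M $$ ij)) dvd 1 \<and> good_block b \<and> block_scale b = 0 \<and>
    z2_isometric (mat r r (\<lambda>ij. M $$ ij)) (block_mat b)"
proof -
  let ?M = "\<lambda>p. mat n n (\<lambda>(i, j). G $$ (p i, p j))"
  have Gsym: "G $$ (i, j) = G $$ (j, i)" if "i < n" "j < n" for i j
    using that G sym by (metis carrier_matD index_transpose_mat(1))
  have Msym: "transpose_mat (?M p) = ?M p" if "p permutes {..<n}" for p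
    using permutes_in_image[OF that] by (intro eq_matI) (auto intro: Gsym)
  show ?thesis
  proof (cases "\<exists>i<n. G $$ (i, i) dvd 1")
    case True
    then obtain i where i: "i < n" "G $$ (i, i) dvd 1" by blast
    define p where "p = Transposition.transpose 0 i"
    have p: "p permutes {..<n}" unfolding p_def using i by (intro permutes_swap_id) auto
    define w where "w = G $$ (i, i)"
    have eq: "mat 1 1 (\<lambda>ij. ?M p $$ ij) = mat 1 1 (\<lambda>_. 2 ^ 0 * w)"
      using i by (intro eq_matI) (auto simp: p_def w_def)
    have "residue w 3 \<in> {1, 3, 5, 7}" using i residue_8_unit w_def by blast
    then have "odd (residue w 3)" "residue w 3 = residue w 3 mod 8" by auto
    then have "z2_isometric (mat 1 1 (\<lambda>_. 2 ^ 0 * w)) (block_mat (Unary 0 (residue w 3)))"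
      using i by (intro unary_mat_isometric) (auto simp: w_def)
    moreover have "det (mat 1 1 (\<lambda>_. 2 ^ 0 * w)) dvd 1"
      using i by (simp add: det_single w_def)
    moreover have "good_block (Unary 0 (residue w 3))" "block_scale (Unary 0 (residue w 3)) = 0"
      "?M p \<in> carrier_mat n n" "(0 :: nat) < 1" "1 \<le> n"
      using \<open>odd (residue w 3)\<close> i by simp_all
    ultimately show ?thesis
      using z2_isometric_permute[OF G p] Msym[OF p] unfolding eq[symmetric] by blast
  next
    case False
    then obtain i j where ij: "i < n" "j < n" "G $$ (i, j) dvd 1" "i \<noteq> j" using unit by blast
    define q where "q = Transposition.transpose 0 i"
    define p where "p = q \<circ> Transposition.transpose 1 (q j)"
    have n: "1 < n" using ij by linarith
    have q: "q permutes {..<n}" unfolding q_def using ij by (intro permutes_swap_id) auto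
    have "q j < n" using permutes_in_image[OF q, of j] ij by simp
    then have p: "p permutes {..<n}"
      unfolding p_def using n q by (intro permutes_compose permutes_swap_id) auto
    have qj: "q j \<noteq> 0" using ij by (auto simp: q_def Transposition.transpose_def)
    then have p0: "p 0 = i" by (auto simp: p_def q_def Transposition.transpose_def)
    have p1: "p 1 = j" by (simp add: p_def q_def)
    obtain a where a: "G $$ (i, i) = 2 * a" using False ij z2adic_unit_iff by (blast elim: dvdE)
    obtain c where c: "G $$ (j, j) = 2 * c" using False ij z2adic_unit_iff by (blast elim: dvdE)
    define b where "b = G $$ (i, j)"
    have eq: "mat 2 2 (\<lambda>ij. ?M p $$ ij) = mat2 (2 * a) b b (2 * c)"
      using n ij Gsym[of i j] p0 p1 a c
      by (intro eq_matI) (auto simp: mat2_def b_def less_Suc_eq numeral_2_eq_2)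
    have "z2_isometric (mat2 (2 * a) b b (2 * c)) (block_mat (if 2 dvd a * c then Hyp 0 else Ani 0))"
      using even_unimodular_binary[of b a c] ij by (auto simp: b_def split: if_splits)
    moreover have "det (mat2 (2 * a) b b (2 * c)) dvd 1"
    proof -
      have "\<not> 2 dvd - (b * b) + 2 * (2 * a * c)"
        using ij by (intro z2adic_odd_add_2) (simp add: z2adic_odd_mult z2adic_unit_iff b_def)
      then show ?thesis unfolding det_mat2 z2adic_unit_iff by (simp add: algebra_simps)
    qed
    moreover have "good_block (if 2 dvd a * c then Hyp 0 else Ani 0)"
      "block_scale (if 2 dvd a * c then Hyp 0 else Ani 0) = 0"
      "?M p \<in> carrier_mat n n" "(0 :: nat) < 2" "2 \<le> n"
      using n by simp_all
    ultimately show ?thesis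
      using z2_isometric_permute[OF G p] Msym[OF p] unfolding eq[symmetric] by blast
  qed
qed

text \<open>After the largest common power of 2 of the entries is taken out, some entry is a unit,
  so that a unimodular block of rank 1 or 2 splits off; the complement has smaller rank.\<close>

lemma jordan_decomposition:
  assumes "G \<in> carrier_mat n n" "transpose_mat G = G" "det G \<noteq> 0"
  shows "\<exists>xs. (\<forall>b\<in>set xs. good_block b) \<and> z2_isometric G (blocks_mat xs)"
  using assms
proof (induction n arbitrary: G rule: less_induct)
  case (less n)
  show ?case
  proof (cases "n = 0")
    case True
    then have "G = blocks_mat []" using less.prems by (intro eq_matI) auto
    then show ?thesis using z2_isometric_refl[OF less.prems(1)] by (intro exI[of _ "[]"]) auto
  next
    case False
    then have n: "0 < n" by simp
    obtain v G' where G': "G' \<in> carrier_mat n n" "transpose_mat G' = G'" "G = 2 ^ v \<cdot>\<^sub>m G'"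
      "\<exists>i<n. \<exists>j<n. G' $$ (i, j) dvd 1"
      using exists_unit_multiple[OF less.prems n] .
    obtain M r b where M: "M \<in> carrier_mat n n" "transpose_mat M = M" "z2_isometric G' M"
      and r: "0 < r" "r \<le> n" and unit: "det (mat r r (\<lambda>ij. M $$ ij)) dvd 1"
      and b: "good_block b" "block_scale b = 0" "z2_isometric (mat r r (\<lambda>ij. M $$ ij)) (block_mat b)"
      using upper_left_block[OF G'(1,2,4)] by blast
    define A where "A = mat r r (\<lambda>ij. M $$ ij)"
    have A: "A \<in> carrier_mat r r" by (simp add: A_def)
    obtain C where C: "C \<in> carrier_mat (n - r) (n - r)" "transpose_mat C = C" "z2_isometric M (dsum A C)"
      using z2_isometric_split_upper_left[OF M(1,2) r(2) unit] unfolding A_def by blast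
    have "z2_isometric G' (dsum A C)" using z2_isometric_trans[OF G'(1) M(3) C(3)] .
    then have "z2_isometric G (2 ^ v \<cdot>\<^sub>m dsum A C)"
      unfolding G'(3) by (rule z2_isometric_smult[OF G'(1)])
    moreover have "2 ^ v \<cdot>\<^sub>m dsum A C = dsum (2 ^ v \<cdot>\<^sub>m A) (2 ^ v \<cdot>\<^sub>m C)"
      using A C(1) by (intro eq_matI) auto
    ultimately have iso: "z2_isometric G (dsum (2 ^ v \<cdot>\<^sub>m A) (2 ^ v \<cdot>\<^sub>m C))" by simp
    have car: "2 ^ v \<cdot>\<^sub>m A \<in> carrier_mat r r" "2 ^ v \<cdot>\<^sub>m C \<in> carrier_mat (n - r) (n - r)"
      using A C by auto
    obtain u where u: "u dvd 1" "det (dsum (2 ^ v \<cdot>\<^sub>m A) (2 ^ v \<cdot>\<^sub>m C)) = det G * u\<^sup>2"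
      using z2_isometric_det[OF less.prems(1) iso] .
    have "u \<noteq> 0" using u(1) by auto
    then have "det (dsum (2 ^ v \<cdot>\<^sub>m A) (2 ^ v \<cdot>\<^sub>m C)) \<noteq> 0" using u(2) less.prems(3) by simp
    moreover have "det (dsum (2 ^ v \<cdot>\<^sub>m A) (2 ^ v \<cdot>\<^sub>m C)) = det (2 ^ v \<cdot>\<^sub>m A) * det (2 ^ v \<cdot>\<^sub>m C)"
      using car A C by (intro det_four_block_mat_upper_right_zero[of _ r _ "n - r"]) auto
    ultimately have "det (2 ^ v \<cdot>\<^sub>m C) \<noteq> 0" by auto
    moreover have "transpose_mat (2 ^ v \<cdot>\<^sub>m C) = 2 ^ v \<cdot>\<^sub>m transpose_mat C" by (intro eq_matI) auto
    then have "transpose_mat (2 ^ v \<cdot>\<^sub>m C) = 2 ^ v \<cdot>\<^sub>m C" using C(2) by simp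
    ultimately obtain xs where xs: "\<forall>b\<in>set xs. good_block b" "z2_isometric (2 ^ v \<cdot>\<^sub>m C) (blocks_mat xs)"
      using less.IH[of "n - r" "2 ^ v \<cdot>\<^sub>m C"] r car(2) by auto
    have "z2_isometric (2 ^ v \<cdot>\<^sub>m A) (block_mat (shift_block v b))"
      unfolding block_mat_shift by (rule z2_isometric_smult[OF A b(3)[folded A_def]])
    then have "z2_isometric (dsum (2 ^ v \<cdot>\<^sub>m A) (2 ^ v \<cdot>\<^sub>m C)) (blocks_mat ([shift_block v b] @ xs))"
      unfolding blocks_mat_append blocks_mat_singleton by (rule z2_isometric_dsum[OF car _ xs(2)])
    with iso have "z2_isometric G (blocks_mat ([shift_block v b] @ xs))"
      by (rule z2_isometric_trans[OF less.prems(1)])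
    moreover have "good_block (shift_block v b)" using b(1) by (cases b) auto
    ultimately show ?thesis using xs(1) by (intro exI[of _ "[shift_block v b] @ xs"]) auto
  qed
qed

section \<open>Normal forms of Jordan constituents\<close>

text \<open>\<open>Unary_pair_times_5\<close> multiplies both entries by 5, and 25 is 1 modulo 8. A
  factor 5 can thus be moved from one entry to another.\<close>

lemma Unary_push_5:
  assumes "odd u" "odd h"
  shows "map (Unary e) (5 * u # h # t) \<approx> map (Unary e) (u # 5 * h # t)"
proof -
  have "[Unary e (5 * u), Unary e h] \<approx> [Unary e (5 * (5 * u)), Unary e (5 * h)]"
    using assms by (intro Unary_pair_times_5) auto
  also have "[Unary e (5 * (5 * u))] @ [Unary e (5 * h)] \<approx> [Unary e u] @ [Unary e (5 * h)]"
    using assms by (intro blocks_isometric_append Unary_mod_8) (auto simp: mod_eq_dvd_iff)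
  then have "[Unary e (5 * (5 * u)), Unary e (5 * h)] \<approx> [Unary e u, Unary e (5 * h)]" by simp
  finally have "[Unary e (5 * u), Unary e h] @ map (Unary e) t \<approx> [Unary e u, Unary e (5 * h)] @ map (Unary e) t"
    by (intro blocks_isometric_append) auto
  then show ?thesis by simp
qed

text \<open>Modulo 8 every odd number is 1 or 3, possibly times 5. Factors 5 move freely within one
  scale and cancel in pairs, so a single flag records them; the factor is stored in the
  head.\<close>

definition twist :: "bool \<Rightarrow> int list \<Rightarrow> int list" where
  "twist d us = (if d then 5 * hd us # tl us else us)"

lemma twist_mset:
  assumes "mset us = mset vs" "\<forall>u\<in>set us. odd u"
  shows "map (Unary e) (twist d us) \<approx> map (Unary e) (twist d vs)"
proof (cases "d \<and> us \<noteq> []")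
  case False
  then consider "us = []" | "\<not> d" by blast
  then show ?thesis
  proof cases
    case 1
    then show ?thesis using assms(1) by simp
  next
    case 2
    have "mset (map (Unary e) us) = mset (map (Unary e) vs)" using assms(1) by (metis mset_map)
    then show ?thesis unfolding twist_def using 2 by (simp only: if_False) (rule blocks_isometric_mset)
  qed
next
  case True
  then obtain x us' y vs' where us: "us = x # us'" and vs: "vs = y # vs'"
    using assms(1) by (cases us; cases vs) auto
  have tw: "twist d us = 5 * x # us'" "twist d vs = 5 * y # vs'" using True by (simp_all add: twist_def us vs)
  show ?thesis
  proof (cases "x = y")
    case True
    then show ?thesis unfolding tw using assms(1) us vs by (intro blocks_isometric_mset) simp
  next
    case False
    have sets: "set us = set vs" by (rule mset_eq_setD[OF assms(1)])
    have odd: "odd x" "odd y" using assms(2) sets by (auto simp: us vs)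
    have "y \<in> set us'" using sets False by (auto simp: us vs)
    then obtain as bs where split: "us' = as @ y # bs" by (meson split_list)
    define ws where "ws = as @ bs"
    have ws: "mset us' = mset (y # ws)" by (simp add: split ws_def)
    have "add_mset x (add_mset y (mset ws)) = add_mset y (mset vs')"
      using assms(1) ws by (simp add: us vs)
    then have ws': "mset vs' = mset (x # ws)" by (simp add: add_mset_commute)
    have "map (Unary e) (5 * x # us') \<approx> map (Unary e) (5 * x # y # ws)"
      using ws by (intro blocks_isometric_mset) simp
    also have "\<dots> \<approx> map (Unary e) (x # 5 * y # ws)" by (rule Unary_push_5[OF odd])
    also have "\<dots> \<approx> map (Unary e) (5 * y # vs')"
      using ws' by (intro blocks_isometric_mset) simp
    finally show ?thesis unfolding tw .
  qed
qed

lemma twist_Cons: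
  assumes "odd x" "\<forall>u\<in>set us. odd u" "us \<noteq> []"
  shows "Unary e x # map (Unary e) (twist d us) \<approx> map (Unary e) (twist d (x # us))"
proof -
  obtain h t where us: "us = h # t" using assms by (cases us) auto
  show ?thesis
    using blocks_isometric_sym[OF Unary_push_5[of x h e t]] assms by (auto simp: twist_def us)
qed

lemma twist_Cons_5:
  assumes "odd x" "\<forall>u\<in>set us. odd u" "us \<noteq> []"
  shows "Unary e (5 * x) # map (Unary e) (twist d us) \<approx> map (Unary e) (twist (\<not> d) (x # us))"
proof -
  obtain h t where us: "us = h # t" using assms by (cases us) auto
  show ?thesis
  proof (cases d)
    case True
    have h: "odd h" using assms us by simp
    then have "map (Unary e) (5 * x # 5 * h # t) \<approx> map (Unary e) (x # 5 * (5 * h) # t)"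
      using assms by (intro Unary_push_5) auto
    also have "[Unary e x] @ [Unary e (5 * (5 * h))] @ map (Unary e) t \<approx> [Unary e x] @ [Unary e h] @ map (Unary e) t"
      using h by (intro blocks_isometric_append Unary_mod_8 blocks_isometric_refl) (auto simp: mod_eq_dvd_iff)
    then have "map (Unary e) (x # 5 * (5 * h) # t) \<approx> map (Unary e) (x # h # t)" by simp
    finally show ?thesis using True by (simp add: twist_def us)
  qed (simp add: twist_def us)
qed

lemma odd_mod_8_cases:
  assumes "odd (u :: int)"
  shows "u mod 8 = 1 \<or> u mod 8 = 3 \<or> u mod 8 = 5 \<or> u mod 8 = 7"
proof -
  have "residue (of_int u) 3 \<in> {1, 3, 5, 7}" using assms of_int_unit_iff residue_8_unit by blast
  then show ?thesis by (simp add: residue_of_int)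
qed

lemma odd_mod_8_eq_1_3_times_5:
  assumes "odd (u :: int)"
  shows "\<exists>d b. b \<in> {1, 3} \<and> u mod 8 = (if d then 5 * b else b) mod 8"
proof -
  consider "u mod 8 = 1" | "u mod 8 = 3" | "u mod 8 = 5" | "u mod 8 = 7"
    using odd_mod_8_cases[OF assms] by blast
  then show ?thesis
  proof cases
    case 1
    then show ?thesis by (intro exI[of _ False] exI[of _ 1]) simp
  next
    case 2
    then show ?thesis by (intro exI[of _ False] exI[of _ 3]) simp
  next
    case 3
    then show ?thesis by (intro exI[of _ True] exI[of _ 1]) simp
  next
    case 4
    then show ?thesis by (intro exI[of _ True] exI[of _ 3]) simp
  qed
qed

lemma Unary_normal_form_aux:
  assumes "us \<noteq> []" "\<forall>u\<in>set us. odd u"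
  shows "\<exists>d bs. set bs \<subseteq> {1, 3} \<and> length bs = length us \<and> map (Unary e) us \<approx> map (Unary e) (twist d bs)"
  using assms
proof (induction us rule: list_nonempty_induct)
  case (single u)
  have "\<exists>d b. b \<in> {1, 3} \<and> u mod 8 = (if d then 5 * b else b) mod 8"
    using odd_mod_8_eq_1_3_times_5 single by simp
  then obtain d b where db: "b \<in> {1, 3}" "u mod 8 = (if d then 5 * b else b) mod 8" by blast
  then have "map (Unary e) [u] \<approx> map (Unary e) (twist d [b])"
    using Unary_mod_8[of u "if d then 5 * b else b" e] single by (auto simp: twist_def)
  then show ?case using db(1) by (intro exI[of _ d] exI[of _ "[b]"]) simp
next
  case (cons u us)
  then obtain d bs where bs: "set bs \<subseteq> {1, 3}" "length bs = length us"
    "map (Unary e) us \<approx> map (Unary e) (twist d bs)" by auto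
  have odd: "\<forall>b\<in>set bs. odd b" "bs \<noteq> []" using bs cons by auto
  have "\<exists>d b. b \<in> {1, 3} \<and> u mod 8 = (if d then 5 * b else b) mod 8"
    using odd_mod_8_eq_1_3_times_5 cons.prems by simp
  then obtain d' b where db: "b \<in> {1, 3}" "u mod 8 = (if d' then 5 * b else b) mod 8" by blast
  have "[Unary e u] @ map (Unary e) us \<approx> [Unary e (if d' then 5 * b else b)] @ map (Unary e) (twist d bs)"
    using cons.prems db(2) by (intro blocks_isometric_append bs(3) Unary_mod_8) auto
  also have "[Unary e (if d' then 5 * b else b)] @ map (Unary e) (twist d bs)
      \<approx> map (Unary e) (twist (d \<noteq> d') (b # bs))"
  proof -
    have "odd b" using db(1) by auto
    then show ?thesis using twist_Cons[of b bs e d] twist_Cons_5[of b bs e d] odd by (cases d') auto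
  qed
  finally show ?case using bs db(1) by (intro exI[of _ "d \<noteq> d'"] exI[of _ "b # bs"]) auto
qed

text \<open>Three equal entries \<open>a\<close> are \<open>3 * a\<close> together with an
  \<open>Ani\<close> plane, and this plane can be absorbed by the fourth entry \<open>b\<close>
  instead.\<close>

lemma Unary_quadruple:
  assumes "odd a" "odd b"
  shows "map (Unary e) [a, a, a, b] \<approx> map (Unary e) [3 * a, 3 * b, 3 * b, 3 * b]"
proof -
  have "map (Unary e) [a, a, a] \<approx> [Unary e (3 * a), Ani e]"
  proof -
    have "[Unary e (3 * a), Ani e] \<approx> map (Unary e) [3 * (3 * a), 3 * (3 * a), 3 * (3 * a)]"
      using assms by (intro Unary_Ani) auto
    also have "\<dots> \<approx> map (Unary e) [a, a, a]"
      using assms by (intro map_Unary_mod_8) (auto simp: mod_eq_dvd_iff)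
    finally show ?thesis by (rule blocks_isometric_sym)
  qed
  then have "map (Unary e) [a, a, a] @ [Unary e b] \<approx> [Unary e (3 * a), Ani e] @ [Unary e b]"
    by (intro blocks_isometric_append) auto
  also have "\<dots> \<approx> [Unary e (3 * a)] @ [Unary e b, Ani e]"
    by (intro blocks_isometric_mset) simp
  also have "\<dots> \<approx> [Unary e (3 * a)] @ map (Unary e) [3 * b, 3 * b, 3 * b]"
    using assms by (intro blocks_isometric_append Unary_Ani) auto
  finally show ?thesis by simp
qed

lemma Unary_3333: "map (Unary e) [3, 3, 3, 3] \<approx> map (Unary e) [1, 1, 1, 1]"
proof -
  have "map (Unary e) [3, 3, 3, 3] \<approx> map (Unary e) [3 * 3, 3 * 3, 3 * 3, 3 * 3]"
    by (rule Unary_quadruple) auto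
  also have "\<dots> \<approx> map (Unary e) [1, 1, 1, 1]" by (intro map_Unary_mod_8) auto
  finally show ?thesis .
qed

text \<open>A twist is first moved to an entry outside the four threes. If there is none, the four
  entries are \<open>3, 3, 3, 15\<close>, and \<open>Unary_quadruple\<close> is applied with
  \<open>b = 15\<close>.\<close>

lemma twist_3333:
  assumes "set rs \<subseteq> {1, 3}"
  shows "map (Unary e) (twist d ([3, 3, 3, 3] @ rs)) \<approx> map (Unary e) (twist d ([1, 1, 1, 1] @ rs))"
proof (cases d)
  case False
  then show ?thesis using blocks_isometric_append[OF Unary_3333, of "map (Unary e) rs" "map (Unary e) rs" e]
    by (simp add: twist_def)
next
  case True
  show ?thesis
  proof (cases rs)
    case Nil
    have "map (Unary e) [15, 3, 3, 3] \<approx> map (Unary e) [3, 3, 3, 15]" by (intro blocks_isometric_mset) simp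
    also have "\<dots> \<approx> map (Unary e) [3 * 3, 3 * 15, 3 * 15, 3 * 15]" by (rule Unary_quadruple) auto
    also have "\<dots> \<approx> map (Unary e) [1, 5, 5, 5]" by (intro map_Unary_mod_8) auto
    also have "\<dots> \<approx> map (Unary e) [5 * 1, 5, 1, 5]" by (intro blocks_isometric_mset) simp
    also have "\<dots> \<approx> map (Unary e) [1, 5 * 5, 1, 5]" by (rule Unary_push_5) auto
    also have "\<dots> \<approx> map (Unary e) [1, 1, 1, 5]" by (intro map_Unary_mod_8) auto
    also have "\<dots> \<approx> map (Unary e) [5, 1, 1, 1]" by (intro blocks_isometric_mset) simp
    finally show ?thesis using True Nil by (simp add: twist_def)
  next
    case (Cons x rs')
    have odd: "\<forall>u\<in>set rs. odd u" using assms by auto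
    have "map (Unary e) (twist d ([3, 3, 3, 3] @ rs)) \<approx> map (Unary e) (twist d (x # [3, 3, 3, 3] @ rs'))"
      using odd by (intro twist_mset) (auto simp: Cons)
    also have "map (Unary e) (twist d (x # [3, 3, 3, 3] @ rs'))
        = [Unary e (5 * x)] @ map (Unary e) [3, 3, 3, 3] @ map (Unary e) rs'"
      using True by (simp add: twist_def)
    also have "\<dots> \<approx> [Unary e (5 * x)] @ map (Unary e) [1, 1, 1, 1] @ map (Unary e) rs'"
      by (intro blocks_isometric_append Unary_3333 blocks_isometric_refl)
    also have "\<dots> = map (Unary e) (twist d (x # [1, 1, 1, 1] @ rs'))"
      using True by (simp add: twist_def)
    also have "\<dots> \<approx> map (Unary e) (twist d ([1, 1, 1, 1] @ rs))"
      using odd by (intro twist_mset) (auto simp: Cons)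
    finally show ?thesis .
  qed
qed

text \<open>The code \<open>2 * j + d\<close> stands for the diagonal form with \<open>j\<close> entries \<open>3\<close> and all others \<open>1\<close>,
  one of them multiplied by \<open>5\<close> if \<open>d = 1\<close>; the place of the factor \<open>5\<close> is irrelevant up to isometry.\<close>

definition odd_canon :: "nat \<Rightarrow> nat \<Rightarrow> int list" where
  "odd_canon m c = twist (odd c) (replicate (m - c div 2) 1 @ replicate (c div 2) 3)"

lemma mset_1_3:
  "set bs \<subseteq> {1, 3 :: int} \<Longrightarrow> \<exists>j\<le>length bs. mset bs = mset (replicate (length bs - j) 1 @ replicate j 3)"
proof (induction bs)
  case (Cons b bs)
  then obtain j where j: "j \<le> length bs" "mset bs = mset (replicate (length bs - j) 1 @ replicate j 3)" by auto
  from Cons.prems consider "b = 1" | "b = 3" by auto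
  then show ?case
  proof cases
    case 1
    then show ?thesis using j by (intro exI[of _ j]) (auto simp: Suc_diff_le)
  next
    case 2
    then show ?thesis using j by (intro exI[of _ "Suc j"]) auto
  qed
qed simp

lemma Unary_reduce_threes:
  assumes "j \<le> m"
  shows "map (Unary e) (twist d (replicate (m - j) 1 @ replicate j 3))
    \<approx> map (Unary e) (twist d (replicate (m - j mod 4) 1 @ replicate (j mod 4) 3))"
  using assms
proof (induction j rule: less_induct)
  case (less j)
  show ?case
  proof (cases "j < 4")
    case False
    define q where "q = j - 4"
    have j: "j = 4 + q" using False by (simp add: q_def)
    define rs :: "int list" where "rs = replicate (m - j) 1 @ replicate q 3"
    have "map (Unary e) (twist d (replicate (m - j) 1 @ replicate j 3))
      \<approx> map (Unary e) (twist d ([3, 3, 3, 3] @ rs))"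
      by (intro twist_mset) (auto simp: rs_def j numeral_eq_Suc)
    also have "\<dots> \<approx> map (Unary e) (twist d ([1, 1, 1, 1] @ rs))"
      by (intro twist_3333) (auto simp: rs_def)
    also have "\<dots> \<approx> map (Unary e) (twist d (replicate (m - q) 1 @ replicate q 3))"
    proof (intro twist_mset)
      have "m - q = 4 + (m - j)" using less.prems j by simp
      then show "mset ([1, 1, 1, 1] @ rs) = mset (replicate (m - q) 1 @ replicate q 3)"
        by (simp add: rs_def numeral_eq_Suc)
    qed (auto simp: rs_def)
    also have "\<dots> \<approx> map (Unary e) (twist d (replicate (m - q mod 4) 1 @ replicate (q mod 4) 3))"
      using less.prems j by (intro less.IH) auto
    finally show ?thesis by (simp add: j)
  qed simp
qed

text \<open>The number of threes matters only modulo 4 and is at most the rank, which leaves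
  \<open>min m 3 + 1\<close> values; the twist flag doubles them.\<close>

lemma Unary_normal_form:
  assumes "us \<noteq> []" "\<forall>u\<in>set us. odd u"
  shows "\<exists>c < 2 * (min (length us) 3 + 1). map (Unary e) us \<approx> map (Unary e) (odd_canon (length us) c)"
proof -
  let ?m = "length us"
  obtain d bs where bs: "set bs \<subseteq> {1, 3}" "length bs = ?m" "map (Unary e) us \<approx> map (Unary e) (twist d bs)"
    using Unary_normal_form_aux[OF assms] by blast
  obtain j where j: "j \<le> ?m" "mset bs = mset (replicate (?m - j) 1 @ replicate j 3)"
    using mset_1_3[OF bs(1)] bs(2) by auto
  note bs(3)
  also have "map (Unary e) (twist d bs) \<approx> map (Unary e) (twist d (replicate (?m - j) 1 @ replicate j 3))"
    using bs(1) by (intro twist_mset j(2)) auto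
  also have "\<dots> \<approx> map (Unary e) (twist d (replicate (?m - j mod 4) 1 @ replicate (j mod 4) 3))"
    by (rule Unary_reduce_threes[OF j(1)])
  also have "\<dots> = map (Unary e) (odd_canon ?m (2 * (j mod 4) + of_bool d))"
    by (simp add: odd_canon_def)
  finally have "map (Unary e) us \<approx> map (Unary e) (odd_canon ?m (2 * (j mod 4) + of_bool d))" .
  moreover have "2 * (j mod 4) + of_bool d < 2 * (min ?m 3 + 1)"
  proof -
    have "j mod 4 \<le> j" "j mod 4 < 4" by simp_all
    then have "j mod 4 \<le> min ?m 3" using j(1) by linarith
    then show ?thesis by (cases d) auto
  qed
  ultimately show ?thesis by blast
qed

section \<open>Codes of a single Jordan constituent\<close>

definition odd_codes :: "nat \<Rightarrow> nat" where
  "odd_codes m = 2 * (min m 3 + 1)"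

definition local_canon :: "nat \<Rightarrow> nat \<Rightarrow> nat \<Rightarrow> z2_block list" where
  "local_canon e m c = (if m = 0 then []
     else if c < odd_codes m then map (Unary e) (odd_canon m c)
     else if c = odd_codes m then replicate (m div 2) (Hyp e)
     else Ani e # replicate (m div 2 - 1) (Hyp e))"

definition num_local_codes :: "nat \<Rightarrow> nat" where
  "num_local_codes m = (if m = 0 then 1 else odd_codes m + (if even m then 2 else 0))"

text \<open>In the presence of a unary block of the same scale, \<open>Unary_Hyp\<close> and
  \<open>Unary_Ani\<close> turn each even plane into unary blocks. A constituent is therefore either
  diagonal or a sum of even planes.\<close>

lemma absorb_even_blocks:
  assumes "us \<noteq> []" "\<forall>u\<in>set us. odd u" "set ys \<subseteq> {Hyp e, Ani e}"
  shows "\<exists>vs. vs \<noteq> [] \<and> (\<forall>v\<in>set vs. odd v) \<and> map (Unary e) us @ ys \<approx> map (Unary e) vs"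
  using assms
proof (induction ys arbitrary: us)
  case (Cons y ys)
  obtain a us' where us: "us = a # us'" using Cons.prems(1) by (cases us) auto
  have a: "odd a" using Cons.prems(2) us by simp
  obtain as where as: "[Unary e a, y] \<approx> map (Unary e) as" "as \<noteq> []" "\<forall>v\<in>set as. odd v"
  proof (cases "y = Hyp e")
    case True
    then show ?thesis using that[of "[a, a, - a]"] Unary_Hyp[OF a, of e] a by simp
  next
    case False
    then have "y = Ani e" using Cons.prems(3) by auto
    then show ?thesis using that[of "[3 * a, 3 * a, 3 * a]"] Unary_Ani[OF a, of e] a by simp
  qed
  have "map (Unary e) us @ y # ys \<approx> [Unary e a, y] @ (map (Unary e) us' @ ys)"
    by (intro blocks_isometric_mset) (simp add: us)
  also have "\<dots> \<approx> map (Unary e) as @ (map (Unary e) us' @ ys)"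
    by (rule blocks_isometric_append[OF as(1) blocks_isometric_refl])
  also have "\<dots> = map (Unary e) (as @ us') @ ys" by simp
  finally have 1: "map (Unary e) us @ y # ys \<approx> map (Unary e) (as @ us') @ ys" .
  obtain vs where "vs \<noteq> []" "\<forall>v\<in>set vs. odd v" "map (Unary e) (as @ us') @ ys \<approx> map (Unary e) vs"
    using Cons.IH[of "as @ us'"] Cons.prems as us by auto
  then show ?case using 1 blocks_isometric_trans by blast
qed auto

lemma blocks_rank_Unary [simp]: "blocks_rank (map (Unary e) us) = length us"
  by (induction us) auto

lemma block_rank_pos [simp]: "0 < block_rank b"
  by (cases b) auto

lemma partition_blocks:
  assumes "\<forall>b\<in>set xs. good_block b \<and> block_scale b = e"
  shows "\<exists>us ys. (\<forall>u\<in>set us. odd u) \<and> set ys \<subseteq> {Hyp e, Ani e} \<and> mset xs = mset (map (Unary e) us @ ys)"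
  using assms
proof (induction xs)
  case (Cons x xs)
  have "\<exists>us ys. (\<forall>u\<in>set us. odd u) \<and> set ys \<subseteq> {Hyp e, Ani e} \<and> mset xs = mset (map (Unary e) us @ ys)"
    by (rule Cons.IH) (use Cons.prems in simp)
  then obtain us ys where IH: "\<forall>u\<in>set us. odd u" "set ys \<subseteq> {Hyp e, Ani e}"
    "mset xs = mset (map (Unary e) us @ ys)" by blast
  show ?case
  proof (cases x)
    case (Unary e' u)
    then show ?thesis using IH Cons.prems by (intro exI[of _ "u # us"] exI[of _ ys]) auto
  next
    case (Hyp e')
    then show ?thesis using IH Cons.prems by (intro exI[of _ us] exI[of _ "x # ys"]) auto
  next
    case (Ani e')
    then show ?thesis using IH Cons.prems by (intro exI[of _ us] exI[of _ "x # ys"]) auto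
  qed
qed simp

lemma local_normal_form_odd:
  assumes "\<forall>b\<in>set xs. good_block b \<and> block_scale b = e" "\<exists>u. Unary e u \<in> set xs"
  shows "\<exists>c < odd_codes (blocks_rank xs). xs \<approx> local_canon e (blocks_rank xs) c"
proof -
  obtain us ys where us: "\<forall>u\<in>set us. odd u" and ys: "set ys \<subseteq> {Hyp e, Ani e}"
    and eq: "mset xs = mset (map (Unary e) us @ ys)"
    using partition_blocks[OF assms(1)] by blast
  have "us \<noteq> []" using assms(2) ys mset_eq_setD[OF eq] by auto
  then obtain vs where vs: "vs \<noteq> []" "\<forall>v\<in>set vs. odd v" "map (Unary e) us @ ys \<approx> map (Unary e) vs"
    using absorb_even_blocks[OF _ us ys] by blast
  have xs: "xs \<approx> map (Unary e) vs" using blocks_isometric_mset[OF eq] vs(3) blocks_isometric_trans by blast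
  then have rank: "blocks_rank xs = length vs" using blocks_isometric_rank by fastforce
  obtain c where "c < odd_codes (length vs)" "map (Unary e) vs \<approx> map (Unary e) (odd_canon (length vs) c)"
    using Unary_normal_form[OF vs(1,2)] unfolding odd_codes_def by blast
  then show ?thesis using xs vs(1) rank blocks_isometric_trans
    by (intro exI[of _ c]) (auto simp: local_canon_def)
qed

lemma even_normal_form:
  assumes "set ys \<subseteq> {Hyp e, Ani e}" "ys \<noteq> []"
  shows "ys \<approx> replicate (length ys) (Hyp e) \<or> ys \<approx> Ani e # replicate (length ys - 1) (Hyp e)"
  using assms(2,1)
proof (induction ys rule: list_nonempty_induct)
  case (cons y ys)
  then obtain l where l: "length ys = Suc l" by (cases ys) auto
  have "ys \<approx> replicate (Suc l) (Hyp e) \<or> ys \<approx> Ani e # replicate l (Hyp e)" using cons l by auto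
  then have IH: "y # ys \<approx> y # replicate (Suc l) (Hyp e) \<or> y # ys \<approx> y # Ani e # replicate l (Hyp e)"
    using blocks_isometric_Cons by blast
  have 1: "Hyp e # Ani e # replicate l (Hyp e) \<approx> Ani e # Hyp e # replicate l (Hyp e)"
    by (intro blocks_isometric_mset) simp
  have 2: "Ani e # Ani e # replicate l (Hyp e) \<approx> Hyp e # Hyp e # replicate l (Hyp e)"
    using blocks_isometric_append[OF Ani_pair, of "replicate l (Hyp e)" "replicate l (Hyp e)" e] by simp
  have "y = Hyp e \<or> y = Ani e" using cons by auto
  then show ?case using IH l 1 2 blocks_isometric_trans by auto
qed auto

lemma local_normal_form_even:
  assumes "set xs \<subseteq> {Hyp e, Ani e}"
  shows "\<exists>c < num_local_codes (blocks_rank xs). (blocks_rank xs \<noteq> 0 \<longrightarrow> odd_codes (blocks_rank xs) \<le> c) \<and>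
    xs \<approx> local_canon e (blocks_rank xs) c"
proof (cases "xs = []")
  case True
  then show ?thesis by (auto simp: local_canon_def num_local_codes_def)
next
  case False
  have rank: "blocks_rank xs = 2 * length xs" using assms by (induction xs) auto
  have "xs \<approx> local_canon e (blocks_rank xs) (odd_codes (blocks_rank xs)) \<or>
    xs \<approx> local_canon e (blocks_rank xs) (Suc (odd_codes (blocks_rank xs)))"
    using even_normal_form[OF assms False] False by (simp add: rank local_canon_def)
  then show ?thesis
  proof
    assume "xs \<approx> local_canon e (blocks_rank xs) (odd_codes (blocks_rank xs))"
    then show ?thesis using False rank
      by (intro exI[of _ "odd_codes (blocks_rank xs)"]) (simp add: num_local_codes_def)
  next
    assume "xs \<approx> local_canon e (blocks_rank xs) (Suc (odd_codes (blocks_rank xs)))"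
    then show ?thesis using False rank
      by (intro exI[of _ "Suc (odd_codes (blocks_rank xs))"]) (simp add: num_local_codes_def)
  qed
qed

lemma no_Unary_even:
  assumes "\<forall>b\<in>set xs. good_block b \<and> block_scale b = e" "\<nexists>u. Unary e u \<in> set xs"
  shows "set xs \<subseteq> {Hyp e, Ani e}"
proof
  fix x assume x: "x \<in> set xs"
  then have "block_scale x = e" "\<And>u. x \<noteq> Unary e u" using assms by blast+
  then show "x \<in> {Hyp e, Ani e}" by (cases x) auto
qed

lemma local_normal_form:
  assumes "\<forall>b\<in>set xs. good_block b \<and> block_scale b = e"
  shows "\<exists>c < num_local_codes (blocks_rank xs). xs \<approx> local_canon e (blocks_rank xs) c"
proof (cases "\<exists>u. Unary e u \<in> set xs")
  case True
  then obtain c where c: "c < odd_codes (blocks_rank xs)" "xs \<approx> local_canon e (blocks_rank xs) c"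
    using local_normal_form_odd[OF assms] by blast
  have "blocks_rank xs \<noteq> 0" using True by (cases xs) (auto simp: block_rank_pos)
  then have "c < num_local_codes (blocks_rank xs)" using c by (simp add: num_local_codes_def)
  then show ?thesis using c by blast
next
  case False
  then show ?thesis using local_normal_form_even no_Unary_even[OF assms False] by blast
qed

section \<open>Jordan codes\<close>

text \<open>The entry \<open>(m, c)\<close> at position \<open>i\<close> of a code is the rank and the local code of the Jordan
  constituent of scale \<open>2 ^ Suc i\<close>.\<close>

primrec codes :: "(nat \<Rightarrow> nat) \<Rightarrow> nat \<Rightarrow> nat \<Rightarrow> (nat \<times> nat) list set" where
  "codes d 0 k = (if k = 0 then {[]} else {})"
| "codes d (Suc N) k =
    (\<Union>m\<in>{..k div Suc N}. \<Union>c\<in>{..<d m}. (\<lambda>cs. cs @ [(m, c)]) ` codes d N (k - Suc N * m))"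

text \<open>The coefficient of \<open>x^k\<close> in the product over \<open>i = 1, ..., N\<close>
  of the series with terms \<open>d m * x^(i * m)\<close>.\<close>

primrec num_codes :: "(nat \<Rightarrow> nat) \<Rightarrow> nat \<Rightarrow> nat \<Rightarrow> nat" where
  "num_codes d 0 k = (if k = 0 then 1 else 0)"
| "num_codes d (Suc N) k = (\<Sum>m\<le>k div Suc N. d m * num_codes d N (k - Suc N * m))"

lemma finite_codes: "finite (codes d N k)"
  by (induction N arbitrary: k) auto

lemma card_codes: "card (codes d N k) = num_codes d N k"
proof (induction N arbitrary: k)
  case (Suc N)
  have img: "card ((\<lambda>cs. cs @ [(m, c)]) ` codes d N (k - Suc N * m)) = num_codes d N (k - Suc N * m)" for m c
    using Suc by (subst card_image) (auto simp: inj_on_def)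
  have inner: "card (\<Union>c\<in>{..<d m}. (\<lambda>cs. cs @ [(m, c)]) ` codes d N (k - Suc N * m))
      = d m * num_codes d N (k - Suc N * m)" for m
    by (subst card_UN_disjoint) (auto simp: finite_codes img simp del: mult_Suc)
  show ?case unfolding codes.simps num_codes.simps
    by (subst card_UN_disjoint) (auto simp: finite_codes inner simp del: mult_Suc)
qed simp

lemma length_codes: "cs \<in> codes d N k \<Longrightarrow> length cs = N"
  by (induction N arbitrary: k cs) (auto split: if_splits)

text \<open>The representative \<open>f\<close> of a single constituent is a parameter:
  \<open>local_canon\<close> serves the upper bound and \<open>type_canon\<close> the lower
  bound.\<close>

definition assemble :: "(nat \<Rightarrow> nat \<Rightarrow> nat \<Rightarrow> z2_block list) \<Rightarrow> (nat \<times> nat) list \<Rightarrow> z2_block list" where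
  "assemble f cs = concat (map (\<lambda>i. f (Suc i) (fst (cs ! i)) (snd (cs ! i))) [0..<length cs])"

abbreviation canon :: "(nat \<times> nat) list \<Rightarrow> z2_block list" where
  "canon \<equiv> assemble local_canon"

lemma assemble_Nil [simp]: "assemble f [] = []"
  by (simp add: assemble_def)

lemma assemble_snoc: "assemble f (cs @ [(m, c)]) = assemble f cs @ f (Suc (length cs)) m c"
proof -
  have "map (\<lambda>i. f (Suc i) (fst ((cs @ [(m, c)]) ! i)) (snd ((cs @ [(m, c)]) ! i))) [0..<length cs]
      = map (\<lambda>i. f (Suc i) (fst (cs ! i)) (snd (cs ! i))) [0..<length cs]"
    by (rule map_cong) (auto simp: nth_append)
  moreover have "[0..<length (cs @ [(m, c)])] = [0..<length cs] @ [length cs]" by simp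
  ultimately show ?thesis unfolding assemble_def map_append concat_append by (simp only: map_append concat_append) simp
qed

definition code_rank :: "(nat \<times> nat) list \<Rightarrow> nat" where
  "code_rank cs = sum_list (map fst cs)"

lemma filter_partition_isometric: "xs \<approx> filter (\<lambda>b. \<not> P b) xs @ filter P xs"
proof (rule blocks_isometric_mset)
  show "mset xs = mset (filter (\<lambda>b. \<not> P b) xs @ filter P xs)"
    by (induction xs) auto
qed

definition blocks_valuation :: "z2_block list \<Rightarrow> nat" where
  "blocks_valuation xs = (\<Sum>b\<leftarrow>xs. block_scale b * block_rank b)"

lemma blocks_valuation_append [simp]:
  "blocks_valuation (xs @ ys) = blocks_valuation xs + blocks_valuation ys"
  by (simp add: blocks_valuation_def)

lemma blocks_valuation_filter:
  "blocks_valuation xs = blocks_valuation (filter (\<lambda>b. \<not> P b) xs) + blocks_valuation (filter P xs)"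
  by (induction xs) (auto simp: blocks_valuation_def)

lemma blocks_rank_filter:
  "blocks_rank xs = blocks_rank (filter (\<lambda>b. \<not> P b) xs) + blocks_rank (filter P xs)"
  by (induction xs) auto

lemma blocks_valuation_scale:
  "\<forall>b\<in>set xs. block_scale b = e \<Longrightarrow> blocks_valuation xs = e * blocks_rank xs"
  by (induction xs) (auto simp: blocks_valuation_def algebra_simps)

lemma global_normal_form:
  assumes "\<forall>b\<in>set xs. good_block b \<and> 0 < block_scale b \<and> block_scale b \<le> N"
  shows "\<exists>cs \<in> codes num_local_codes N (blocks_valuation xs). xs \<approx> canon cs \<and> code_rank cs = blocks_rank xs"
  using assms
proof (induction N arbitrary: xs)
  case 0
  then have "xs = []" by (cases xs) auto
  then show ?case by (simp add: blocks_valuation_def code_rank_def)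
next
  case (Suc N)
  let ?ys = "filter (\<lambda>b. block_scale b = Suc N) xs" and ?zs = "filter (\<lambda>b. block_scale b \<noteq> Suc N) xs"
  have "\<forall>b\<in>set ?zs. good_block b \<and> 0 < block_scale b \<and> block_scale b \<le> N" using Suc.prems by auto
  then obtain cs where cs: "cs \<in> codes num_local_codes N (blocks_valuation ?zs)" "?zs \<approx> canon cs"
    "code_rank cs = blocks_rank ?zs" using Suc.IH by blast
  have "\<forall>b\<in>set ?ys. good_block b \<and> block_scale b = Suc N" using Suc.prems by auto
  then obtain c where c: "c < num_local_codes (blocks_rank ?ys)" "?ys \<approx> local_canon (Suc N) (blocks_rank ?ys) c"
    using local_normal_form by blast
  have val: "blocks_valuation xs = blocks_valuation ?zs + Suc N * blocks_rank ?ys"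
    using blocks_valuation_filter[of xs "\<lambda>b. block_scale b = Suc N"] blocks_valuation_scale[of ?ys "Suc N"] by simp
  have "cs @ [(blocks_rank ?ys, c)] \<in> codes num_local_codes (Suc N) (blocks_valuation xs)"
  proof -
    have "blocks_rank ?ys \<le> blocks_valuation xs div Suc N"
      unfolding val by (simp add: less_eq_div_iff_mult_less_eq mult.commute[of "blocks_rank ?ys"])
    moreover have "blocks_valuation xs - Suc N * blocks_rank ?ys = blocks_valuation ?zs" unfolding val by simp
    ultimately show ?thesis
      using cs(1) c(1) unfolding codes.simps
      by (intro UN_I[of "blocks_rank ?ys"] UN_I[of c] imageI) (auto simp del: mult_Suc)
  qed
  moreover have "xs \<approx> canon (cs @ [(blocks_rank ?ys, c)])"
  proof -
    have "xs \<approx> ?zs @ ?ys" using filter_partition_isometric[of xs "\<lambda>b. block_scale b = Suc N"] by simp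
    also have "\<dots> \<approx> canon cs @ local_canon (Suc N) (blocks_rank ?ys) c"
      by (rule blocks_isometric_append[OF cs(2) c(2)])
    finally show ?thesis by (simp add: assemble_snoc length_codes[OF cs(1)])
  qed
  moreover have "code_rank (cs @ [(blocks_rank ?ys, c)]) = blocks_rank xs"
    using cs(3) blocks_rank_filter[of xs "\<lambda>b. block_scale b = Suc N"] by (simp add: code_rank_def)
  ultimately show ?case by blast
qed

section \<open>Determinants of block lists modulo unit squares\<close>

lemma z2adic_power2_unit_unique:
  assumes "2 ^ s * x = 2 ^ k * (y :: z2adic)" "x dvd 1" "y dvd 1"
  shows "s = k" "x = y"
proof -
  have le: "a \<le> b" if "2 ^ a * x = 2 ^ b * y" "y dvd 1" for a b and x y :: z2adic
  proof (rule ccontr)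
    assume "\<not> a \<le> b"
    then have "2 ^ a = 2 ^ b * (2 * 2 ^ (a - b - 1) :: z2adic)"
      by (simp flip: power_Suc power_add)
    then have "2 ^ b * (2 * (2 ^ (a - b - 1) * x)) = 2 ^ b * y" using that(1) by (simp add: mult.assoc)
    then have "2 * (2 ^ (a - b - 1) * x) = y" by simp
    then have "2 dvd y" by (metis dvd_triv_left)
    then show False using that(2) unfolding z2adic_unit_iff by simp
  qed
  show "s = k" using le[OF assms(1,3)] le[OF assms(1)[symmetric] assms(2)] by simp
  then show "x = y" using assms(1) by simp
qed

definition odd_part :: "int \<Rightarrow> int" where
  "odd_part D = D div 2 ^ multiplicity 2 D"

lemma odd_part:
  assumes "D \<noteq> 0"
  shows "D = 2 ^ multiplicity 2 D * odd_part D" "odd (odd_part D)"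
proof -
  show "D = 2 ^ multiplicity 2 D * odd_part D" by (simp add: odd_part_def multiplicity_dvd)
  show "odd (odd_part D)" unfolding odd_part_def using multiplicity_decompose[of D 2] assms by simp
qed

definition blocks_unit :: "z2_block list \<Rightarrow> int" where
  "blocks_unit xs = (\<Prod>b\<leftarrow>xs. block_unit b)"

lemma blocks_unit_append [simp]: "blocks_unit (xs @ ys) = blocks_unit xs * blocks_unit ys"
  by (simp add: blocks_unit_def)

lemma odd_blocks_unit: "\<forall>b\<in>set xs. good_block b \<Longrightarrow> odd (blocks_unit xs)"
proof (induction xs)
  case (Cons b xs)
  then show ?case by (cases b) (auto simp: blocks_unit_def)
qed (simp add: blocks_unit_def)

lemma eq_mod_unit_squares_blocks:
  assumes D: "D \<noteq> 0" and good: "\<forall>b\<in>set xs. good_block b"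
  shows "eq_mod_unit_squares (det (blocks_mat xs)) (of_int D) \<longleftrightarrow>
    blocks_valuation xs = multiplicity 2 D \<and> blocks_unit xs mod 8 = odd_part D mod 8"
proof -
  let ?k = "multiplicity 2 D"
  have u: "(of_int (blocks_unit xs) :: z2adic) dvd 1" "(of_int (odd_part D) :: z2adic) dvd 1"
    using odd_blocks_unit[OF good] odd_part(2)[OF D] of_int_unit_iff by blast+
  have Dz: "(of_int D :: z2adic) = 2 ^ ?k * of_int (odd_part D)"
    using arg_cong[OF odd_part(1)[OF D], of "of_int :: int \<Rightarrow> z2adic"] by (simp only: of_int_mult of_int_power of_int_numeral)
  have det: "det (blocks_mat xs) = 2 ^ blocks_valuation xs * of_int (blocks_unit xs)"
    by (simp only: det_blocks_mat blocks_valuation_def blocks_unit_def)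
  have res: "(\<exists>v. v dvd 1 \<and> (of_int (blocks_unit xs) :: z2adic) = of_int (odd_part D) * v\<^sup>2) \<longleftrightarrow>
    blocks_unit xs mod 8 = odd_part D mod 8"
    using unit_eq_mod_squares_iff[OF u] by (simp only: residue_of_int) simp
  show ?thesis
  proof
    assume "eq_mod_unit_squares (det (blocks_mat xs)) (of_int D)"
    then obtain v :: z2adic where v: "v dvd 1" "2 ^ blocks_valuation xs * of_int (blocks_unit xs) = 2 ^ ?k * (of_int (odd_part D) * v\<^sup>2)"
      unfolding eq_mod_unit_squares_def det Dz by (auto simp: mult.assoc)
    have "of_int (odd_part D) * v\<^sup>2 dvd 1"
      using u(2) v(1) by (metis is_unit_mult_iff power2_eq_square)
    note z2adic_power2_unit_unique[OF v(2) u(1) this]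
    then show "blocks_valuation xs = ?k \<and> blocks_unit xs mod 8 = odd_part D mod 8"
      using res v(1) by blast
  next
    assume "blocks_valuation xs = ?k \<and> blocks_unit xs mod 8 = odd_part D mod 8"
    then show "eq_mod_unit_squares (det (blocks_mat xs)) (of_int D)"
      unfolding eq_mod_unit_squares_def det Dz using res by (auto simp: mult.assoc)
  qed
qed

lemma z2_lattice_blocks:
  assumes G: "G \<in> z2_lattices n D" and D: "D \<noteq> 0"
  shows "\<exists>xs. (\<forall>b\<in>set xs. good_block b) \<and> z2_isometric G (blocks_mat xs) \<and> blocks_rank xs = n \<and>
    blocks_valuation xs = multiplicity 2 D \<and> blocks_unit xs mod 8 = odd_part D mod 8"
proof -
  have lat: "G \<in> carrier_mat n n" "transpose_mat G = G" "det G \<noteq> 0"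
    and sq: "eq_mod_unit_squares (det G) (of_int D)"
    using G by (auto simp: z2_lattices_def integral_z2_lattice_def)
  obtain xs where xs: "\<forall>b\<in>set xs. good_block b" "z2_isometric G (blocks_mat xs)"
    using jordan_decomposition[OF lat] by blast
  have rank: "blocks_rank xs = n" using z2_isometric_carrier[OF lat(1) xs(2)] by auto
  obtain u where u: "u dvd 1" "det (blocks_mat xs) = det G * u\<^sup>2" using z2_isometric_det[OF lat(1) xs(2)] .
  obtain w where w: "w dvd 1" "det G = of_int D * w\<^sup>2" using sq unfolding eq_mod_unit_squares_def by blast
  have "w * u dvd 1" using u(1) w(1) by simp
  moreover have "det (blocks_mat xs) = of_int D * (w * u)\<^sup>2" using u(2) w(2) by (simp add: power_mult_distrib)
  ultimately have "eq_mod_unit_squares (det (blocks_mat xs)) (of_int D)"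
    unfolding eq_mod_unit_squares_def by blast
  then show ?thesis using xs rank eq_mod_unit_squares_blocks[OF D xs(1)] by blast
qed

lemma blocks_mat_in_z2_lattices:
  assumes "\<forall>b\<in>set xs. good_block b" "D \<noteq> 0" "blocks_rank xs = n"
    "blocks_valuation xs = multiplicity 2 D" "blocks_unit xs mod 8 = odd_part D mod 8"
  shows "blocks_mat xs \<in> z2_lattices n D"
proof -
  have "transpose_mat (blocks_mat ys) = blocks_mat ys" for ys
  proof (induction ys)
    case Nil
    show ?case by (rule eq_matI) auto
  next
    case (Cons y ys)
    have "transpose_mat (block_mat y) = block_mat y"
      by (cases y) (auto simp: mat2_transpose intro!: eq_matI)
    then have "transpose_mat (blocks_mat ([y] @ ys)) = blocks_mat ([y] @ ys)"
      unfolding blocks_mat_append blocks_mat_singleton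
      by (subst dsum_transpose[of _ "block_rank y" _ "blocks_rank ys"]) (auto simp: Cons intro!: carrier_matI)
    then show ?case by simp
  qed
  moreover have "det (blocks_mat xs) \<noteq> 0"
  proof -
    have "(of_int (blocks_unit xs) :: z2adic) dvd 1"
      using odd_blocks_unit[OF assms(1)] of_int_unit_iff by blast
    then have "(of_int (blocks_unit xs) :: z2adic) \<noteq> 0" by auto
    then show ?thesis by (simp only: det_blocks_mat blocks_unit_def) simp
  qed
  ultimately show ?thesis
    using assms eq_mod_unit_squares_blocks[OF assms(2,1)] blocks_mat_carrier[of xs]
    by (simp add: z2_lattices_def integral_z2_lattice_def)
qed

section \<open>Upper bound for the number of classes\<close>

lemma z2_lattices_cover:
  assumes S: "finite S" and cover: "\<And>G. G \<in> z2_lattices n D \<Longrightarrow>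
    \<exists>xs\<in>S. blocks_mat xs \<in> z2_lattices n D \<and> z2_isometric G (blocks_mat xs)"
  shows "finite (z2_lattices n D // z2_isometry_rel n D)" "L2 n D \<le> card S"
proof -
  let ?A = "z2_lattices n D" and ?R = "z2_isometry_rel n D"
  have sub: "?A // ?R \<subseteq> (\<lambda>xs. ?R `` {blocks_mat xs}) ` S"
  proof
    fix X assume "X \<in> ?A // ?R"
    then obtain G where G: "G \<in> ?A" "X = ?R `` {G}" by (rule quotientE)
    obtain xs where xs: "xs \<in> S" "blocks_mat xs \<in> ?A" "z2_isometric G (blocks_mat xs)" using cover[OF G(1)] by blast
    then have "(G, blocks_mat xs) \<in> ?R" using G by (simp add: z2_isometry_rel_def)
    then have "?R `` {G} = ?R `` {blocks_mat xs}" by (rule equiv_class_eq[OF equiv_z2_isometry_rel])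
    then show "X \<in> (\<lambda>xs. ?R `` {blocks_mat xs}) ` S" using G xs by blast
  qed
  then show "finite (?A // ?R)" using S finite_subset by blast
  show "L2 n D \<le> card S"
    unfolding L2_def using card_mono[OF _ sub] card_image_le[OF S, of "\<lambda>xs. ?R `` {blocks_mat xs}"] S by fastforce
qed

lemma prod_list_twist: "us \<noteq> [] \<Longrightarrow> prod_list (twist d us) = (if d then 5 else 1) * prod_list us"
  by (cases us) (auto simp: twist_def)

lemma blocks_unit_Unary: "blocks_unit (map (Unary e) us) = prod_list us"
  by (simp add: blocks_unit_def comp_def)

lemma prod_list_odd_canon:
  assumes "0 < m" "c < odd_codes m"
  shows "prod_list (odd_canon m c) = (if odd c then 5 else 1) * 3 ^ (c div 2)"
proof -
  have "c div 2 \<le> m" using assms by (auto simp: odd_codes_def)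
  then have "replicate (m - c div 2) 1 @ replicate (c div 2) 3 \<noteq> ([] :: int list)" using assms by simp
  then show ?thesis unfolding odd_canon_def by (simp add: prod_list_twist)
qed

lemma odd_in_odd_canon: "u \<in> set (odd_canon m c) \<Longrightarrow> 0 < m \<Longrightarrow> c < odd_codes m \<Longrightarrow> odd u"
proof -
  assume u: "u \<in> set (odd_canon m c)" and m: "0 < m" "c < odd_codes m"
  have "odd (prod_list (odd_canon m c))" unfolding prod_list_odd_canon[OF m] by simp
  moreover have "u dvd prod_list us" if "u \<in> set us" for us :: "int list" using that by (induction us) auto
  ultimately show "odd u" using u dvd_trans by blast
qed

lemma good_local_canon: "b \<in> set (local_canon e m c) \<Longrightarrow> good_block b"
  by (auto simp: local_canon_def odd_in_odd_canon split: if_splits)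

lemma good_canon: "b \<in> set (canon cs) \<Longrightarrow> good_block b"
  by (auto simp: assemble_def good_local_canon)

text \<open>The admissible codes of the unimodular constituent when the others contribute the unit
  \<open>R\<close> and the determinant prescribes the residue \<open>\<rho>\<close> modulo
  8.\<close>

definition zero_codes :: "nat \<Rightarrow> int \<Rightarrow> int \<Rightarrow> nat set" where
  "zero_codes m R \<rho> = {c. c < num_local_codes m \<and> (blocks_unit (local_canon 0 m c) * R) mod 8 = \<rho>}"

text \<open>The unit of the code \<open>2 * j + d\<close> is \<open>5^d * 3^j\<close>. Modulo 8 its
  value fixes \<open>d\<close> and the parity of \<open>j\<close>, so at most two of the values
  \<open>j = 0, ..., 3\<close> remain.\<close>

lemma card_odd_zero_codes:
  assumes "odd R" "0 < m"
  shows "card {c \<in> zero_codes m R \<rho>. c < odd_codes m} \<le> 2"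
proof -
  have "\<forall>r\<in>{1, 3, 5, 7 :: int}. \<forall>\<rho>\<in>{0, 1, 2, 3, 4, 5, 6, 7 :: int}.
      card (Set.filter (\<lambda>c. ((if odd c then 5 else 1) * 3 ^ (c div 2) * r) mod 8 = \<rho>) {0, 1, 2, 3, 4, 5, 6, 7 :: nat}) \<le> 2"
    by code_simp
  moreover have "R mod 8 \<in> {1, 3, 5, 7}" using odd_mod_8_cases[OF assms(1)] by blast
  ultimately have "card (Set.filter (\<lambda>c. ((if odd c then 5 else 1) * 3 ^ (c div 2) * (R mod 8)) mod 8 = \<rho>) {0, 1, 2, 3, 4, 5, 6, 7 :: nat}) \<le> 2"
    if "\<rho> \<in> {0, 1, 2, 3, 4, 5, 6, 7}" using that by blast
  moreover have "{c \<in> zero_codes m R \<rho>. c < odd_codes m} \<subseteq>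
    Set.filter (\<lambda>c. ((if odd c then 5 else 1) * 3 ^ (c div 2) * (R mod 8)) mod 8 = \<rho>) {0, 1, 2, 3, 4, 5, 6, 7 :: nat}"
  proof
    fix c assume c: "c \<in> {c \<in> zero_codes m R \<rho>. c < odd_codes m}"
    then have "local_canon 0 m c = map (Unary 0) (odd_canon m c)" using assms by (simp add: local_canon_def)
    then have "((if odd c then 5 else 1) * 3 ^ (c div 2) * R) mod 8 = \<rho>"
      using c prod_list_odd_canon[OF assms(2), of c] by (simp only: zero_codes_def mem_Collect_eq blocks_unit_Unary)
    then have "((if odd c then 5 else 1) * 3 ^ (c div 2) * (R mod 8)) mod 8 = \<rho>" by (simp only: mod_mult_right_eq)
    moreover have "c < odd_codes m" "odd_codes m \<le> 8" using c by (simp, simp add: odd_codes_def)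
    then have "c \<in> {0, 1, 2, 3, 4, 5, 6, 7}" by auto
    ultimately show "c \<in> Set.filter (\<lambda>c. ((if odd c then 5 else 1) * 3 ^ (c div 2) * (R mod 8)) mod 8 = \<rho>) {0, 1, 2, 3, 4, 5, 6, 7}"
      by (simp only: Set.filter_eq mem_Collect_eq)
  qed
  moreover have "zero_codes m R \<rho> = {}" if "\<rho> \<notin> {0, 1, 2, 3, 4, 5, 6, 7}"
  proof -
    have "x mod 8 \<in> {0, 1, 2, 3, 4, 5, 6, 7}" for x :: int
    proof -
      have "0 \<le> x mod 8" "x mod 8 < 8" by simp_all
      then show ?thesis by auto
    qed
    then show ?thesis using that unfolding zero_codes_def by blast
  qed
  ultimately show ?thesis
    by (cases "\<rho> \<in> {0, 1, 2, 3, 4, 5, 6, 7}") (meson card_mono finite.intros finite_filter order.trans, simp)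
qed

text \<open>The units of the two even forms of a given rank differ by the factor -3, which is 5
  modulo 8, so that the determinant tells them apart.\<close>

lemma card_even_zero_codes:
  assumes "odd R" "0 < m"
  shows "card {c \<in> zero_codes m R \<rho>. \<not> c < odd_codes m} \<le> 1"
proof (rule ccontr)
  let ?o = "odd_codes m"
  assume contr: "\<not> ?thesis"
  have sub: "{c \<in> zero_codes m R \<rho>. \<not> c < ?o} \<subseteq> {?o, Suc ?o}"
    using assms by (auto simp: zero_codes_def num_local_codes_def split: if_splits)
  have both: "{?o, Suc ?o} \<subseteq> {c \<in> zero_codes m R \<rho>. \<not> c < ?o}"
  proof (rule ccontr)
    assume "\<not> ?thesis"
    then have "{c \<in> zero_codes m R \<rho>. \<not> c < ?o} \<subseteq> {?o} \<or> {c \<in> zero_codes m R \<rho>. \<not> c < ?o} \<subseteq> {Suc ?o}"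
      using sub by blast
    then have "card {c \<in> zero_codes m R \<rho>. \<not> c < ?o} \<le> 1"
      using card_mono[of "{?o}" "{c \<in> zero_codes m R \<rho>. \<not> c < ?o}"] card_mono[of "{Suc ?o}" "{c \<in> zero_codes m R \<rho>. \<not> c < ?o}"]
      by (elim disjE) simp_all
    then show False using contr by simp
  qed
  then have "Suc ?o < num_local_codes m" by (auto simp: zero_codes_def)
  then have "even m" using assms by (auto simp: num_local_codes_def split: if_splits)
  then obtain h where h: "m div 2 = Suc h" using assms by (cases "m div 2") auto
  have u: "blocks_unit (local_canon 0 m ?o) = - ((- 1) ^ h)" "blocks_unit (local_canon 0 m (Suc ?o)) = 3 * (- 1) ^ h"
    using assms h by (simp_all add: local_canon_def blocks_unit_def)
  have "(- ((- 1) ^ h) * R) mod 8 = (3 * (- 1) ^ h * R) mod 8"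
    using both unfolding zero_codes_def u[symmetric] by auto
  then have "8 dvd (- ((- 1) ^ h) * R) - (3 * (- 1) ^ h * R)" by (simp only: mod_eq_dvd_iff)
  also have "(- ((- 1) ^ h) * R) - (3 * (- 1) ^ h * R) = 4 * (- ((- 1) ^ h) * R)" by simp
  finally have "2 dvd - ((- 1) ^ h) * R" by (simp only: dvd_times_left_cancel_iff[of 4 2, symmetric]) simp
  then show False using assms by simp
qed

lemma finite_zero_codes: "finite (zero_codes m R \<rho>)"
  by (simp add: zero_codes_def)

lemma card_zero_codes:
  assumes "odd R"
  shows "card (zero_codes m R \<rho>) \<le> 3"
proof (cases "m = 0")
  case True
  then have "zero_codes m R \<rho> \<subseteq> {0}" by (auto simp: zero_codes_def num_local_codes_def)
  then have "card (zero_codes m R \<rho>) \<le> card {0 :: nat}" by (intro card_mono) auto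
  then show ?thesis by simp
next
  case False
  have "zero_codes m R \<rho> = {c \<in> zero_codes m R \<rho>. c < odd_codes m} \<union> {c \<in> zero_codes m R \<rho>. \<not> c < odd_codes m}" by blast
  then have "card (zero_codes m R \<rho>) \<le> card {c \<in> zero_codes m R \<rho>. c < odd_codes m} + card {c \<in> zero_codes m R \<rho>. \<not> c < odd_codes m}"
    by (metis card_Un_le)
  then show ?thesis using card_odd_zero_codes[OF assms, of m \<rho>] card_even_zero_codes[OF assms, of m \<rho>] False by linarith
qed

lemma blocks_isometric_invariants:
  assumes "xs \<approx> ys" "\<forall>b\<in>set xs. good_block b" "\<forall>b\<in>set ys. good_block b" "D \<noteq> 0"
    and "blocks_valuation xs = multiplicity 2 D" "blocks_unit xs mod 8 = odd_part D mod 8"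
  shows "blocks_valuation ys = multiplicity 2 D" "blocks_unit ys mod 8 = odd_part D mod 8"
proof -
  have "eq_mod_unit_squares (det (blocks_mat xs)) (of_int D)"
    using eq_mod_unit_squares_blocks[OF assms(4,2)] assms by blast
  then obtain w where w: "w dvd 1" "det (blocks_mat xs) = of_int D * w\<^sup>2" unfolding eq_mod_unit_squares_def by blast
  obtain u where u: "u dvd 1" "det (blocks_mat ys) = det (blocks_mat xs) * u\<^sup>2"
    using z2_isometric_det[OF blocks_mat_carrier] assms(1) unfolding blocks_isometric_def by blast
  have "w * u dvd 1" using u(1) w(1) by simp
  moreover have "det (blocks_mat ys) = of_int D * (w * u)\<^sup>2" using u(2) w(2) by (simp add: power_mult_distrib)
  ultimately have "eq_mod_unit_squares (det (blocks_mat ys)) (of_int D)"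
    unfolding eq_mod_unit_squares_def by blast
  then show "blocks_valuation ys = multiplicity 2 D" "blocks_unit ys mod 8 = odd_part D mod 8"
    using eq_mod_unit_squares_blocks[OF assms(4,3)] by blast+
qed

lemma z2_lattice_blocks_isometric:
  assumes "xs \<approx> ys" "\<forall>b\<in>set xs. good_block b" "\<forall>b\<in>set ys. good_block b" "D \<noteq> 0"
    and "blocks_valuation xs = multiplicity 2 D" "blocks_unit xs mod 8 = odd_part D mod 8"
    and "G \<in> z2_lattices n D" "z2_isometric G (blocks_mat xs)" "blocks_rank xs = n"
  shows "blocks_mat ys \<in> z2_lattices n D \<and> z2_isometric G (blocks_mat ys) \<and> blocks_unit ys mod 8 = odd_part D mod 8"
proof -
  have G: "G \<in> carrier_mat n n" using assms(7) by (simp add: z2_lattices_def integral_z2_lattice_def)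
  note inv = blocks_isometric_invariants[OF assms(1-6)]
  have "blocks_rank ys = n" using blocks_isometric_rank[OF assms(1)] assms(9) by simp
  then have "blocks_mat ys \<in> z2_lattices n D" using blocks_mat_in_z2_lattices[OF assms(3,4)] inv by blast
  moreover have "z2_isometric G (blocks_mat ys)"
    using z2_isometric_trans[OF G assms(8)] assms(1) unfolding blocks_isometric_def by blast
  ultimately show ?thesis using inv by blast
qed

lemma scale_le_blocks_valuation: "b \<in> set xs \<Longrightarrow> block_scale b \<le> blocks_valuation xs"
proof (induction xs)
  case (Cons a xs)
  have "1 \<le> block_rank a" by (cases a) auto
  then have "block_scale a \<le> block_scale a * block_rank a" by simp
  moreover have "blocks_valuation (a # xs) = block_scale a * block_rank a + blocks_valuation xs" by (simp add: blocks_valuation_def)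
  moreover have "b = a \<or> block_scale b \<le> blocks_valuation xs" using Cons by auto
  ultimately show ?case by (metis le_add1 le_add2 le_trans)
qed simp

lemma z2_lattices_cover_codes:
  assumes D: "D \<noteq> 0" and G: "G \<in> z2_lattices n D" and k: "k = multiplicity 2 D"
  shows "\<exists>cs \<in> codes num_local_codes k k. \<exists>c \<in> zero_codes (n - code_rank cs) (blocks_unit (canon cs)) (odd_part D mod 8).
    blocks_mat (local_canon 0 (n - code_rank cs) c @ canon cs) \<in> z2_lattices n D \<and>
    z2_isometric G (blocks_mat (local_canon 0 (n - code_rank cs) c @ canon cs))"
proof -
  obtain xs where xs: "\<forall>b\<in>set xs. good_block b" "z2_isometric G (blocks_mat xs)" "blocks_rank xs = n"
    "blocks_valuation xs = multiplicity 2 D" "blocks_unit xs mod 8 = odd_part D mod 8"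
    using z2_lattice_blocks[OF G D] by blast
  let ?zs = "filter (\<lambda>b. block_scale b = 0) xs" and ?ys = "filter (\<lambda>b. block_scale b \<noteq> 0) xs"
  have "blocks_valuation ?zs = 0" using blocks_valuation_scale[of ?zs 0] by simp
  then have val: "blocks_valuation ?ys = k"
    using blocks_valuation_filter[of xs "\<lambda>b. block_scale b = 0"] xs(4) k by simp
  have "\<forall>b\<in>set ?ys. good_block b \<and> 0 < block_scale b \<and> block_scale b \<le> k"
    using xs(1) scale_le_blocks_valuation[of _ ?ys] val by auto
  from global_normal_form[OF this] obtain cs where cs: "cs \<in> codes num_local_codes k k" "?ys \<approx> canon cs" "code_rank cs = blocks_rank ?ys"
    unfolding val by blast
  have rank: "blocks_rank ?zs = n - code_rank cs"
    using blocks_rank_filter[of xs "\<lambda>b. block_scale b = 0"] xs(3) cs(3) by simp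
  have "\<forall>b\<in>set ?zs. good_block b \<and> block_scale b = 0" using xs(1) by auto
  from local_normal_form[OF this] obtain c where c: "c < num_local_codes (n - code_rank cs)" "?zs \<approx> local_canon 0 (n - code_rank cs) c"
    unfolding rank by blast
  have "xs \<approx> ?ys @ ?zs" using filter_partition_isometric[of xs "\<lambda>b. block_scale b = 0"] by simp
  also have "\<dots> \<approx> ?zs @ ?ys" by (rule blocks_isometric_swap)
  also have "\<dots> \<approx> local_canon 0 (n - code_rank cs) c @ canon cs" by (rule blocks_isometric_append[OF c(2) cs(2)])
  finally have iso: "xs \<approx> local_canon 0 (n - code_rank cs) c @ canon cs" .
  have "\<forall>b\<in>set (local_canon 0 (n - code_rank cs) c @ canon cs). good_block b"
    using good_local_canon good_canon by auto
  note res = z2_lattice_blocks_isometric[OF iso xs(1) this D xs(4,5) G xs(2,3)]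
  then have "c \<in> zero_codes (n - code_rank cs) (blocks_unit (canon cs)) (odd_part D mod 8)"
    using c(1) by (simp add: zero_codes_def)
  then show ?thesis using cs(1) res by blast
qed

lemma odd_blocks_unit_canon: "odd (blocks_unit (canon cs))"
  using odd_blocks_unit good_canon by blast

lemma L2_upper:
  assumes "D \<noteq> 0" "k = multiplicity 2 D"
  shows "finite (z2_lattices n D // z2_isometry_rel n D)" "L2 n D \<le> 3 * num_codes num_local_codes k k"
proof -
  define Z where "Z cs = zero_codes (n - code_rank cs) (blocks_unit (canon cs)) (odd_part D mod 8)" for cs
  define S where "S = (\<Union>cs\<in>codes num_local_codes k k. (\<lambda>c. local_canon 0 (n - code_rank cs) c @ canon cs) ` Z cs)"
  have fin: "finite S" unfolding S_def Z_def using finite_codes finite_zero_codes by blast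
  have cover: "\<exists>xs\<in>S. blocks_mat xs \<in> z2_lattices n D \<and> z2_isometric G (blocks_mat xs)" if "G \<in> z2_lattices n D" for G
    using z2_lattices_cover_codes[OF assms(1) that assms(2)] unfolding S_def Z_def by blast
  show "finite (z2_lattices n D // z2_isometry_rel n D)" by (rule z2_lattices_cover[OF fin cover])
  have "L2 n D \<le> card S" by (rule z2_lattices_cover[OF fin cover])
  also have "\<dots> \<le> (\<Sum>cs\<in>codes num_local_codes k k. card ((\<lambda>c. local_canon 0 (n - code_rank cs) c @ canon cs) ` Z cs))"
    unfolding S_def by (rule card_UN_le[OF finite_codes])
  also have "\<dots> \<le> (\<Sum>cs\<in>codes num_local_codes k k. 3)"
  proof (rule sum_mono)
    fix cs
    show "card ((\<lambda>c. local_canon 0 (n - code_rank cs) c @ canon cs) ` Z cs) \<le> 3"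
      using card_image_le[of "Z cs" "\<lambda>c. local_canon 0 (n - code_rank cs) c @ canon cs"]
        card_zero_codes[OF odd_blocks_unit_canon, of "n - code_rank cs" cs "odd_part D mod 8"] finite_zero_codes
      unfolding Z_def by fastforce
  qed
  also have "\<dots> = 3 * num_codes num_local_codes k k" by (simp add: card_codes)
  finally show "L2 n D \<le> 3 * num_codes num_local_codes k k" .
qed

section \<open>A sharper estimate for valuation 1\<close>

lemma local_canon_rank_1:
  "local_canon e 1 0 = [Unary e 1]" "local_canon e 1 1 = [Unary e 5]"
  "local_canon e 1 2 = [Unary e 3]" "local_canon e 1 3 = [Unary e 15]"
  by (simp_all add: local_canon_def odd_codes_def odd_canon_def twist_def)

lemma Unary_rank_1_cases:
  assumes "odd b"
  shows "\<exists>c<4. [Unary e b] \<approx> local_canon e 1 c" "b mod 4 = 1 \<Longrightarrow> \<exists>c<2. [Unary e b] \<approx> local_canon e 1 c"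
proof -
  have iso: "[Unary e b] \<approx> [Unary e u]" if "b mod 8 = u mod 8" for u using Unary_mod_8[OF assms that] .
  consider "b mod 8 = 1" | "b mod 8 = 3" | "b mod 8 = 5" | "b mod 8 = 7" using odd_mod_8_cases[OF assms] by blast
  then show "\<exists>c<4. [Unary e b] \<approx> local_canon e 1 c"
  proof cases
    case 1
    then show ?thesis using iso[of 1] local_canon_rank_1(1) by (intro exI[of _ 0]) simp
  next
    case 2
    then show ?thesis using iso[of 3] local_canon_rank_1(3) by (intro exI[of _ 2]) simp
  next
    case 3
    then show ?thesis using iso[of 5] local_canon_rank_1(2) by (intro exI[of _ 1]) simp
  next
    case 4
    then show ?thesis using iso[of 15] local_canon_rank_1(4) by (intro exI[of _ 3]) simp
  qed
  show "\<exists>c<2. [Unary e b] \<approx> local_canon e 1 c" if "b mod 4 = 1"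
  proof -
    have "b mod 8 mod 4 = b mod 4" by (simp add: mod_mod_cancel)
    then have "b mod 8 = 1 \<or> b mod 8 = 5" using odd_mod_8_cases[OF assms] that by auto
    then show ?thesis
      using iso[of 1] iso[of 5] local_canon_rank_1(1,2) by (auto simp: less_2_cases_iff)
  qed
qed

lemma blocks_valuation_1:
  assumes "\<forall>b\<in>set ys. good_block b \<and> 0 < block_scale b" "blocks_valuation ys = 1"
  obtains b where "ys = [Unary 1 b]" "odd b"
proof -
  obtain y ys' where ys: "ys = y # ys'" using assms(2) by (cases ys) (auto simp: blocks_valuation_def)
  have pos: "0 < block_scale b * block_rank b" if "b \<in> set ys" for b using assms(1) that by simp
  have sum: "block_scale y * block_rank y + blocks_valuation ys' = 1" using assms(2) by (simp add: ys blocks_valuation_def)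
  moreover have "0 < block_scale y * block_rank y" using pos by (simp add: ys)
  ultimately have 1: "block_scale y * block_rank y = 1" "blocks_valuation ys' = 0" by linarith+
  have "ys' = []"
  proof (cases ys')
    case (Cons z zs)
    then have "0 < block_scale z * block_rank z" using pos[of z] by (simp add: ys)
    moreover have "block_scale z * block_rank z + blocks_valuation zs = 0" using 1(2) Cons by (simp add: blocks_valuation_def)
    ultimately show ?thesis by linarith
  qed simp
  moreover obtain b where "y = Unary 1 b" using 1(1) by (cases y) auto
  ultimately show ?thesis using that assms(1) ys by simp
qed

text \<open>The only block of positive scale is \<open><2 * b>\<close>. If the unimodular part is
  odd, \<open>Unary_adjacent_pair\<close> replaces \<open>b\<close> by
  \<open>a * b * (a + 2 * b)\<close>, which is \<open>b + 2\<close> modulo 4; so \<open>b\<close>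
  may be taken 1 modulo 4, and two codes of \<open>b\<close> remain. If it is even, \<open>b\<close>
  has four codes, but the determinant leaves only one choice for the unimodular part. Codes 0 and 1
  of \<open>b\<close> thus allow at most 2 + 1 lattices each and codes 2 and 3 at most one, which
  gives 8.\<close>

lemma L2_upper_1:
  assumes D: "D \<noteq> 0" and k: "multiplicity 2 D = 1" and n: "2 \<le> n"
  shows "L2 n D \<le> 8"
proof -
  define Z where "Z c = {c0 \<in> zero_codes (n - 1) (blocks_unit (local_canon 1 1 c)) (odd_part D mod 8). c0 < odd_codes (n - 1) \<longrightarrow> c < 2}" for c
  define S where "S = (\<Union>c\<in>{..<4}. (\<lambda>c0. local_canon 0 (n - 1) c0 @ local_canon 1 1 c) ` Z c)"
  have finZ: "finite (Z c)" for c unfolding Z_def using finite_zero_codes by simp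
  have fin: "finite S" unfolding S_def using finZ by blast
  have cover: "\<exists>xs\<in>S. blocks_mat xs \<in> z2_lattices n D \<and> z2_isometric G (blocks_mat xs)" if G: "G \<in> z2_lattices n D" for G
  proof -
    obtain xs where xs: "\<forall>b\<in>set xs. good_block b" "z2_isometric G (blocks_mat xs)" "blocks_rank xs = n"
      "blocks_valuation xs = multiplicity 2 D" "blocks_unit xs mod 8 = odd_part D mod 8"
      using z2_lattice_blocks[OF G D] by blast
    let ?zs = "filter (\<lambda>b. block_scale b = 0) xs" and ?ys = "filter (\<lambda>b. block_scale b \<noteq> 0) xs"
    have "blocks_valuation ?zs = 0" using blocks_valuation_scale[of ?zs 0] by simp
    then have "blocks_valuation ?ys = 1"
      using blocks_valuation_filter[of xs "\<lambda>b. block_scale b = 0"] xs(4) k by simp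
    moreover have "\<forall>b\<in>set ?ys. good_block b \<and> 0 < block_scale b" using xs(1) by auto
    ultimately obtain b where b: "?ys = [Unary 1 b]" "odd b" using blocks_valuation_1 by blast
    have good: "\<forall>b\<in>set ?zs. good_block b \<and> block_scale b = 0" using xs(1) by auto
    have rank: "blocks_rank ?zs = n - 1"
      using blocks_rank_filter[of xs "\<lambda>b. block_scale b = 0"] xs(3) b(1) by simp
    have part: "xs \<approx> ?zs @ [Unary 1 b]"
      using blocks_isometric_trans[OF filter_partition_isometric[of xs "\<lambda>b. block_scale b = 0"] blocks_isometric_swap]
      unfolding b(1) .
    have "\<exists>c<4. \<exists>c0<num_local_codes (n - 1). (c0 < odd_codes (n - 1) \<longrightarrow> c < 2) \<and> xs \<approx> local_canon 0 (n - 1) c0 @ local_canon 1 1 c"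
    proof (cases "\<exists>u. Unary 0 u \<in> set ?zs")
      case True
      then obtain a as bs where zs: "?zs = as @ Unary 0 a # bs" by (meson split_list)
      have a: "odd a" using good zs by auto
      obtain a' b' where ab: "odd a'" "odd b'" "b' mod 4 = 1" "[Unary 0 a, Unary 1 b] \<approx> [Unary 0 a', Unary 1 b']"
      proof (cases "b mod 4 = 1")
        case True
        then show ?thesis using that[of a b] a b by simp
      next
        case False
        then have "b mod 4 = 3" using b(2) by presburger
        then obtain b1 where b1: "b = 4 * b1 + 3" by (metis mult_div_mod_eq)
        obtain a1 where a1: "a = 2 * a1 + 1" using a by (rule oddE)
        have "a * b * (a + 2 * b) - 1 = 4 * ((a1 * a1 + a1) * b + b1 + 2 * a * (4 * b1 * b1 + 6 * b1 + 2) + a1 + 1)"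
          by (simp add: a1 b1 algebra_simps)
        then have "4 dvd a * b * (a + 2 * b) - 1" by (metis dvd_triv_left)
        then have "(a * b * (a + 2 * b)) mod 4 = 1" using mod_eq_dvd_iff[of "a * b * (a + 2 * b)" 4 1] by simp
        then show ?thesis
          using that[OF _ _ _ Unary_adjacent_pair[OF a b(2)]] a b(2) by simp
      qed
      let ?ws = "Unary 0 a' # as @ bs"
      have "xs \<approx> (as @ Unary 0 a # bs) @ [Unary 1 b]" using part unfolding zs .
      also have "\<dots> \<approx> [Unary 0 a, Unary 1 b] @ as @ bs" by (intro blocks_isometric_mset) simp
      also have "\<dots> \<approx> [Unary 0 a', Unary 1 b'] @ as @ bs" by (intro blocks_isometric_append ab(4) blocks_isometric_refl)
      also have "\<dots> \<approx> ?ws @ [Unary 1 b']" by (intro blocks_isometric_mset) simp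
      finally have 1: "xs \<approx> ?ws @ [Unary 1 b']" .
      have rank': "blocks_rank ?ws = n - 1" using rank unfolding zs by simp
      have "\<forall>b\<in>set ?ws. good_block b \<and> block_scale b = 0" using good ab(1) unfolding zs by auto
      moreover have "\<exists>u. Unary 0 u \<in> set ?ws" by auto
      ultimately obtain c0 where c0: "c0 < odd_codes (n - 1)" "?ws \<approx> local_canon 0 (n - 1) c0"
        using local_normal_form_odd[of ?ws 0] unfolding rank' by blast
      obtain c where c: "c < 2" "[Unary 1 b'] \<approx> local_canon 1 1 c" using Unary_rank_1_cases(2)[OF ab(2,3)] by blast
      have "xs \<approx> local_canon 0 (n - 1) c0 @ local_canon 1 1 c"
        using blocks_isometric_trans[OF 1 blocks_isometric_append[OF c0(2) c(2)]] .
      moreover have "c0 < num_local_codes (n - 1)" using c0(1) n by (simp add: num_local_codes_def)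
      ultimately show ?thesis using c(1) by (intro exI[of _ c]) auto
    next
      case False
      obtain c0 where c0: "c0 < num_local_codes (n - 1)" "n - 1 \<noteq> 0 \<longrightarrow> odd_codes (n - 1) \<le> c0" "?zs \<approx> local_canon 0 (n - 1) c0"
        using local_normal_form_even[OF no_Unary_even[OF good False]] unfolding rank by blast
      obtain c where c: "c < 4" "[Unary 1 b] \<approx> local_canon 1 1 c" using Unary_rank_1_cases(1)[OF b(2)] by blast
      have "xs \<approx> local_canon 0 (n - 1) c0 @ local_canon 1 1 c"
        using blocks_isometric_trans[OF part blocks_isometric_append[OF c0(3) c(2)]] .
      then show ?thesis using c(1) c0(1,2) n by (intro exI[of _ c] conjI exI[of _ c0]) auto
    qed
    then obtain c c0 where c: "c < 4" "c0 < num_local_codes (n - 1)" "c0 < odd_codes (n - 1) \<longrightarrow> c < 2"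
      "xs \<approx> local_canon 0 (n - 1) c0 @ local_canon 1 1 c" by blast
    have "\<forall>b\<in>set (local_canon 0 (n - 1) c0 @ local_canon 1 1 c). good_block b"
      using good_local_canon by auto
    note res = z2_lattice_blocks_isometric[OF c(4) xs(1) this D xs(4,5) G xs(2,3)]
    then have "c0 \<in> Z c" using c by (simp add: Z_def zero_codes_def)
    then show ?thesis using res c(1) unfolding S_def by blast
  qed
  have "L2 n D \<le> card S" by (rule z2_lattices_cover[OF fin cover])
  also have "\<dots> \<le> (\<Sum>c<4. card ((\<lambda>c0. local_canon 0 (n - 1) c0 @ local_canon 1 1 c) ` Z c))"
    unfolding S_def by (rule card_UN_le) simp
  also have "\<dots> \<le> (\<Sum>c<4. card (Z c))" by (intro sum_mono card_image_le finZ)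
  also have "\<dots> \<le> (\<Sum>c<(4 :: nat). if c < 2 then 3 else 1 :: nat)"
  proof (rule sum_mono)
    fix c :: nat
    have odd: "odd (blocks_unit (local_canon 1 1 c))" using odd_blocks_unit good_local_canon by blast
    have "card (Z c) \<le> card (zero_codes (n - 1) (blocks_unit (local_canon 1 1 c)) (odd_part D mod 8))"
      unfolding Z_def by (intro card_mono finite_zero_codes) auto
    then have 1: "card (Z c) \<le> 3" using card_zero_codes[OF odd] order.trans by blast
    have 2: "card (Z c) \<le> 1" if "\<not> c < 2"
    proof -
      have "card (Z c) \<le> card {c0 \<in> zero_codes (n - 1) (blocks_unit (local_canon 1 1 c)) (odd_part D mod 8). \<not> c0 < odd_codes (n - 1)}"
        unfolding Z_def using that by (intro card_mono) (auto simp: finite_zero_codes)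
      then show ?thesis using card_even_zero_codes[OF odd, of "n - 1" "odd_part D mod 8"] n by linarith
    qed
    show "card (Z c) \<le> (if c < 2 then 3 else 1)" using 1 2 by simp
  qed
  also have "\<dots> = 8" by (simp add: eval_nat_numeral)
  finally show ?thesis .
qed

section \<open>Invariants of isometry classes\<close>

abbreviation quad :: "z2adic mat \<Rightarrow> z2adic vec \<Rightarrow> z2adic" where
  "quad G x \<equiv> x \<bullet> (G *\<^sub>v x)"

text \<open>The intersection of the lattice \<open>L\<close> with \<open>2 ^ i\<close> times its
  dual, defined without reference to a Jordan decomposition.\<close>

definition scaled_dual :: "nat \<Rightarrow> z2adic mat \<Rightarrow> z2adic vec set" where
  "scaled_dual i G = {x \<in> carrier_vec (dim_row G). \<forall>p < dim_row G. 2 ^ i dvd (G *\<^sub>v x) $ p}"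

text \<open>The support of a vector modulo 2, that is, its class in \<open>L / 2 L\<close>.\<close>

definition oddset :: "z2adic vec \<Rightarrow> nat set" where
  "oddset x = {p. p < dim_vec x \<and> \<not> 2 dvd x $ p}"

text \<open>The order of the image of the scaled dual in \<open>L / 2 L\<close>. Only the
  constituents of scale at least \<open>2 ^ i\<close> contribute to it, which makes their total rank
  an invariant.\<close>

definition dual_count :: "nat \<Rightarrow> z2adic mat \<Rightarrow> nat" where
  "dual_count i G = card (oddset ` scaled_dual i G)"

text \<open>The values modulo \<open>2 ^ N\<close> of the quadratic form on the scaled dual.\<close>

definition dual_value :: "nat \<Rightarrow> nat \<Rightarrow> z2adic mat \<Rightarrow> z2adic \<Rightarrow> bool" where
  "dual_value i N G s \<longleftrightarrow> (\<exists>x \<in> scaled_dual i G. 2 ^ N dvd quad G x - s)"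

text \<open>Characteristic vectors: the norm of each \<open>x\<close> has the parity of the inner
  product of \<open>x\<close> and \<open>w\<close>.\<close>

definition char_vec :: "z2adic mat \<Rightarrow> z2adic vec \<Rightarrow> bool" where
  "char_vec G w \<longleftrightarrow> w \<in> carrier_vec (dim_row G) \<and>
    (\<forall>x \<in> carrier_vec (dim_row G). 2 dvd quad G x - x \<bullet> (G *\<^sub>v w))"

text \<open>The norms of characteristic vectors modulo 8, a substitute for the oddity of the genus
  symbol.\<close>

definition char_value :: "z2adic mat \<Rightarrow> z2adic \<Rightarrow> bool" where
  "char_value G s \<longleftrightarrow> (\<exists>w. char_vec G w \<and> 8 dvd quad G w - s)"

lemma mat_vec_dvd:
  fixes A :: "z2adic mat"
  assumes "A \<in> carrier_mat n m" "x \<in> carrier_vec m" "\<And>p. p < m \<Longrightarrow> d dvd x $ p" "q < n"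
  shows "d dvd (A *\<^sub>v x) $ q"
  using assms by (auto simp: scalar_prod_def intro!: dvd_sum dvd_mult)

context
  fixes G H U V :: "z2adic mat" and n :: nat
  assumes G: "G \<in> carrier_mat n n" and U: "U \<in> carrier_mat n n" and V: "V \<in> carrier_mat n n"
    and UV: "U * V = 1\<^sub>m n" and VU: "V * U = 1\<^sub>m n" and H: "H = transpose_mat U * G * U"
begin

lemma H_carrier: "H \<in> carrier_mat n n"
  unfolding H using G U by simp

lemma bilinear_transform:
  assumes "x \<in> carrier_vec n" "y \<in> carrier_vec n"
  shows "x \<bullet> (H *\<^sub>v y) = (U *\<^sub>v x) \<bullet> (G *\<^sub>v (U *\<^sub>v y))"
proof -
  have "H *\<^sub>v y = transpose_mat U *\<^sub>v (G *\<^sub>v (U *\<^sub>v y))"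
    unfolding H using G U assms by (simp add: assoc_mult_mat_vec[of _ n n _ n])
  moreover have "x \<bullet> (transpose_mat U *\<^sub>v (G *\<^sub>v (U *\<^sub>v y))) = (U *\<^sub>v x) \<bullet> (G *\<^sub>v (U *\<^sub>v y))"
    using transpose_vec_mult_scalar[of "transpose_mat U" n n "G *\<^sub>v (U *\<^sub>v y)" x] G U assms by simp
  ultimately show ?thesis by simp
qed

lemma scaled_dual_transform:
  assumes "x \<in> scaled_dual i H"
  shows "U *\<^sub>v x \<in> scaled_dual i G"
proof -
  have x: "x \<in> carrier_vec n" "\<And>p. p < n \<Longrightarrow> 2 ^ i dvd (H *\<^sub>v x) $ p"
    using assms H_carrier by (auto simp: scaled_dual_def)
  have VtUt: "transpose_mat V * transpose_mat U = 1\<^sub>m n"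
    using transpose_mult[OF U V] UV by simp
  have "transpose_mat V *\<^sub>v (H *\<^sub>v x) = (transpose_mat V * transpose_mat U) *\<^sub>v (G *\<^sub>v (U *\<^sub>v x))"
    unfolding H using G U V x(1) by (simp add: assoc_mult_mat_vec[of _ n n _ n])
  then have "G *\<^sub>v (U *\<^sub>v x) = transpose_mat V *\<^sub>v (H *\<^sub>v x)"
    unfolding VtUt using G U x(1) by simp
  moreover have "2 ^ i dvd (transpose_mat V *\<^sub>v (H *\<^sub>v x)) $ p" if "p < n" for p
    by (rule mat_vec_dvd[of _ n n]) (use that x V H_carrier in \<open>auto simp del: index_mult_mat_vec\<close>)
  ultimately show ?thesis using G U x(1) by (simp add: scaled_dual_def del: index_mult_mat_vec)
qed

lemma char_vec_transform:
  assumes "char_vec H w"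
  shows "char_vec G (U *\<^sub>v w)"
proof -
  have w: "w \<in> carrier_vec n" "\<And>x. x \<in> carrier_vec n \<Longrightarrow> 2 dvd quad H x - x \<bullet> (H *\<^sub>v w)"
    using assms H_carrier by (auto simp: char_vec_def)
  have "2 dvd quad G x - x \<bullet> (G *\<^sub>v (U *\<^sub>v w))" if x: "x \<in> carrier_vec n" for x
  proof -
    have V': "V *\<^sub>v x \<in> carrier_vec n" using V x by simp
    have "U *\<^sub>v (V *\<^sub>v x) = (U * V) *\<^sub>v x" using U V x by simp
    then have "U *\<^sub>v (V *\<^sub>v x) = x" unfolding UV using x by simp
    then show ?thesis
      using w(2)[OF V'] bilinear_transform[OF V' V'] bilinear_transform[OF V' w(1)] by simp
  qed
  then show ?thesis using w(1) G U by (simp add: char_vec_def)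
qed

lemma dual_value_transform:
  assumes "dual_value i N H s"
  shows "dual_value i N G s"
proof -
  obtain x where x: "x \<in> scaled_dual i H" "2 ^ N dvd quad H x - s" using assms unfolding dual_value_def by blast
  have xn: "x \<in> carrier_vec n" using x(1) H_carrier by (simp add: scaled_dual_def)
  show ?thesis
    unfolding dual_value_def using scaled_dual_transform[OF x(1)] x(2) unfolding bilinear_transform[OF xn xn] by blast
qed

lemma char_value_transform:
  assumes "char_value H s"
  shows "char_value G s"
proof -
  obtain w where w: "char_vec H w" "8 dvd quad H w - s" using assms unfolding char_value_def by blast
  have wn: "w \<in> carrier_vec n" using w(1) H_carrier by (simp add: char_vec_def)
  show ?thesis
    unfolding char_value_def using char_vec_transform[OF w(1)] w(2) unfolding bilinear_transform[OF wn wn] by blast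
qed

lemma oddset_mod_2:
  assumes "x \<in> carrier_vec n" "y \<in> carrier_vec n" "oddset x = oddset y"
  shows "oddset (V *\<^sub>v x) = oddset (V *\<^sub>v y)"
proof -
  have xy: "2 dvd x $ p - y $ p" if "p < n" for p
  proof -
    have "2 dvd x $ p \<longleftrightarrow> 2 dvd y $ p" using assms that by (auto simp: oddset_def set_eq_iff)
    then show ?thesis
    proof (cases "2 dvd x $ p")
      case False
      then have "2 dvd x $ p - 1" "2 dvd y $ p - 1" using \<open>2 dvd x $ p \<longleftrightarrow> 2 dvd y $ p\<close> z2adic_two_dvd_or by blast+
      then have "2 dvd (x $ p - 1) - (y $ p - 1)" by (rule dvd_diff)
      then show ?thesis by simp
    qed auto
  qed
  have "2 dvd (V *\<^sub>v (x - y)) $ p" if "p < n" for p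
    using that V assms xy by (intro mat_vec_dvd[of _ n n]) auto
  then have diff: "2 dvd (V *\<^sub>v x) $ p - (V *\<^sub>v y) $ p" if "p < n" for p
    using that V assms by (simp add: mult_minus_distrib_mat_vec[of _ n n])
  have "2 dvd (V *\<^sub>v x) $ p \<longleftrightarrow> 2 dvd (V *\<^sub>v y) $ p" if "p < n" for p
    using dvd_add_right_iff[OF diff[OF that], of "(V *\<^sub>v y) $ p"] by (simp only: diff_add_cancel)
  then show ?thesis using V by (auto simp: oddset_def)
qed

lemma dual_count_transform: "dual_count i H \<le> dual_count i G"
proof -
  \<comment> \<open>The 0-1 vector with support \<open>S\<close> represents the class of
    \<open>S\<close> in \<open>L / 2 L\<close>. As \<open>V\<close> acts on these classes, the
    classes for \<open>H\<close> are images of those for \<open>G\<close>.\<close>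
  define ind where "ind S = vec n (\<lambda>p. if p \<in> S then 1 else 0 :: z2adic)" for S
  have fin: "finite (oddset ` scaled_dual i G)"
    by (rule finite_subset[of _ "Pow {..<n}"]) (use G in \<open>auto simp: scaled_dual_def oddset_def\<close>)
  have "oddset ` scaled_dual i H \<subseteq> (\<lambda>S. oddset (V *\<^sub>v ind S)) ` oddset ` scaled_dual i G"
  proof
    fix S assume "S \<in> oddset ` scaled_dual i H"
    then obtain x where x: "x \<in> scaled_dual i H" "S = oddset x" by blast
    have xn: "x \<in> carrier_vec n" using x H_carrier by (simp add: scaled_dual_def)
    define y where "y = U *\<^sub>v x"
    have y: "y \<in> scaled_dual i G" "y \<in> carrier_vec n" unfolding y_def using scaled_dual_transform[OF x(1)] U xn by auto
    have "oddset (ind (oddset y)) = oddset y"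
      using y(2) z2adic_two_not_unit by (auto simp: oddset_def ind_def)
    then have "oddset (V *\<^sub>v ind (oddset y)) = oddset (V *\<^sub>v y)"
      using y(2) by (intro oddset_mod_2) (auto simp: ind_def)
    also have "V *\<^sub>v y = (V * U) *\<^sub>v x" unfolding y_def using U V xn by simp
    also have "\<dots> = x" unfolding VU using xn by simp
    finally show "S \<in> (\<lambda>S. oddset (V *\<^sub>v ind S)) ` oddset ` scaled_dual i G" using x(2) y(1) by blast
  qed
  then show ?thesis
    unfolding dual_count_def using fin
    by (meson card_image_le card_mono finite_imageI order.trans)
qed

end

lemma z2_isometric_invariants:
  assumes G: "G \<in> carrier_mat n n" and iso: "z2_isometric G H"
  shows "dual_count i G = dual_count i H" "dual_value i N G s \<longleftrightarrow> dual_value i N H s" "char_value G s \<longleftrightarrow> char_value H s"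
proof -
  have one: "dual_count i H \<le> dual_count i G \<and> (dual_value i N H s \<longrightarrow> dual_value i N G s) \<and> (char_value H s \<longrightarrow> char_value G s)"
    if GH: "G \<in> carrier_mat n n" "z2_isometric G H" for G H
  proof -
    obtain U V where "U \<in> carrier_mat n n" "V \<in> carrier_mat n n" "U * V = 1\<^sub>m n" "V * U = 1\<^sub>m n"
      "H = transpose_mat U * G * U" using GH by (rule z2_isometricE)
    note * = GH(1) this
    show ?thesis using dual_count_transform[OF *] dual_value_transform[OF *] char_value_transform[OF *] by blast
  qed
  have "H \<in> carrier_mat n n" "z2_isometric H G"
    using z2_isometric_carrier[OF assms] z2_isometric_sym[OF assms] by auto
  note 1 = one[OF assms] and 2 = one[OF this]
  show "dual_count i G = dual_count i H" using 1 2 by (meson order.antisym)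
  show "dual_value i N G s \<longleftrightarrow> dual_value i N H s" "char_value G s \<longleftrightarrow> char_value H s" using 1 2 by blast+
qed

context
  fixes A B :: "z2adic mat" and n m :: nat
  assumes A: "A \<in> carrier_mat n n" and B: "B \<in> carrier_mat m m"
begin

lemma dsum_mult_append:
  assumes "a \<in> carrier_vec n" "b \<in> carrier_vec m"
  shows "dsum A B *\<^sub>v (a @\<^sub>v b) = (A *\<^sub>v a) @\<^sub>v (B *\<^sub>v b)"
proof -
  have "dsum A B *\<^sub>v (a @\<^sub>v b) = (A *\<^sub>v a + 0\<^sub>m n m *\<^sub>v b) @\<^sub>v (0\<^sub>m m n *\<^sub>v a + B *\<^sub>v b)"
    using A B assms by (simp add: four_block_mat_mult_vec[of A n n "0\<^sub>m n m" m "0\<^sub>m m n" m B a b])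
  moreover have "0\<^sub>m n m *\<^sub>v b = 0\<^sub>v n" "0\<^sub>m m n *\<^sub>v a = 0\<^sub>v m"
    using assms by (auto intro!: eq_vecI simp: scalar_prod_def)
  ultimately show ?thesis using A B assms by simp
qed

lemma dsum_bilinear:
  assumes "a \<in> carrier_vec n" "b \<in> carrier_vec m" "a' \<in> carrier_vec n" "b' \<in> carrier_vec m"
  shows "(a @\<^sub>v b) \<bullet> (dsum A B *\<^sub>v (a' @\<^sub>v b')) = a \<bullet> (A *\<^sub>v a') + b \<bullet> (B *\<^sub>v b')"
  unfolding dsum_mult_append[OF assms(3,4)]
  using A B assms by (subst scalar_prod_append[of _ n _ m]) auto

lemma carrier_vec_appendE:
  fixes x :: "z2adic vec"
  assumes "x \<in> carrier_vec (dim_row (dsum A B))"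
  obtains a b where "a \<in> carrier_vec n" "b \<in> carrier_vec m" "x = a @\<^sub>v b"
proof -
  have "x \<in> carrier_vec (n + m)" using assms A B by simp
  then show ?thesis using that[of "vec_first x n" "vec_last x m"] by simp
qed

lemma scaled_dual_dsum:
  assumes "a \<in> carrier_vec n" "b \<in> carrier_vec m"
  shows "a @\<^sub>v b \<in> scaled_dual i (dsum A B) \<longleftrightarrow> a \<in> scaled_dual i A \<and> b \<in> scaled_dual i B"
proof -
  have "(\<forall>p<n + m. 2 ^ i dvd ((A *\<^sub>v a) @\<^sub>v (B *\<^sub>v b)) $ p) \<longleftrightarrow>
      (\<forall>p<n. 2 ^ i dvd (A *\<^sub>v a) $ p) \<and> (\<forall>p<m. 2 ^ i dvd (B *\<^sub>v b) $ p)" (is "?L \<longleftrightarrow> ?R")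
  proof
    assume L: ?L
    have "2 ^ i dvd (A *\<^sub>v a) $ p" if "p < n" for p
      using L[rule_format, of p] that A B by (simp del: index_mult_mat_vec)
    moreover have "2 ^ i dvd (B *\<^sub>v b) $ p" if "p < m" for p
      using L[rule_format, of "n + p"] that A B by (simp del: index_mult_mat_vec)
    ultimately show ?R by blast
  next
    assume ?R
    then show ?L using A B by (auto simp del: index_mult_mat_vec simp: index_append_vec)
  qed
  then show ?thesis
    unfolding scaled_dual_def using dsum_mult_append[OF assms] assms A B by (simp del: index_mult_mat_vec index_append_vec)
qed

lemma dual_value_dsum:
  "dual_value i N (dsum A B) s \<longleftrightarrow> (\<exists>s1 s2. dual_value i N A s1 \<and> dual_value i N B s2 \<and> s = s1 + s2)"
proof
  assume "dual_value i N (dsum A B) s"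
  then obtain x where x: "x \<in> scaled_dual i (dsum A B)" "2 ^ N dvd quad (dsum A B) x - s"
    unfolding dual_value_def by blast
  then obtain a b where ab: "a \<in> carrier_vec n" "b \<in> carrier_vec m" "x = a @\<^sub>v b"
    using carrier_vec_appendE unfolding scaled_dual_def by blast
  have 1: "a \<in> scaled_dual i A" "b \<in> scaled_dual i B" using x(1) scaled_dual_dsum[OF ab(1,2)] ab(3) by auto
  have "2 ^ N dvd quad B b - (s - quad A a)" using x(2) unfolding ab(3) dsum_bilinear[OF ab(1,2,1,2)] by (simp add: algebra_simps)
  then have "dual_value i N B (s - quad A a)" unfolding dual_value_def using 1(2) by blast
  moreover have "dual_value i N A (quad A a)" unfolding dual_value_def using 1(1) by (intro bexI[of _ a]) simp_all
  ultimately show "\<exists>s1 s2. dual_value i N A s1 \<and> dual_value i N B s2 \<and> s = s1 + s2"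
    by (intro exI[of _ "quad A a"] exI[of _ "s - quad A a"]) simp
next
  assume "\<exists>s1 s2. dual_value i N A s1 \<and> dual_value i N B s2 \<and> s = s1 + s2"
  then obtain a b s1 s2 where ab: "a \<in> scaled_dual i A" "2 ^ N dvd quad A a - s1" "b \<in> scaled_dual i B" "2 ^ N dvd quad B b - s2" "s = s1 + s2"
    unfolding dual_value_def by blast
  have c: "a \<in> carrier_vec n" "b \<in> carrier_vec m" using ab A B by (auto simp: scaled_dual_def)
  have "2 ^ N dvd (quad A a - s1) + (quad B b - s2)" using ab by (intro dvd_add) auto
  then have "2 ^ N dvd quad (dsum A B) (a @\<^sub>v b) - s" unfolding dsum_bilinear[OF c c] ab(5) by (simp add: algebra_simps)
  then show "dual_value i N (dsum A B) s" unfolding dual_value_def using scaled_dual_dsum[OF c] ab by blast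
qed

lemma char_vec_dsum:
  assumes "a \<in> carrier_vec n" "b \<in> carrier_vec m"
  shows "char_vec (dsum A B) (a @\<^sub>v b) \<longleftrightarrow> char_vec A a \<and> char_vec B b"
proof
  assume L: "char_vec (dsum A B) (a @\<^sub>v b)"
  have dim: "dim_row (dsum A B) = n + m" using A B by simp
  have *: "2 dvd (quad A x - x \<bullet> (A *\<^sub>v a)) + (quad B y - y \<bullet> (B *\<^sub>v b))" if "x \<in> carrier_vec n" "y \<in> carrier_vec m" for x y
  proof -
    have "x @\<^sub>v y \<in> carrier_vec (n + m)" using that by simp
    then have "2 dvd quad (dsum A B) (x @\<^sub>v y) - (x @\<^sub>v y) \<bullet> (dsum A B *\<^sub>v (a @\<^sub>v b))"
      using L unfolding char_vec_def dim by blast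
    then show ?thesis unfolding dsum_bilinear[OF that that] dsum_bilinear[OF that assms] by (simp add: algebra_simps)
  qed
  have z: "quad A (0\<^sub>v n) - (0\<^sub>v n) \<bullet> (A *\<^sub>v a) = 0" "quad B (0\<^sub>v m) - (0\<^sub>v m) \<bullet> (B *\<^sub>v b) = 0"
    using A B assms by (simp_all add: scalar_prod_left_zero[OF mult_mat_vec_carrier])
  show "char_vec A a \<and> char_vec B b"
    unfolding char_vec_def using *[of _ "0\<^sub>v m"] *[of "0\<^sub>v n"] z A B assms by auto
next
  assume R: "char_vec A a \<and> char_vec B b"
  show "char_vec (dsum A B) (a @\<^sub>v b)"
    unfolding char_vec_def
  proof (intro conjI ballI)
    show "a @\<^sub>v b \<in> carrier_vec (dim_row (dsum A B))" using assms A B by simp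
    fix x :: "z2adic vec" assume "x \<in> carrier_vec (dim_row (dsum A B))"
    then obtain c d where c: "c \<in> carrier_vec n" "d \<in> carrier_vec m" "x = c @\<^sub>v d" by (rule carrier_vec_appendE)
    have "2 dvd (quad A c - c \<bullet> (A *\<^sub>v a)) + (quad B d - d \<bullet> (B *\<^sub>v b))"
      using R c A B by (intro dvd_add) (auto simp: char_vec_def)
    then show "2 dvd quad (dsum A B) x - x \<bullet> (dsum A B *\<^sub>v (a @\<^sub>v b))"
      unfolding c(3) dsum_bilinear[OF c(1,2) c(1,2)] dsum_bilinear[OF c(1,2) assms] by (simp add: algebra_simps)
  qed
qed

lemma char_value_dsum:
  "char_value (dsum A B) s \<longleftrightarrow> (\<exists>s1 s2. char_value A s1 \<and> char_value B s2 \<and> s = s1 + s2)"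
proof
  assume "char_value (dsum A B) s"
  then obtain x where x: "char_vec (dsum A B) x" "8 dvd quad (dsum A B) x - s"
    unfolding char_value_def by blast
  then obtain a b where ab: "a \<in> carrier_vec n" "b \<in> carrier_vec m" "x = a @\<^sub>v b"
    using carrier_vec_appendE unfolding char_vec_def by blast
  have 1: "char_vec A a" "char_vec B b" using x(1) char_vec_dsum[OF ab(1,2)] ab(3) by auto
  have "8 dvd quad B b - (s - quad A a)" using x(2) unfolding ab(3) dsum_bilinear[OF ab(1,2,1,2)] by (simp add: algebra_simps)
  then have "char_value B (s - quad A a)" unfolding char_value_def using 1(2) by blast
  moreover have "char_value A (quad A a)" unfolding char_value_def using 1(1) by (intro exI[of _ a]) simp_all
  ultimately show "\<exists>s1 s2. char_value A s1 \<and> char_value B s2 \<and> s = s1 + s2"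
    by (intro exI[of _ "quad A a"] exI[of _ "s - quad A a"]) simp
next
  assume "\<exists>s1 s2. char_value A s1 \<and> char_value B s2 \<and> s = s1 + s2"
  then obtain a b s1 s2 where ab: "char_vec A a" "8 dvd quad A a - s1" "char_vec B b" "8 dvd quad B b - s2" "s = s1 + s2"
    unfolding char_value_def by blast
  have c: "a \<in> carrier_vec n" "b \<in> carrier_vec m" using ab A B by (auto simp: char_vec_def)
  have "8 dvd (quad A a - s1) + (quad B b - s2)" using ab by (intro dvd_add) auto
  then have "8 dvd quad (dsum A B) (a @\<^sub>v b) - s" unfolding dsum_bilinear[OF c c] ab(5) by (simp add: algebra_simps)
  then show "char_value (dsum A B) s" unfolding char_value_def using char_vec_dsum[OF c] ab by blast
qed

lemma dual_count_dsum: "dual_count i (dsum A B) = dual_count i A * dual_count i B"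
proof -
  let ?f = "\<lambda>(S, T). S \<union> (+) n ` T"
  have odd: "oddset (a @\<^sub>v b) = oddset a \<union> (+) n ` oddset b" if "a \<in> carrier_vec n" "b \<in> carrier_vec m" for a b
  proof -
    have img: "p \<in> (+) n ` oddset b \<longleftrightarrow> n \<le> p \<and> p - n \<in> oddset b" for p
      by (auto simp: image_iff intro: bexI[of _ "p - n"])
    have app: "p \<in> oddset (a @\<^sub>v b) \<longleftrightarrow> p < n + m \<and> \<not> 2 dvd (if p < n then a $ p else b $ (p - n))" for p
      using that by (auto simp: oddset_def)
    have dims: "p \<in> oddset a \<longleftrightarrow> p < n \<and> \<not> 2 dvd a $ p" "p \<in> oddset b \<longleftrightarrow> p < m \<and> \<not> 2 dvd b $ p" for p
      using that by (auto simp: oddset_def)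
    show ?thesis
    proof (rule Set.set_eqI)
      fix p
      show "p \<in> oddset (a @\<^sub>v b) \<longleftrightarrow> p \<in> oddset a \<union> (+) n ` oddset b"
        unfolding Un_iff img app dims by (cases "p < n") auto
    qed
  qed
  have "oddset ` scaled_dual i (dsum A B) = ?f ` (oddset ` scaled_dual i A \<times> oddset ` scaled_dual i B)"
  proof
    show "oddset ` scaled_dual i (dsum A B) \<subseteq> ?f ` (oddset ` scaled_dual i A \<times> oddset ` scaled_dual i B)"
    proof
      fix S assume "S \<in> oddset ` scaled_dual i (dsum A B)"
      then obtain x where x: "x \<in> scaled_dual i (dsum A B)" "S = oddset x" by blast
      then obtain a b where ab: "a \<in> carrier_vec n" "b \<in> carrier_vec m" "x = a @\<^sub>v b"
        using carrier_vec_appendE unfolding scaled_dual_def by blast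
      then have "a \<in> scaled_dual i A" "b \<in> scaled_dual i B" using x(1) scaled_dual_dsum by auto
      then show "S \<in> ?f ` (oddset ` scaled_dual i A \<times> oddset ` scaled_dual i B)"
        using x(2) odd[OF ab(1,2)] ab(3) by auto
    qed
    show "?f ` (oddset ` scaled_dual i A \<times> oddset ` scaled_dual i B) \<subseteq> oddset ` scaled_dual i (dsum A B)"
    proof
      fix S assume "S \<in> ?f ` (oddset ` scaled_dual i A \<times> oddset ` scaled_dual i B)"
      then obtain a b where ab: "a \<in> scaled_dual i A" "b \<in> scaled_dual i B" "S = oddset a \<union> (+) n ` oddset b" by auto
      have c: "a \<in> carrier_vec n" "b \<in> carrier_vec m" using ab A B by (auto simp: scaled_dual_def)
      show "S \<in> oddset ` scaled_dual i (dsum A B)"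
        using ab odd[OF c] scaled_dual_dsum[OF c, of i] by (metis image_eqI)
    qed
  qed
  moreover have "inj_on ?f (oddset ` scaled_dual i A \<times> oddset ` scaled_dual i B)"
  proof (rule inj_on_inverseI)
    fix x assume "x \<in> oddset ` scaled_dual i A \<times> oddset ` scaled_dual i B"
    then obtain S T where x: "x = (S, T)" "S \<in> oddset ` scaled_dual i A" by blast
    then have "S \<subseteq> {..<n}" using A by (auto simp: oddset_def scaled_dual_def)
    have "{p \<in> S \<union> (+) n ` T. p < n} = S" "{q. n + q \<in> S \<union> (+) n ` T} = T" using \<open>S \<subseteq> {..<n}\<close> by auto
    then show "(\<lambda>Y. ({p \<in> Y. p < n}, {q. n + q \<in> Y})) (?f x) = x" unfolding x by simp
  qed
  ultimately show ?thesis unfolding dual_count_def by (simp add: card_image card_cartesian_product)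
qed

end

section \<open>Invariants of blocks and block lists\<close>

lemma blocks_mat_Cons: "blocks_mat (x # xs) = dsum (block_mat x) (blocks_mat xs)"
  using blocks_mat_append[of "[x]" xs] by (simp only: blocks_mat_singleton append_Cons append_Nil)

lemma block_mat_carrier: "block_mat b \<in> carrier_mat (block_rank b) (block_rank b)"
  by (intro carrier_matI) simp_all

lemma power2_dvd_power2_mult: "2 ^ i dvd 2 ^ e * x \<longleftrightarrow> i \<le> e \<or> 2 ^ (i - e) dvd (x :: z2adic)"
proof (cases "i \<le> e")
  case False
  then have "2 ^ i = 2 ^ e * (2 :: z2adic) ^ (i - e)" by (simp flip: power_add)
  then show ?thesis using False by simp
qed (simp add: le_imp_power_dvd dvd_mult2)

lemma dvd_mult_unit: "u dvd 1 \<Longrightarrow> a dvd b * u \<longleftrightarrow> a dvd (b :: z2adic)"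
  by (metis dvd_mult2 dvd_mult_unit_iff' mult.commute)

lemma Unary_mult_vec:
  assumes "x \<in> carrier_vec 1" "y \<in> carrier_vec 1"
  shows "(block_mat (Unary e u) *\<^sub>v x) $ 0 = 2 ^ e * of_int u * x $ 0"
    "x \<bullet> (block_mat (Unary e u) *\<^sub>v y) = x $ 0 * (2 ^ e * of_int u * y $ 0)"
  using assms by (auto simp: scalar_prod_def)

lemma scaled_dual_Unary:
  assumes "odd u"
  shows "x \<in> scaled_dual i (block_mat (Unary e u)) \<longleftrightarrow> x \<in> carrier_vec 1 \<and> (i \<le> e \<or> 2 ^ (i - e) dvd x $ 0)"
proof -
  have "(of_int u :: z2adic) dvd 1" using assms of_int_unit_iff by blast
  then have "2 ^ i dvd 2 ^ e * of_int u * x $ 0 \<longleftrightarrow> i \<le> e \<or> 2 ^ (i - e) dvd x $ 0"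
    using dvd_mult_unit[of "of_int u" "2 ^ i" "2 ^ e * x $ 0"] power2_dvd_power2_mult[of i e "x $ 0"]
    by (simp only: mult.assoc mult.commute mult.left_commute)
  then show ?thesis
    unfolding scaled_dual_def using Unary_mult_vec(1)[of x x e u] by (auto simp del: index_mult_mat_vec)
qed

lemma scaled_dual_Hyp:
  "x \<in> scaled_dual i (block_mat (Hyp e)) \<longleftrightarrow> x \<in> carrier_vec 2 \<and> (i \<le> e \<or> 2 ^ (i - e) dvd x $ 0 \<and> 2 ^ (i - e) dvd x $ 1)"
proof -
  have mv: "(block_mat (Hyp e) *\<^sub>v x) $ 0 = 2 ^ e * x $ 1" "(block_mat (Hyp e) *\<^sub>v x) $ 1 = 2 ^ e * x $ 0"
    if "x \<in> carrier_vec 2"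
    using that by (auto simp: scalar_prod_def mat2_def numeral_2_eq_2)
  have two: "(\<forall>p<2. P p) \<longleftrightarrow> P 0 \<and> P (1 :: nat)" for P by (auto simp: less_2_cases_iff)
  have "x \<in> scaled_dual i (block_mat (Hyp e)) \<longleftrightarrow>
      x \<in> carrier_vec 2 \<and> 2 ^ i dvd 2 ^ e * x $ 1 \<and> 2 ^ i dvd 2 ^ e * x $ 0"
    unfolding scaled_dual_def block_mat_dim block_rank.simps mem_Collect_eq two using mv by (metis (no_types))
  then show ?thesis unfolding power2_dvd_power2_mult by blast
qed

lemma zero_in_scaled_dual: "0\<^sub>v (dim_row G) \<in> scaled_dual i G" if "G \<in> carrier_mat n n"
proof -
  have "G *\<^sub>v 0\<^sub>v (dim_row G) = 0\<^sub>v n" using that by (intro eq_vecI) auto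
  then show ?thesis using that by (simp add: scaled_dual_def del: index_mult_mat_vec)
qed

lemma dual_count_full:
  assumes "scaled_dual i G = carrier_vec r"
  shows "dual_count i G = 2 ^ r"
proof -
  have "oddset ` carrier_vec r = Pow {..<r}"
  proof
    show "oddset ` carrier_vec r \<subseteq> Pow {..<r}" by (auto simp: oddset_def)
    show "Pow {..<r} \<subseteq> oddset ` carrier_vec r"
    proof
      fix S assume "S \<in> Pow {..<r}"
      then have "S = oddset (vec r (\<lambda>p. if p \<in> S then 1 else 0))"
        using z2adic_two_not_unit by (auto simp: oddset_def split: if_splits)
      then show "S \<in> oddset ` carrier_vec r" by (rule image_eqI) simp
    qed
  qed
  then show ?thesis by (simp add: dual_count_def assms card_Pow)
qed

lemma dual_count_trivial:
  assumes "G \<in> carrier_mat n n" "\<And>x p. x \<in> scaled_dual i G \<Longrightarrow> p < n \<Longrightarrow> 2 dvd x $ p"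
  shows "dual_count i G = 1"
proof -
  have "oddset x = {}" if "x \<in> scaled_dual i G" for x
    using assms(2)[OF that] that assms(1) by (auto simp: oddset_def scaled_dual_def)
  then have "oddset ` scaled_dual i G = {{}}" using zero_in_scaled_dual[OF assms(1)] by blast
  then show ?thesis by (simp add: dual_count_def)
qed

text \<open>The lattices built for the lower bound contain no \<open>Ani\<close> block, so the
  invariants are computed for the other two kinds only.\<close>

fun split_block :: "z2_block \<Rightarrow> bool" where
  "split_block (Unary e u) \<longleftrightarrow> odd u" | "split_block (Hyp e) \<longleftrightarrow> True" | "split_block (Ani e) \<longleftrightarrow> False"

lemma split_block_good: "split_block b \<Longrightarrow> good_block b"
  by (cases b) auto

lemma even_power2_dvd: "e < i \<Longrightarrow> 2 ^ (i - e) dvd x \<Longrightarrow> 2 dvd (x :: z2adic)"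
  by (metis dvd_power dvd_trans zero_less_diff)

lemma dual_count_block:
  assumes "split_block b"
  shows "dual_count i (block_mat b) = (if i \<le> block_scale b then 2 ^ block_rank b else 1)"
proof (cases b)
  case (Unary e u)
  then have u: "odd u" using assms by simp
  show ?thesis
  proof (cases "i \<le> e")
    case True
    then have "scaled_dual i (block_mat b) = carrier_vec 1" using scaled_dual_Unary[OF u] unfolding Unary by blast
    then show ?thesis using dual_count_full True Unary by fastforce
  next
    case False
    have "dual_count i (block_mat b) = 1"
      by (rule dual_count_trivial[OF block_mat_carrier])
        (use False u even_power2_dvd in \<open>auto simp: Unary scaled_dual_Unary simp del: block_mat.simps\<close>)
    then show ?thesis using False Unary by simp
  qed
next
  case (Hyp e)
  show ?thesis
  proof (cases "i \<le> e")
    case True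
    then have "scaled_dual i (block_mat b) = carrier_vec 2" using scaled_dual_Hyp unfolding Hyp by blast
    then show ?thesis using dual_count_full True Hyp by fastforce
  next
    case False
    have "dual_count i (block_mat b) = 1"
    proof (rule dual_count_trivial[OF block_mat_carrier])
      fix x p assume x: "x \<in> scaled_dual i (block_mat b)" and "p < block_rank b"
      then have "p = 0 \<or> p = 1" by (auto simp: Hyp)
      moreover have "2 dvd x $ 0" "2 dvd x $ 1"
        using x False even_power2_dvd[of e i] unfolding Hyp scaled_dual_Hyp by auto
      ultimately show "2 dvd x $ p" by auto
    qed
    then show ?thesis using False Hyp by simp
  qed
qed (use assms in simp)

definition rank_from :: "nat \<Rightarrow> z2_block list \<Rightarrow> nat" where
  "rank_from i xs = blocks_rank (filter (\<lambda>b. i \<le> block_scale b) xs)"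

lemma dual_count_blocks:
  assumes "\<forall>b\<in>set xs. split_block b"
  shows "dual_count i (blocks_mat xs) = 2 ^ rank_from i xs"
  using assms
proof (induction xs)
  case Nil
  have "scaled_dual i (blocks_mat []) = carrier_vec 0" by (auto simp: scaled_dual_def)
  then show ?case using dual_count_full by (fastforce simp: rank_from_def)
next
  case (Cons b xs)
  then show ?case
    unfolding blocks_mat_Cons dual_count_dsum[OF block_mat_carrier blocks_mat_carrier]
    by (simp add: dual_count_block rank_from_def power_add)
qed

text \<open>For blocks of scale other than \<open>2 ^ i\<close> the norms on the scaled dual are
  always divisible by \<open>2 ^ Suc i\<close>, so the condition expresses that the constituent of
  scale \<open>2 ^ i\<close> is even. Formulated with \<open>dual_value\<close>, it inherits
  invariance under isometry.\<close>

definition even_at :: "nat \<Rightarrow> z2adic mat \<Rightarrow> bool" where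
  "even_at i G \<longleftrightarrow> (\<forall>s. dual_value i (Suc i) G s \<longrightarrow> 2 ^ Suc i dvd s)"

lemma dual_value_0:
  assumes "G \<in> carrier_mat n n"
  shows "dual_value i N G 0"
  unfolding dual_value_def
proof (rule bexI[OF _ zero_in_scaled_dual[OF assms]])
  show "2 ^ N dvd quad G (0\<^sub>v (dim_row G)) - 0"
    using assms by (simp add: scalar_prod_left_zero[OF mult_mat_vec_carrier])
qed

lemma even_at_dsum:
  assumes A: "A \<in> carrier_mat n n" and B: "B \<in> carrier_mat m m"
  shows "even_at i (dsum A B) \<longleftrightarrow> even_at i A \<and> even_at i B"
proof
  assume L: "even_at i (dsum A B)"
  have "2 ^ Suc i dvd s" if "dual_value i (Suc i) A s \<or> dual_value i (Suc i) B s" for s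
  proof -
    have "dual_value i (Suc i) (dsum A B) s"
      unfolding dual_value_dsum[OF assms] using that dual_value_0[OF A] dual_value_0[OF B]
      by (metis add.left_neutral add.right_neutral)
    then show ?thesis using L unfolding even_at_def by blast
  qed
  then show "even_at i A \<and> even_at i B" unfolding even_at_def by blast
next
  assume "even_at i A \<and> even_at i B"
  then show "even_at i (dsum A B)"
    unfolding even_at_def dual_value_dsum[OF assms] by (auto intro: dvd_add)
qed

lemma even_at_iff: "even_at i G \<longleftrightarrow> (\<forall>x \<in> scaled_dual i G. 2 ^ Suc i dvd quad G x)"
proof
  assume L: "even_at i G"
  show "\<forall>x \<in> scaled_dual i G. 2 ^ Suc i dvd quad G x"
  proof
    fix x assume "x \<in> scaled_dual i G"
    then have "dual_value i (Suc i) G (quad G x)" unfolding dual_value_def by (intro bexI[of _ x]) simp_all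
    then show "2 ^ Suc i dvd quad G x" using L unfolding even_at_def by blast
  qed
next
  assume R: "\<forall>x \<in> scaled_dual i G. 2 ^ Suc i dvd quad G x"
  show "even_at i G"
    unfolding even_at_def dual_value_def using R by (auto dest: dvd_diff simp: dvd_diff_right_iff)
qed

text \<open>In a block of scale \<open>2 ^ e\<close> the coordinates of a vector of the scaled dual
  are arbitrary if \<open>i <= e\<close>, and divisible by \<open>2 ^ (i - e)\<close> otherwise. In
  the second case a product of two of them raises the exponent to \<open>2 * i - e\<close>, which is
  more than \<open>i\<close>; in the first the exponent is at least \<open>e + a\<close>.\<close>

lemma power2_mult_dvd:
  assumes "i \<le> e \<and> 2 ^ a dvd x \<or> e < i \<and> 2 ^ (i - e) dvd y \<and> 2 ^ (i - e) dvd x" "i < e + a"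
  shows "2 ^ Suc i dvd 2 ^ e * (x * (y :: z2adic))"
proof (cases "i \<le> e")
  case True
  then have "2 ^ (e + a) dvd 2 ^ e * (x * y)" unfolding power_add using assms by (intro mult_dvd_mono) auto
  then show ?thesis using assms(2) by (meson dvd_trans le_imp_power_dvd Suc_leI)
next
  case False
  then have "2 ^ (e + ((i - e) + (i - e))) dvd 2 ^ e * (x * y)"
    unfolding power_add using assms by (intro mult_dvd_mono) auto
  moreover have "Suc i \<le> e + ((i - e) + (i - e))" using False by simp
  ultimately show ?thesis by (meson dvd_trans le_imp_power_dvd)
qed

lemma even_at_Unary:
  assumes "odd u"
  shows "even_at i (block_mat (Unary e u)) \<longleftrightarrow> i \<noteq> e"
proof -
  have unit: "(of_int u :: z2adic) dvd 1" using assms of_int_unit_iff by blast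
  have quad: "quad (block_mat (Unary e u)) x = 2 ^ e * (x $ 0 * x $ 0) * of_int u" if "x \<in> carrier_vec 1" for x
    using Unary_mult_vec(2)[OF that that] by (simp only: ac_simps)
  show ?thesis
  proof
    assume even: "even_at i (block_mat (Unary e u))"
    show "i \<noteq> e"
    proof
      assume "i = e"
      define x :: "z2adic vec" where "x = vec 1 (\<lambda>_. 1)"
      have "x \<in> carrier_vec 1" by (simp add: x_def)
      then have "2 ^ Suc i dvd 2 ^ e * (x $ 0 * x $ 0) * of_int u"
        using even scaled_dual_Unary[OF assms, of x i e] \<open>i = e\<close> unfolding even_at_iff quad[OF \<open>x \<in> carrier_vec 1\<close>, symmetric] by simp
      then have "2 ^ Suc i dvd 2 ^ e * (1 :: z2adic)" using dvd_mult_unit[OF unit] by (simp add: x_def)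
      then show False using \<open>i = e\<close> power2_dvd_power2_mult[of "Suc i" e 1] z2adic_two_not_unit by simp
    qed
  next
    assume ne: "i \<noteq> e"
    show "even_at i (block_mat (Unary e u))"
      unfolding even_at_iff
    proof
      fix x assume "x \<in> scaled_dual i (block_mat (Unary e u))"
      then have x: "x \<in> carrier_vec 1" "i \<le> e \<or> 2 ^ (i - e) dvd x $ 0" unfolding scaled_dual_Unary[OF assms] by auto
      have "2 ^ Suc i dvd 2 ^ e * (x $ 0 * x $ 0)"
      proof (cases "i < e")
        case True
        then show ?thesis using power2_mult_dvd[of i e 0 "x $ 0" "x $ 0"] by simp
      next
        case False
        then have "e < i" using ne by simp
        then show ?thesis using power2_mult_dvd[of i e "i - e + 1" "x $ 0" "x $ 0"] x(2) by simp
      qed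
      then show "2 ^ Suc i dvd quad (block_mat (Unary e u)) x" unfolding quad[OF x(1)] by (rule dvd_mult2)
    qed
  qed
qed

lemma even_at_Hyp: "even_at i (block_mat (Hyp e))"
  unfolding even_at_iff
proof
  fix x assume "x \<in> scaled_dual i (block_mat (Hyp e))"
  then have x: "x \<in> carrier_vec 2" "i \<le> e \<or> 2 ^ (i - e) dvd x $ 0 \<and> 2 ^ (i - e) dvd x $ 1"
    unfolding scaled_dual_Hyp by auto
  have "quad (block_mat (Hyp e)) x = 2 ^ e * (2 * x $ 0 * x $ 1)"
    using x(1) by (auto simp: scalar_prod_def mat2_def numeral_2_eq_2 algebra_simps)
  moreover have "2 ^ Suc i dvd 2 ^ e * (2 * x $ 0 * x $ 1)"
  proof (cases "i \<le> e")
    case True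
    then show ?thesis using power2_mult_dvd[of i e 1 "2 * x $ 0" "x $ 1"] by (simp add: mult.assoc)
  next
    case False
    then show ?thesis
      using power2_mult_dvd[of i e "i - e + 1" "2 * x $ 0" "x $ 1"] x(2) by (simp add: mult.assoc)
  qed
  ultimately show "2 ^ Suc i dvd quad (block_mat (Hyp e)) x" by simp
qed

lemma even_at_blocks:
  assumes "\<forall>b\<in>set xs. split_block b"
  shows "even_at i (blocks_mat xs) \<longleftrightarrow> (\<nexists>u. Unary i u \<in> set xs)"
  using assms
proof (induction xs)
  case Nil
  have "blocks_mat [] *\<^sub>v x = 0\<^sub>v 0" for x by (intro eq_vecI) auto
  then show ?case unfolding even_at_iff by (auto simp: scaled_dual_def scalar_prod_def)
next
  case (Cons b xs)
  have "even_at i (block_mat b) \<longleftrightarrow> (\<nexists>u. b = Unary i u)"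
    using Cons.prems by (cases b) (auto simp: even_at_Unary even_at_Hyp simp del: block_mat.simps)
  then show ?case
    unfolding blocks_mat_Cons even_at_dsum[OF block_mat_carrier blocks_mat_carrier] using Cons by auto
qed

section \<open>Numerical bounds\<close>

lemma nonneg_if_deriv_nonneg:
  fixes f :: "real \<Rightarrow> real"
  assumes "\<And>t. 0 \<le> t \<Longrightarrow> (f has_real_derivative f' t) (at t)" "\<And>t. 0 \<le> t \<Longrightarrow> 0 \<le> f' t"
    and "f 0 = 0" "0 \<le> x"
  shows "0 \<le> f x"
  using DERIV_nonneg_imp_nondecreasing[of 0 x f] assms by fastforce

lemma arctan_bounds:
  assumes "0 \<le> x"
  shows "x - x ^ 3 / 3 \<le> arctan x" "arctan x \<le> x - x ^ 3 / 3 + x ^ 5 / 5"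
proof -
  have nz: "1 + t\<^sup>2 \<noteq> 0" for t :: real by (simp add: add_nonneg_eq_0_iff)
  have "0 \<le> arctan x - (x - x ^ 3 / 3)"
  proof (rule nonneg_if_deriv_nonneg[where f = "\<lambda>x. arctan x - (x - x ^ 3 / 3)" and f' = "\<lambda>t. t ^ 4 / (1 + t\<^sup>2)"])
    show "((\<lambda>x. arctan x - (x - x ^ 3 / 3)) has_real_derivative t ^ 4 / (1 + t\<^sup>2)) (at t)" for t
    proof -
      have "t ^ 4 / (1 + t\<^sup>2) = inverse (1 + t\<^sup>2) - (1 - t\<^sup>2)"
        using nz[of t] by (simp add: divide_simps) (simp add: algebra_simps power2_eq_square power4_eq_xxxx)
      then show ?thesis by (auto intro!: derivative_eq_intros)
    qed
  qed (use assms in auto)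
  then show "x - x ^ 3 / 3 \<le> arctan x" by simp
  have "0 \<le> x - x ^ 3 / 3 + x ^ 5 / 5 - arctan x"
  proof (rule nonneg_if_deriv_nonneg[where f = "\<lambda>x. x - x ^ 3 / 3 + x ^ 5 / 5 - arctan x" and f' = "\<lambda>t. t ^ 6 / (1 + t\<^sup>2)"])
    show "((\<lambda>x. x - x ^ 3 / 3 + x ^ 5 / 5 - arctan x) has_real_derivative t ^ 6 / (1 + t\<^sup>2)) (at t)" for t
    proof -
      have "t ^ 6 / (1 + t\<^sup>2) = 1 - t\<^sup>2 + t ^ 4 - inverse (1 + t\<^sup>2)"
        using nz[of t] by (simp add: divide_simps) (simp add: algebra_simps eval_nat_numeral)
      then show ?thesis by (auto intro!: derivative_eq_intros)
    qed
  qed (use assms in auto)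
  then show "arctan x \<le> x - x ^ 3 / 3 + x ^ 5 / 5" by simp
qed

lemma pi_bounds: "31 / 10 \<le> pi" "pi \<le> 31417 / 10000"
proof -
  have "pi = 16 * arctan (1 / 5) - 4 * arctan (1 / 239)" using machin by simp
  moreover have "arctan (1 / 5) \<le> 1 / 5 - (1 / 5) ^ 3 / 3 + (1 / 5) ^ 5 / 5" "1 / 5 - (1 / 5) ^ 3 / 3 \<le> arctan (1 / 5)"
    "1 / 239 - (1 / 239) ^ 3 / 3 \<le> arctan (1 / 239)" "arctan (1 / 239) \<le> 1 / 239 - (1 / 239) ^ 3 / 3 + (1 / 239) ^ 5 / 5"
    using arctan_bounds by simp_all
  ultimately show "31 / 10 \<le> pi" "pi \<le> 31417 / 10000" by (simp_all add: eval_nat_numeral)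
qed

lemma exp_1_le: "exp 1 \<le> (68 / 25 :: real)"
proof -
  obtain t :: real where t: "\<bar>t\<bar> \<le> \<bar>1\<bar>" "exp 1 = (\<Sum>m<7. 1 ^ m / fact m) + exp t / fact 7 * 1 ^ 7"
    using Maclaurin_exp_le[of 1 7] by blast
  have "exp t \<le> exp 1" using t(1) by simp
  then have "exp t \<le> 3" using exp_le by linarith
  then show ?thesis using t(2) by (simp add: eval_nat_numeral)
qed

lemma exp_ge_partial_sum:
  assumes "0 \<le> (x :: real)" "finite A"
  shows "(\<Sum>n\<in>A. x ^ n /\<^sub>R fact n) \<le> exp x"
  unfolding exp_def by (rule sum_le_suminf[OF summable_exp_generic assms(2)]) (use assms in auto)

text \<open>It is applied at \<open>x = 5 / 2 * sqrt k\<close>, where the even powers are rational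
  expressions in \<open>k\<close>.\<close>

lemma exp_ge_even_terms:
  assumes "0 \<le> (x :: real)"
  shows "x\<^sup>2 / 2 + x ^ 4 / 24 + x ^ 6 / 720 + x ^ 8 / 40320 \<le> exp x"
  using exp_ge_partial_sum[OF assms, of "{2, 4, 6, 8}"] by (simp add: fact_numeral field_simps)

section \<open>Upper estimate of the number of codes\<close>

lemma num_codes_upper_step:
  fixes C F :: real
  assumes IH: "\<And>k. real (num_codes d N k) \<le> C * (7 / 2) ^ k" and "0 \<le> C"
    and F: "\<And>M. (\<Sum>m\<le>M. real (d m) * ((2 / 7) ^ Suc N) ^ m) \<le> F"
  shows "real (num_codes d (Suc N) k) \<le> C * F * (7 / 2) ^ k"
proof -
  have "real (num_codes d (Suc N) k)
      = (\<Sum>m\<le>k div Suc N. real (d m) * real (num_codes d N (k - Suc N * m)))"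
    by (simp del: mult_Suc)
  also have "\<dots> \<le> (\<Sum>m\<le>k div Suc N. real (d m) * (C * (7 / 2) ^ (k - Suc N * m)))"
    by (intro sum_mono mult_left_mono IH) auto
  \<comment> \<open>The power \<open>(7 / 2) ^ (k - Suc N * m)\<close> splits, which leaves the
    generating series of the new factor evaluated at 2/7.\<close>
  also have "\<dots> = (\<Sum>m\<le>k div Suc N. C * (7 / 2) ^ k * (real (d m) * ((2 / 7) ^ Suc N) ^ m))"
  proof (intro sum.cong refl)
    fix m assume "m \<in> {..k div Suc N}"
    then have "Suc N * m \<le> k"
      by (metis atMost_iff div_le_mono div_mult_self1_is_m le_trans less_eq_div_iff_mult_less_eq mult.commute zero_less_Suc)
    then have "(7 / 2 :: real) ^ (k - Suc N * m) = (7 / 2) ^ k * (2 / 7) ^ (Suc N * m)"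
      by (simp add: power_diff power_divide field_simps del: mult_Suc)
    then show "real (d m) * (C * (7 / 2) ^ (k - Suc N * m)) = C * (7 / 2) ^ k * (real (d m) * ((2 / 7) ^ Suc N) ^ m)"
      by (simp add: power_mult del: mult_Suc)
  qed
  also have "\<dots> = C * (7 / 2) ^ k * (\<Sum>m\<le>k div Suc N. real (d m) * ((2 / 7) ^ Suc N) ^ m)"
    by (simp add: sum_distrib_left)
  also have "\<dots> \<le> C * (7 / 2) ^ k * F"
    using F assms(2) by (intro mult_left_mono) auto
  finally show ?thesis by (simp add: ac_simps)
qed

lemma num_local_codes_simps:
  "num_local_codes 0 = 1" "num_local_codes 1 = 4" "num_local_codes 2 = 8" "num_local_codes 3 = 8"
  "num_local_codes m \<le> 10"
  by (auto simp: num_local_codes_def odd_codes_def)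

lemma local_codes_series:
  fixes y :: real
  assumes "0 \<le> y" "y < 1"
  shows "(\<Sum>m\<le>M. real (num_local_codes m) * y ^ m) \<le> 1 + 4 * y + 8 * y\<^sup>2 + 10 * y ^ 3 / (1 - y)"
proof -
  have d10: "real (num_local_codes m) \<le> 10" for m
    using num_local_codes_simps(5)[of m] by linarith
  have geo: "(\<Sum>m<n. 10 * y ^ (m + 3)) \<le> 10 * y ^ 3 / (1 - y)" for n
  proof -
    have "(\<Sum>m<n. 10 * y ^ (m + 3)) = 10 * y ^ 3 * (\<Sum>m<n. y ^ m)"
      unfolding sum_distrib_left by (intro sum.cong) (auto simp: power_add)
    also have "\<dots> \<le> 10 * y ^ 3 * (1 / (1 - y))"
    proof (intro mult_left_mono)
      have "(\<Sum>m<n. y ^ m) = (1 - y ^ n) / (1 - y)" using assms by (simp add: sum_gp_strict)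
      also have "\<dots> \<le> 1 / (1 - y)" using assms by (intro divide_right_mono) auto
      finally show "(\<Sum>m<n. y ^ m) \<le> 1 / (1 - y)" .
    qed (use assms in auto)
    finally show ?thesis by simp
  qed
  have "(\<Sum>m\<le>M. real (num_local_codes m) * y ^ m) \<le> (\<Sum>m<M + 3. real (num_local_codes m) * y ^ m)"
    using assms by (intro sum_mono2) auto
  also have "\<dots> = (\<Sum>m<3. real (num_local_codes m) * y ^ m) + (\<Sum>m<M. real (num_local_codes (m + 3)) * y ^ (m + 3))"
    using sum.atLeastLessThan_concat[of 0 3 "M + 3" "\<lambda>m. real (num_local_codes m) * y ^ m"]
      sum.shift_bounds_nat_ivl[of "\<lambda>m. real (num_local_codes m) * y ^ m" 0 3 M]
    by (simp add: lessThan_atLeast0)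
  also have "\<dots> \<le> (\<Sum>m<3. real (num_local_codes m) * y ^ m) + (\<Sum>m<M. 10 * y ^ (m + 3))"
    using assms d10 by (intro add_left_mono sum_mono mult_right_mono) auto
  also have "(\<Sum>m<3. real (num_local_codes m) * y ^ m) = 1 + 4 * y + 8 * y\<^sup>2"
    using num_local_codes_simps by (simp add: numeral_3_eq_3 numeral_2_eq_2)
  finally show ?thesis using geo[of M] by linarith
qed

text \<open>A coefficient is at most the value of the generating function at 2/7, times
  \<open>(7 / 2) ^ k\<close>; the base 7/2 is slightly below (3 + sqrt 17) / 2, about 3.56. The
  bracket keeps the bounds below 16/3 uniformly in \<open>N\<close>: with
  \<open>y = (2 / 7) ^ Suc N\<close> the old bracket is \<open>1 - 7 * y\<close>, the new factor is
  at most \<open>1 + 5 * y\<close>, and their product is at most the new bracket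
  \<open>1 - 2 * y\<close>.\<close>

lemma num_codes_upper:
  assumes "2 \<le> N"
  shows "real (num_codes num_local_codes N k) \<le> 16 / 3 * (1 - 2 * (2 / 7) ^ N) * (7 / 2) ^ k"
  using assms
proof (induction N arbitrary: k rule: dec_induct)
  case base
  have 0: "real (num_codes num_local_codes 0 k) \<le> 1 * (7 / 2) ^ k" for k by simp
  have 1: "real (num_codes num_local_codes (Suc 0) k) \<le> 1 * (313 / 100) * (7 / 2) ^ k" for k
    by (rule num_codes_upper_step[OF 0]; (rule order.trans[OF local_codes_series])?)
      (simp_all add: power2_eq_square power3_eq_cube)
  have "real (num_codes num_local_codes (Suc (Suc 0)) k) \<le> 1 * (313 / 100) * (1409 / 1000) * (7 / 2) ^ k"
    by (rule num_codes_upper_step[OF 1]; (rule order.trans[OF local_codes_series])?)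
      (simp_all add: power2_eq_square power3_eq_cube)
  also have "\<dots> \<le> 16 / 3 * (1 - 2 * (2 / 7) ^ 2) * (7 / 2) ^ k"
    by (intro mult_right_mono) (simp_all add: power2_eq_square)
  finally show ?case by (simp add: numeral_2_eq_2)
next
  case (step N)
  define y :: real where "y = (2 / 7) ^ Suc N"
  have y: "0 < y" by (simp add: y_def)
  have "y \<le> (2 / 7) ^ Suc 2" unfolding y_def using step.hyps by (intro power_decreasing) auto
  then have y2: "y \<le> 1 / 40" by (simp add: power3_eq_cube)
  have F: "(\<Sum>m\<le>M. real (num_local_codes m) * ((2 / 7) ^ Suc N) ^ m) \<le> 1 + 5 * y" for M
  proof -
    have "10 * y ^ 3 / (1 - y) \<le> 10 * y ^ 3 * 2"
      using y y2 by (simp add: field_simps)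
    also have "\<dots> = y * (20 * (y * y))" by (simp add: power3_eq_cube)
    also have "\<dots> \<le> y * (20 * (1 / 40 * (1 / 40)))"
      using y y2 by (intro mult_left_mono mult_mono) auto
    finally have "10 * y ^ 3 / (1 - y) \<le> y * (1 / 80)" by simp
    moreover have "8 * y\<^sup>2 \<le> 8 * (y * (1 / 40))"
      unfolding power2_eq_square using y y2 by (intro mult_left_mono) auto
    ultimately show ?thesis
      using local_codes_series[of y M] y y2 unfolding y_def[symmetric] by linarith
  qed
  have "(2 / 7 :: real) ^ N \<le> (2 / 7) ^ 2" using step.hyps by (intro power_decreasing) auto
  then have pos: "(0 :: real) \<le> 16 / 3 * (1 - 2 * (2 / 7) ^ N)" by (simp add: power2_eq_square)
  have "real (num_codes num_local_codes (Suc N) k) \<le> 16 / 3 * (1 - 2 * (2 / 7) ^ N) * (1 + 5 * y) * (7 / 2) ^ k"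
    by (rule num_codes_upper_step[OF step.IH pos F])
  also have "\<dots> \<le> 16 / 3 * (1 - 2 * (2 / 7) ^ Suc N) * (7 / 2) ^ k"
  proof (intro mult_right_mono)
    have "(1 - 2 * (7 / 2 * y)) * (1 + 5 * y) = 1 - 2 * y - 35 * (y * y)" by (simp add: algebra_simps)
    moreover have "(2 / 7 :: real) ^ N = 7 / 2 * y" by (simp add: y_def)
    ultimately have prod: "(1 - 2 * (2 / 7) ^ N) * (1 + 5 * y) = 1 - 2 * y - 35 * (y * y)" by (simp only:)
    show "16 / 3 * (1 - 2 * (2 / 7) ^ N) * (1 + 5 * y) \<le> 16 / 3 * (1 - 2 * (2 / 7) ^ Suc N)"
      unfolding y_def[symmetric] mult.assoc prod using mult_pos_pos[OF y y]
      by (intro mult_left_mono) auto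
  qed simp
  finally show ?case .
qed

lemma exp_half_ge: "329 / 200 \<le> exp (1 / 2 :: real)"
  using exp_ge_partial_sum[of "1 / 2" "{0, 1, 2, 3}"] by (simp add: fact_numeral eval_nat_numeral)

lemma pi_sqrt_ge: "5 / 2 * sqrt (real k) \<le> pi * sqrt (2 * real k / 3)"
proof -
  have "(5 / 2)\<^sup>2 \<le> (31 / 10)\<^sup>2 * (2 / 3 :: real)" by (simp add: power2_eq_square)
  also have "\<dots> \<le> pi\<^sup>2 * (2 / 3)"
    using pi_bounds(1) by (intro mult_right_mono power_mono) auto
  finally have "5 / 2 \<le> sqrt (pi\<^sup>2 * (2 / 3))" by (rule real_le_rsqrt)
  then have "5 / 2 \<le> pi * sqrt (2 / 3)" by (simp only: real_sqrt_mult real_sqrt_abs) simp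
  then have "5 / 2 * sqrt (real k) \<le> pi * sqrt (2 / 3) * sqrt (real k)" by (intro mult_right_mono) auto
  then show ?thesis by (simp add: real_sqrt_mult[symmetric] real_sqrt_divide mult.assoc)
qed

definition upper_bound :: "nat \<Rightarrow> real" where
  "upper_bound k = 3 / (2 * sqrt 51 * real k) * ((3 + sqrt 17) / 2) ^ k * exp (pi * sqrt (2 * real k / 3))"

text \<open>21/100 and 89/25 are rational lower bounds of 3 / (2 sqrt 51) and (3 + sqrt 17) /
  2.\<close>

lemma upper_bound_ge:
  assumes "0 < k" "E \<le> exp (pi * sqrt (2 * real k / 3))" "0 \<le> E"
  shows "21 / 100 / real k * (89 / 25) ^ k * E \<le> upper_bound k"
proof -
  have "sqrt 51 \<le> sqrt ((50 / 7)\<^sup>2)" by (simp add: power2_eq_square del: real_sqrt_abs)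
  then have "2 * sqrt 51 * real k \<le> 100 / 7 * real k" by (intro mult_right_mono) auto
  then have 1: "21 / 100 / real k \<le> 3 / (2 * sqrt 51 * real k)"
    using assms(1) by (simp add: field_simps)
  have "sqrt ((412 / 100)\<^sup>2) \<le> sqrt 17" by (simp add: power2_eq_square del: real_sqrt_abs)
  then have 2: "89 / 25 \<le> (3 + sqrt 17) / 2" by simp
  show ?thesis unfolding upper_bound_def
    by (intro mult_mono 1 power_mono 2 assms) (use assms in auto)
qed

lemma num_codes_le_upper_bound:
  assumes "2 \<le> k"
  shows "3 * real (num_codes num_local_codes k k) \<le> upper_bound k"
proof -
  define x where "x = 5 / 2 * sqrt (real k)"
  have x2: "x\<^sup>2 = 25 / 4 * real k" by (simp add: x_def power_mult_distrib power2_eq_square)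
  have x4: "x ^ 4 = (25 / 4 * real k)\<^sup>2" "x ^ 6 = (25 / 4 * real k) ^ 3" "x ^ 8 = (25 / 4 * real k) ^ 4"
    unfolding x2[symmetric] power_mult[symmetric] by simp_all
  have x: "0 \<le> x" "x \<le> pi * sqrt (2 * real k / 3)" using pi_sqrt_ge by (auto simp: x_def)
  then have exp_le: "exp x \<le> exp (pi * sqrt (2 * real k / 3))" by simp
  define E where "E = 25 / 8 * real k + (25 / 4 * real k)\<^sup>2 / 24 + (25 / 4 * real k) ^ 3 / 720 + (25 / 4 * real k) ^ 4 / 40320"
  have E: "E \<le> exp (pi * sqrt (2 * real k / 3))"
    using exp_ge_even_terms[OF x(1)] exp_le unfolding x2 x4 E_def by linarith
  have E0: "0 \<le> E" by (simp add: E_def)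
  have ub: "21 / 100 / real k * (89 / 25) ^ k * E \<le> upper_bound k"
    using upper_bound_ge[OF _ E E0] assms by simp
  consider "10 \<le> k" | "k = 2" | "k \<in> {3, 4, 5, 6, 7, 8, 9}" using assms by fastforce
  then show ?thesis
  proof cases
    case 1
    have "(2 / 7 :: real) ^ k > 0" by simp
    then have "16 / 3 * (1 - 2 * (2 / 7) ^ k) * (7 / 2) ^ k \<le> 16 / 3 * 1 * (7 / 2 :: real) ^ k"
      by (intro mult_right_mono mult_left_mono) auto
    then have "3 * real (num_codes num_local_codes k k) \<le> 16 * (7 / 2) ^ k"
      using num_codes_upper[OF assms, of k] by linarith
    also have "\<dots> \<le> 16 * (89 / 25) ^ k" by (intro mult_left_mono power_mono) auto
    also have "\<dots> \<le> 21 / 100 / real k * E * (89 / 25) ^ k"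
    proof (intro mult_right_mono)
      have k: "10 \<le> real k" using 1 by simp
      have "E / real k = 25 / 8 + (25 / 4)\<^sup>2 * real k / 24 + (25 / 4) ^ 3 * (real k)\<^sup>2 / 720 + (25 / 4) ^ 4 * real k ^ 3 / 40320"
        using 1 by (simp add: E_def field_simps power2_eq_square power3_eq_cube power4_eq_xxxx)
      also have "\<dots> \<ge> 25 / 8 + (25 / 4)\<^sup>2 * 10 / 24 + (25 / 4) ^ 3 * (10)\<^sup>2 / 720 + (25 / 4) ^ 4 * 10 ^ 3 / 40320"
        by (intro add_mono divide_right_mono mult_left_mono power_mono k) auto
      finally have "25 / 8 + (25 / 4)\<^sup>2 * 10 / 24 + (25 / 4) ^ 3 * (10)\<^sup>2 / 720 + (25 / 4) ^ 4 * 10 ^ 3 / 40320 \<le> E / real k" .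
      \<comment> \<open>78 is enough because 21/100 times 78 exceeds 16, which is 3 times the
        constant 16/3.\<close>
      moreover have "(78 :: real) \<le> 25 / 8 + (25 / 4)\<^sup>2 * 10 / 24 + (25 / 4) ^ 3 * (10)\<^sup>2 / 720 + (25 / 4) ^ 4 * 10 ^ 3 / 40320"
        by (simp add: power2_eq_square power3_eq_cube power4_eq_xxxx)
      ultimately have "78 \<le> E / real k" by linarith
      then have "16 \<le> 21 / 100 * (E / real k)" by linarith
      also have "\<dots> = 21 / 100 / real k * E" by simp
      finally show "16 \<le> 21 / 100 / real k * E" .
    qed simp
    also have "\<dots> = 21 / 100 / real k * (89 / 25) ^ k * E" by simp
    finally show ?thesis using ub by linarith
  next
    case 2
    \<comment> \<open>The even terms of the exponential series give only about half of its value,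
      which is too little at \<open>k = 2\<close>; the exponential is bounded by powers of exp (1/2)
      instead.\<close>
    have "(329 / 200) ^ 7 \<le> exp (1 / 2 :: real) ^ 7" using exp_half_ge by (intro power_mono) auto
    also have "\<dots> = exp (7 / 2 :: real)" by (simp flip: exp_of_nat_mult)
    finally have "(329 / 200) ^ 7 \<le> exp (7 / 2 :: real)" .
    also have "7 / 2 \<le> x"
    proof -
      have "sqrt ((7 / 5)\<^sup>2) \<le> sqrt 2" by (simp add: power2_eq_square del: real_sqrt_abs)
      then show ?thesis using 2 by (simp add: x_def)
    qed
    then have "exp (7 / 2) \<le> exp x" by simp
    finally have "(329 / 200) ^ 7 \<le> exp (pi * sqrt (2 * real k / 3))" using exp_le by linarith
    from upper_bound_ge[OF _ this] have "21 / 100 / real k * (89 / 25) ^ k * (329 / 200) ^ 7 \<le> upper_bound k"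
      using 2 by simp
    moreover have "num_codes num_local_codes 2 2 = 12"
      by (simp add: numeral_2_eq_2 num_local_codes_def odd_codes_def)
    ultimately show ?thesis using 2 by (simp add: eval_nat_numeral)
  next
    case 3
    have "num_codes num_local_codes 3 3 = 28" "num_codes num_local_codes 4 4 = 70"
      "num_codes num_local_codes 5 5 = 140" "num_codes num_local_codes 6 6 = 294"
      "num_codes num_local_codes 7 7 = 548" "num_codes num_local_codes 8 8 = 1040"
      "num_codes num_local_codes 9 9 = 1868"
      by code_simp+
    with 3 have "3 * real (num_codes num_local_codes k k) \<le> 21 / 100 / real k * (89 / 25) ^ k * E"
      unfolding E_def by (elim insertE) (simp_all add: power_divide field_simps)
    then show ?thesis using ub by linarith
  qed
qed

section \<open>Counting ranks and types\<close>

text \<open>Given the Jordan scales and ranks, the parity type of a constituent is forced to be odd if its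
  rank is odd.\<close>

definition num_types :: "nat \<Rightarrow> nat" where
  "num_types m = (if m = 0 \<or> odd m then 1 else 2)"

text \<open>The coefficients of \<open>x F'(x) / F(x)\<close> for \<open>F(x) = (1 + x + x\<^sup>2) / (1 - x\<^sup>2)\<close>, the generating
  function of \<^const>\<open>num_types\<close>.\<close>

definition log_weight :: "nat \<Rightarrow> real" where
  "log_weight m = 1 + 2 * of_bool (2 dvd m) - 3 * of_bool (3 dvd m)"

text \<open>Exactly one of three consecutive numbers is divisible by 3, so the constant term and the
  term with 3 cancel, and twice the number of even ones remains. On series this is multiplication by
  \<open>1 + x + x^2\<close>.\<close>

lemma log_weight_three_term: "log_weight n + log_weight (n + 1) + log_weight (n + 2) = 2 * of_bool (odd n) + 4 * of_bool (even n)"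
proof -
  have "(3 dvd n \<and> \<not> 3 dvd n + 1 \<and> \<not> 3 dvd n + 2) \<or> (\<not> 3 dvd n \<and> 3 dvd n + 1 \<and> \<not> 3 dvd n + 2)
      \<or> (\<not> 3 dvd n \<and> \<not> 3 dvd n + 1 \<and> 3 dvd n + 2)" by presburger
  then show ?thesis by (cases "even n") (auto simp: log_weight_def)
qed

lemma log_weight_0: "log_weight 0 = 0"
  by (simp add: log_weight_def)

lemma num_types_log_derivative:
  "real m * real (num_types m) = (\<Sum>l\<le>m. log_weight l * real (num_types (m - l)))"
proof -
  define F :: "real fps" where "F = Abs_fps (\<lambda>m. real (num_types m))"
  define G :: "real fps" where "G = Abs_fps log_weight"
  have F: "F * (1 - fps_X ^ 2) = 1 + fps_X + fps_X ^ 2"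
    by (rule fps_ext)
      (auto simp: F_def algebra_simps fps_X_power_mult_nth num_types_def fps_X_power_nth)
  \<comment> \<open>This is \<open>G = (x + 2 * x^2) / (1 + x + x^2) + 2 * x^2 / (1 - x^2)\<close>,
    the logarithmic derivative of numerator and denominator of \<open>F\<close>, multiplied by
    \<open>1 + x + x^2\<close>.\<close>
  have G: "G * (1 + fps_X + fps_X ^ 2) = fps_X + 2 * fps_X ^ 2 + 2 * fps_X ^ 2 * F"
  proof (rule fps_ext)
    fix n
    have "n = 0 \<or> n = 1 \<or> (\<exists>l::nat. n = l + 2)" by presburger
    then consider "n = 0" | "n = 1" | l where "n = l + 2" by blast
    then show "fps_nth (G * (1 + fps_X + fps_X ^ 2)) n = fps_nth (fps_X + 2 * fps_X ^ 2 + 2 * fps_X ^ 2 * F) n"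
    proof cases
      case (3 l)
      have "fps_nth (G * (1 + fps_X + fps_X ^ 2)) n = log_weight (l + 2) + log_weight (l + 1) + log_weight l"
        by (simp add: G_def algebra_simps fps_X_power_mult_right_nth 3)
      also have "\<dots> = 2 * of_bool (odd l) + 4 * of_bool (even l)"
        using log_weight_three_term[of l] by simp
      also have "\<dots> = 2 * of_bool (l = 0) + 2 * real (num_types l)"
        by (cases "l = 0") (auto simp: num_types_def)
      also have "\<dots> = fps_nth (fps_X + 2 * fps_X ^ 2 + 2 * fps_X ^ 2 * F) n"
        by (simp add: F_def algebra_simps fps_X_power_mult_nth fps_X_power_mult_right_nth fps_X_power_nth 3 numeral_fps_const)
      finally show ?thesis .
    qed (simp_all add: G_def F_def algebra_simps fps_X_power_mult_nth fps_X_power_mult_right_nth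
        fps_X_power_nth numeral_fps_const log_weight_def)
  qed
  have "fps_deriv F * (1 - fps_X ^ 2) - 2 * fps_X * F = 1 + 2 * fps_X"
    using arg_cong[OF F, of fps_deriv] by (simp add: algebra_simps power2_eq_square)
  note F' = this
  have "fps_X * fps_deriv F * (1 - fps_X ^ 2)
      = fps_X * (fps_deriv F * (1 - fps_X ^ 2) - 2 * fps_X * F) + 2 * fps_X ^ 2 * F"
    by (simp add: algebra_simps power2_eq_square)
  also have "\<dots> = fps_X + 2 * fps_X ^ 2 + 2 * fps_X ^ 2 * F"
    unfolding F' by (simp add: algebra_simps power2_eq_square)
  finally have "fps_X * fps_deriv F * (1 - fps_X ^ 2) = fps_X + 2 * fps_X ^ 2 + 2 * fps_X ^ 2 * F" .
  also have "fps_X + 2 * fps_X ^ 2 + 2 * fps_X ^ 2 * F = F * G * (1 - fps_X ^ 2)"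
    unfolding G[symmetric] F[symmetric] by (simp add: ac_simps)
  finally have "fps_X * fps_deriv F * (1 - fps_X ^ 2) = F * G * (1 - fps_X ^ 2)" .
  moreover have "(1 - fps_X ^ 2 :: real fps) \<noteq> 0"
  proof
    assume "(1 - fps_X ^ 2 :: real fps) = 0"
    then have "fps_nth (1 - fps_X ^ 2 :: real fps) 0 = 0" by simp
    then show False by simp
  qed
  ultimately have "fps_X * fps_deriv F = G * F" by (simp add: mult.commute)
  then have "fps_nth (fps_X * fps_deriv F) m = fps_nth (G * F) m" by simp
  moreover have "fps_nth (fps_X * fps_deriv F) m = real m * real (num_types m)"
    by (cases m) (simp_all add: F_def)
  moreover have "fps_nth (G * F) m = (\<Sum>l\<le>m. log_weight l * real (num_types (m - l)))"
    by (simp add: F_def G_def fps_mult_nth atLeast0AtMost)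
  ultimately show ?thesis by simp
qed

text \<open>The generating series of \<open>f\<close> with \<open>x^i\<close> substituted for
  \<open>x\<close>.\<close>

definition dilate :: "nat \<Rightarrow> (nat \<Rightarrow> real) \<Rightarrow> real fps" where
  "dilate i f = Abs_fps (\<lambda>n. if i dvd n then f (n div i) else 0)"

lemma dilate_mult:
  assumes "0 < i"
  shows "fps_nth (dilate i f * dilate i g) n = (if i dvd n then (\<Sum>l\<le>n div i. f l * g (n div i - l)) else 0)"
proof (cases "i dvd n")
  case True
  then obtain m where n: "n = i * m" by blast
  have "fps_nth (dilate i f * dilate i g) n = (\<Sum>j\<in>{0..n}. fps_nth (dilate i f) j * fps_nth (dilate i g) (n - j))"
    by (simp add: fps_mult_nth)
  also have "\<dots> = (\<Sum>j\<in>(*) i ` {..m}. fps_nth (dilate i f) j * fps_nth (dilate i g) (n - j))"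
  proof (rule sum.mono_neutral_right)
    show "\<forall>j\<in>{0..n} - (*) i ` {..m}. fps_nth (dilate i f) j * fps_nth (dilate i g) (n - j) = 0"
    proof
      fix j assume j: "j \<in> {0..n} - (*) i ` {..m}"
      have "\<not> i dvd j"
      proof
        assume "i dvd j"
        then obtain l where "j = i * l" by blast
        then show False using j assms n by auto
      qed
      then show "fps_nth (dilate i f) j * fps_nth (dilate i g) (n - j) = 0" by (simp add: dilate_def)
    qed
  qed (auto simp: n)
  also have "\<dots> = (\<Sum>l\<le>m. fps_nth (dilate i f) (i * l) * fps_nth (dilate i g) (n - i * l))"
    using assms by (subst sum.reindex) (auto simp: inj_on_def)
  also have "\<dots> = (\<Sum>l\<le>m. f l * g (m - l))"
    using assms by (intro sum.cong) (auto simp: dilate_def n simp flip: diff_mult_distrib2)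
  finally show ?thesis using assms by (simp add: n)
next
  case False
  have "fps_nth (dilate i f * dilate i g) n = (\<Sum>j\<in>{0..n}. fps_nth (dilate i f) j * fps_nth (dilate i g) (n - j))"
    by (simp add: fps_mult_nth)
  also have "\<dots> = 0"
  proof (rule sum.neutral, rule)
    fix j assume "j \<in> {0..n}"
    then have "\<not> i dvd j \<or> \<not> i dvd n - j" using False by (metis atLeastAtMost_iff dvd_diffD)
    then show "fps_nth (dilate i f) j * fps_nth (dilate i g) (n - j) = 0" by (auto simp: dilate_def)
  qed
  finally show ?thesis using False by simp
qed

definition codes_fps :: "nat \<Rightarrow> real fps" where
  "codes_fps N = Abs_fps (\<lambda>k. real (num_codes num_types N k))"

lemma codes_fps_Suc: "codes_fps (Suc N) = dilate (Suc N) (\<lambda>m. real (num_types m)) * codes_fps N"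
proof (rule fps_ext)
  fix k
  let ?f = "\<lambda>j. fps_nth (dilate (Suc N) (\<lambda>m. real (num_types m))) j * fps_nth (codes_fps N) (k - j)"
  have "fps_nth (dilate (Suc N) (\<lambda>m. real (num_types m)) * codes_fps N) k = (\<Sum>j\<in>{0..k}. ?f j)"
    by (simp add: fps_mult_nth)
  also have "\<dots> = (\<Sum>j\<in>(*) (Suc N) ` {..k div Suc N}. ?f j)"
  proof (rule sum.mono_neutral_right)
    have "Suc N * m \<le> k" if "m \<le> k div Suc N" for m
      using that by (metis less_eq_div_iff_mult_less_eq mult.commute zero_less_Suc)
    then show "(*) (Suc N) ` {..k div Suc N} \<subseteq> {0..k}" by (auto simp del: mult_Suc)
    show "\<forall>j\<in>{0..k} - (*) (Suc N) ` {..k div Suc N}. ?f j = 0"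
    proof
      fix j assume j: "j \<in> {0..k} - (*) (Suc N) ` {..k div Suc N}"
      have "\<not> Suc N dvd j"
      proof
        assume "Suc N dvd j"
        then obtain l where l: "j = Suc N * l" by blast
        then have "l \<le> k div Suc N" using j by (metis DiffD1 atLeastAtMost_iff div_le_mono nonzero_mult_div_cancel_left nat.distinct(1))
        then show False using j l by blast
      qed
      then show "?f j = 0" by (simp add: dilate_def)
    qed
  qed simp
  also have "\<dots> = (\<Sum>m\<le>k div Suc N. ?f (Suc N * m))"
    by (subst sum.reindex) (auto simp: inj_on_def simp del: mult_Suc)
  also have "\<dots> = fps_nth (codes_fps (Suc N)) k"
    by (simp add: dilate_def codes_fps_def del: mult_Suc)
  finally show "fps_nth (codes_fps (Suc N)) k = fps_nth (dilate (Suc N) (\<lambda>m. real (num_types m)) * codes_fps N) k" ..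
qed

text \<open>The logarithmic derivative of a product is the sum of those of its factors, and the
  substitution of \<open>x^i\<close> produces the factor \<open>i\<close>.\<close>

lemma codes_fps_log_derivative:
  "fps_X * fps_deriv (codes_fps N) = (\<Sum>i=1..N. dilate i (\<lambda>m. real i * log_weight m)) * codes_fps N"
proof (induction N)
  case 0
  have "codes_fps 0 = 1" by (rule fps_ext) (simp add: codes_fps_def)
  then show ?case by simp
next
  case (Suc N)
  let ?i = "Suc N"
  let ?F = "dilate ?i (\<lambda>m. real (num_types m))" and ?G = "dilate ?i (\<lambda>m. real ?i * log_weight m)"
  have FG: "fps_X * fps_deriv ?F = ?G * ?F"
  proof (rule fps_ext)
    fix n
    have "fps_nth (fps_X * fps_deriv ?F) n = real n * fps_nth ?F n" by (cases n) simp_all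
    also have "\<dots> = fps_nth (?G * ?F) n"
    proof (cases "?i dvd n")
      case True
      then obtain m where n: "n = ?i * m" by blast
      have "real n * fps_nth ?F n = real ?i * (real m * real (num_types m))"
        by (simp add: dilate_def n del: mult_Suc of_nat_Suc)
      also have "\<dots> = (\<Sum>l\<le>m. real ?i * log_weight l * real (num_types (m - l)))"
        unfolding num_types_log_derivative by (simp add: sum_distrib_left mult.assoc del: of_nat_Suc)
      also have "\<dots> = fps_nth (?G * ?F) n" by (simp add: dilate_mult n del: mult_Suc of_nat_Suc)
      finally show ?thesis .
    next
      case False
      then show ?thesis by (simp add: dilate_mult) (simp add: dilate_def)
    qed
    finally show "fps_nth (fps_X * fps_deriv ?F) n = fps_nth (?G * ?F) n" .
  qed
  have "fps_X * fps_deriv (codes_fps (Suc N)) = (fps_X * fps_deriv ?F) * codes_fps N + ?F * (fps_X * fps_deriv (codes_fps N))"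
    by (simp add: codes_fps_Suc algebra_simps)
  also have "\<dots> = (?G + (\<Sum>i=1..N. dilate i (\<lambda>m. real i * log_weight m))) * (?F * codes_fps N)"
    unfolding FG Suc by (simp add: algebra_simps)
  finally show ?case by (simp add: codes_fps_Suc add.commute)
qed

lemma num_codes_stable:
  assumes "d 0 = 1" "k \<le> N"
  shows "num_codes d N k = num_codes d k k"
  using assms(2)
proof (induction N rule: dec_induct)
  case (step N)
  then have "k div Suc N = 0" by simp
  then show ?case using step assms(1) by simp
qed simp

definition type_codes :: "nat \<Rightarrow> real" where
  "type_codes k = real (num_codes num_types k k)"

text \<open>The coefficients of \<open>x A'(x) / A(x)\<close>, where \<open>A\<close> is the
  infinite product whose coefficients are the \<open>type_codes\<close>.\<close>

definition log_coeff :: "nat \<Rightarrow> real" where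
  "log_coeff j = (\<Sum>i | i dvd j. real i * log_weight (j div i))"

lemma type_codes_recurrence:
  "real k * type_codes k = (\<Sum>j=1..k. log_coeff j * type_codes (k - j))"
proof -
  have nth: "fps_nth (codes_fps k) j = type_codes j" if "j \<le> k" for j
    using num_codes_stable[OF _ that, of num_types] by (simp add: codes_fps_def type_codes_def num_types_def)
  have coeff: "fps_nth (\<Sum>i=1..k. dilate i (\<lambda>m. real i * log_weight m)) j = (if j = 0 then 0 else log_coeff j)"
    if "j \<le> k" for j
  proof (cases "j = 0")
    case True
    then show ?thesis by (simp add: fps_sum_nth dilate_def log_weight_0)
  next
    case False
    have "fps_nth (\<Sum>i=1..k. dilate i (\<lambda>m. real i * log_weight m)) j
        = (\<Sum>i\<in>{1..k}. if i dvd j then real i * log_weight (j div i) else 0)"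
      by (simp add: fps_sum_nth dilate_def)
    also have "\<dots> = (\<Sum>i | i dvd j. real i * log_weight (j div i))"
    proof (rule sum.mono_neutral_cong_right)
      show "{i. i dvd j} \<subseteq> {1..k}"
      proof
        fix i assume "i \<in> {i. i dvd j}"
        then have "i \<le> j" "i \<noteq> 0" using False by (auto dest: dvd_imp_le)
        then show "i \<in> {1..k}" using that by simp
      qed
    qed auto
    finally show ?thesis using False by (simp add: log_coeff_def)
  qed
  have "real k * type_codes k = fps_nth (fps_X * fps_deriv (codes_fps k)) k"
    using nth[of k] by (cases k) simp_all
  also have "\<dots> = (\<Sum>j=0..k. fps_nth (\<Sum>i=1..k. dilate i (\<lambda>m. real i * log_weight m)) j * fps_nth (codes_fps k) (k - j))"
    by (simp only: codes_fps_log_derivative fps_mult_nth)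
  also have "\<dots> = (\<Sum>j=0..k. (if j = 0 then 0 else log_coeff j) * type_codes (k - j))"
    by (intro sum.cong) (auto simp only: coeff nth atLeastAtMost_iff diff_le_self)
  also have "\<dots> = (\<Sum>j=1..k. log_coeff j * type_codes (k - j))"
    by (simp add: sum.atLeast_Suc_atMost)
  finally show ?thesis .
qed

text \<open>Multiplication by 3 maps the divisors \<open>i\<close> for which 3 divides
  \<open>j div i\<close> injectively into the divisors of \<open>j\<close>. The negative part of the
  sum is thus at most the full divisor sum.\<close>

lemma log_coeff_nonneg:
  assumes "0 < j"
  shows "0 \<le> log_coeff j"
proof -
  let ?D = "{i. i dvd j}" and ?T = "{i. 3 * i dvd j}"
  have fin: "finite ?D" using assms by simp
  have T: "?T = {i \<in> ?D. 3 dvd j div i}"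
    using assms by (auto simp: dvd_div_iff_mult mult.commute dest: dvd_mult_left dvd_mult_right)
  have "(\<Sum>i\<in>?T. 3 * real i) = (\<Sum>d\<in>(*) 3 ` ?T. real d)"
    by (subst sum.reindex) (auto simp: inj_on_def)
  also have "\<dots> \<le> (\<Sum>d\<in>?D. real d)"
    using fin by (intro sum_mono2) auto
  finally have "(\<Sum>i\<in>?T. 3 * real i) \<le> (\<Sum>i\<in>?D. real i)" .
  moreover have "(\<Sum>i\<in>?T. 3 * real i) = (\<Sum>i\<in>?D. real i * (3 * of_bool (3 dvd j div i)))"
    unfolding T sum.inter_filter[OF fin] by (intro sum.cong) auto
  moreover have "0 \<le> (\<Sum>i\<in>?D. real i * (2 * of_bool (2 dvd j div i)))"
    by (intro sum_nonneg) auto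
  ultimately show ?thesis
    unfolding log_coeff_def log_weight_def by (simp add: algebra_simps sum.distrib sum_subtractf)
qed

section \<open>Partial sums of the logarithmic coefficients\<close>

definition tri :: "nat \<Rightarrow> nat" where
  "tri n = (\<Sum>i=1..n. i)"

lemma tri_real: "real (tri n) = real n * (real n + 1) / 2"
  by (induction n) (auto simp: tri_def field_simps)

definition weight_sum :: "nat \<Rightarrow> int" where
  "weight_sum q = int q + 2 * int (q div 2) - 3 * int (q div 3)"

lemma sum_log_weight: "(\<Sum>m=1..q. log_weight m) = of_int (weight_sum q)"
proof (induction q)
  case (Suc q)
  have 2: "Suc q div 2 = q div 2 + of_bool (2 dvd Suc q)" by (cases "2 dvd Suc q") (auto simp: div_Suc dvd_eq_mod_eq_0)
  have 3: "Suc q div 3 = q div 3 + of_bool (3 dvd Suc q)" by (cases "3 dvd Suc q") (auto simp: div_Suc dvd_eq_mod_eq_0)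
  show ?case using Suc by (simp add: weight_sum_def 2 3 log_weight_def)
qed (simp add: weight_sum_def)

definition log_coeff_sum :: "nat \<Rightarrow> real" where
  "log_coeff_sum J = (\<Sum>j=1..J. log_coeff j)"

lemma log_coeff_sum_eq: "log_coeff_sum J = of_int (\<Sum>i=1..J. int i * weight_sum (J div i))"
proof -
  have "log_coeff_sum J = (\<Sum>j=1..J. \<Sum>i=1..J. if i dvd j then real i * log_weight (j div i) else 0)"
    unfolding log_coeff_sum_def log_coeff_def
  proof (rule sum.cong[OF refl])
    fix j assume j: "j \<in> {1..J}"
    have "{i. i dvd j} \<subseteq> {1..J}"
    proof
      fix i assume "i \<in> {i. i dvd j}"
      then have "i \<le> j" "i \<noteq> 0" using j by (auto dest: dvd_imp_le)
      then show "i \<in> {1..J}" using j by simp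
    qed
    then show "(\<Sum>i | i dvd j. real i * log_weight (j div i)) = (\<Sum>i=1..J. if i dvd j then real i * log_weight (j div i) else 0)"
      by (intro sum.mono_neutral_cong_left) auto
  qed
  also have "\<dots> = (\<Sum>i=1..J. \<Sum>j=1..J. if i dvd j then real i * log_weight (j div i) else 0)"
    by (rule sum.swap)
  also have "\<dots> = (\<Sum>i=1..J. real i * (\<Sum>m=1..J div i. log_weight m))"
  proof (rule sum.cong[OF refl])
    fix i assume i: "i \<in> {1..J}"
    then have pos: "0 < i" by simp
    have "(\<Sum>j=1..J. if i dvd j then real i * log_weight (j div i) else 0)
        = (\<Sum>j\<in>(*) i ` {1..J div i}. real i * log_weight (j div i))"
    proof (rule sum.mono_neutral_cong_right)
      have "i * m \<le> J" if "m \<le> J div i" for m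
        using that pos by (metis less_eq_div_iff_mult_less_eq mult.commute)
      then show "(*) i ` {1..J div i} \<subseteq> {1..J}" using pos by auto
      show "\<forall>j\<in>{1..J} - (*) i ` {1..J div i}. (if i dvd j then real i * log_weight (j div i) else 0) = 0"
      proof
        fix j assume j: "j \<in> {1..J} - (*) i ` {1..J div i}"
        have "\<not> i dvd j"
        proof
          assume "i dvd j"
          then obtain m where m: "j = i * m" by blast
          then have "m \<le> J div i" "1 \<le> m" using j pos
            by (auto simp: less_eq_div_iff_mult_less_eq mult.commute)
          then show False using j m by auto
        qed
        then show "(if i dvd j then real i * log_weight (j div i) else 0) = 0" by simp
      qed
    qed auto
    also have "\<dots> = (\<Sum>m=1..J div i. real i * log_weight m)"
      using pos by (subst sum.reindex) (auto simp: inj_on_def)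
    finally show "(\<Sum>j=1..J. if i dvd j then real i * log_weight (j div i) else 0) = real i * (\<Sum>m=1..J div i. log_weight m)"
      by (simp add: sum_distrib_left)
  qed
  finally show ?thesis unfolding sum_log_weight by simp
qed

text \<open>The coefficients 1, 3, -2, 3, 1 are the values of \<open>log_weight\<close> at 1 to 5,
  and \<open>weight_sum\<close> does not fall below 6 from 5 on. Five terms suffice because 1 + 3/4
  - 2/9 + 3/16 + 1/25 still exceeds 5/3.\<close>

lemma weight_sum_ge:
  "of_bool (1 \<le> q) + 3 * of_bool (2 \<le> q) - 2 * of_bool (3 \<le> q) + 3 * of_bool (4 \<le> q) + of_bool (5 \<le> q) \<le> weight_sum q"
proof (cases "q < 7")
  case True
  then have "q \<in> {0, 1, 2, 3, 4, 5, 6}" by auto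
  then show ?thesis by (auto simp: weight_sum_def)
next
  case False
  have "q \<le> 2 * (q div 2) + 1" "3 * (q div 3) \<le> q" by simp_all
  then have "int q \<le> 2 * int (q div 2) + 1" "3 * int (q div 3) \<le> int q" by linarith+
  then show ?thesis using False by (simp add: weight_sum_def)
qed

lemma sum_of_bool_le_div:
  assumes "0 < m"
  shows "(\<Sum>i=1..J. int i * of_bool (m \<le> J div i)) = int (tri (J div m))"
proof -
  have "(\<Sum>i=1..J. int i * of_bool (m \<le> J div i)) = (\<Sum>i\<in>{1..J div m}. int i)"
  proof (rule sum.mono_neutral_cong_right)
    have iff: "m \<le> J div i \<longleftrightarrow> i \<le> J div m" if "i \<in> {1..J}" for i
      using that assms by (simp add: less_eq_div_iff_mult_less_eq mult.commute)
    show "{1..J div m} \<subseteq> {1..J}" by (auto intro: order.trans[OF _ div_le_dividend])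
    show "\<forall>i\<in>{1..J} - {1..J div m}. int i * of_bool (m \<le> J div i) = 0" using iff by auto
    show "\<And>i. i \<in> {1..J div m} \<Longrightarrow> int i * of_bool (m \<le> J div i) = int i"
      using iff by (auto intro: order.trans[OF _ div_le_dividend])
  qed simp
  then show ?thesis by (simp add: tri_def)
qed

lemma log_coeff_sum_ge_tri:
  "real (tri J) + 3 * real (tri (J div 2)) - 2 * real (tri (J div 3)) + 3 * real (tri (J div 4)) + real (tri (J div 5))
    \<le> log_coeff_sum J"
proof -
  have "(\<Sum>i=1..J. int i * (of_bool (1 \<le> J div i) + 3 * of_bool (2 \<le> J div i) - 2 * of_bool (3 \<le> J div i)
      + 3 * of_bool (4 \<le> J div i) + of_bool (5 \<le> J div i))) \<le> (\<Sum>i=1..J. int i * weight_sum (J div i))"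
    by (intro sum_mono mult_left_mono weight_sum_ge) simp
  moreover have "(\<Sum>i=1..J. int i * (of_bool (1 \<le> J div i) + 3 * of_bool (2 \<le> J div i) - 2 * of_bool (3 \<le> J div i)
      + 3 * of_bool (4 \<le> J div i) + of_bool (5 \<le> J div i)))
    = int (tri (J div 1)) + 3 * int (tri (J div 2)) - 2 * int (tri (J div 3)) + 3 * int (tri (J div 4)) + int (tri (J div 5))"
    unfolding sum_of_bool_le_div[symmetric, OF less_numeral_extra(1)] sum_of_bool_le_div[symmetric, OF zero_less_numeral]
    by (simp only: distrib_left right_diff_distrib sum.distrib sum_subtractf mult.left_commute[of _ 3]
        mult.left_commute[of _ 2] sum_distrib_left)
  ultimately have "int (tri J) + 3 * int (tri (J div 2)) - 2 * int (tri (J div 3)) + 3 * int (tri (J div 4)) + int (tri (J div 5))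
    \<le> (\<Sum>i=1..J. int i * weight_sum (J div i))" by simp
  then have "real_of_int (int (tri J) + 3 * int (tri (J div 2)) - 2 * int (tri (J div 3)) + 3 * int (tri (J div 4)) + int (tri (J div 5)))
    \<le> of_int (\<Sum>i=1..J. int i * weight_sum (J div i))" by (simp only: of_int_le_iff)
  then show ?thesis unfolding log_coeff_sum_eq by simp
qed

lemma tri_div_lower:
  assumes "0 < m" "m \<le> J + 1"
  shows "(real J + 1 - real m) * (real J + 1) / (2 * (real m)\<^sup>2) \<le> real (tri (J div m))"
proof -
  have "J + 1 \<le> m * (J div m) + m"
    using mod_less_divisor[OF assms(1), of J] mult_div_mod_eq[of m J] by linarith
  then have "real (J + 1) \<le> real (m * (J div m) + m)" by (simp only: of_nat_le_iff)
  then have q: "real J + 1 \<le> real m * (real (J div m) + 1)" by (simp add: algebra_simps)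
  then have q': "real J + 1 - real m \<le> real m * real (J div m)" by (simp add: algebra_simps)
  have "(real J + 1 - real m) * (real J + 1) \<le> (real m * real (J div m)) * (real m * (real (J div m) + 1))"
    using q q' assms by (intro mult_mono) auto
  also have "\<dots> = 2 * (real m)\<^sup>2 * real (tri (J div m))" by (simp add: tri_real power2_eq_square)
  finally show ?thesis using assms by (simp add: field_simps)
qed

lemma tri_div_upper:
  assumes "0 < m"
  shows "real (tri (J div m)) \<le> real J * (real J + real m) / (2 * (real m)\<^sup>2)"
proof -
  have "m * (J div m) \<le> J" by simp
  then have "real (m * (J div m)) \<le> real J" by (simp only: of_nat_le_iff)
  then have q: "real m * real (J div m) \<le> real J" by simp
  have "(real m * real (J div m)) * (real m * real (J div m) + real m) \<le> real J * (real J + real m)"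
    using q by (intro mult_mono) auto
  moreover have "(real m * real (J div m)) * (real m * real (J div m) + real m) = 2 * (real m)\<^sup>2 * real (tri (J div m))"
    by (simp add: tri_real power2_eq_square algebra_simps)
  ultimately show ?thesis using assms by (simp add: field_simps)
qed

text \<open>The partial sum of \<open>log_coeff\<close> minus that of the sequence
  \<open>5 / 3 * j\<close>, which is the logarithmic coefficient of the minorant.\<close>

definition excess :: "nat \<Rightarrow> real" where
  "excess J = log_coeff_sum J - 5 / 6 * real J * (real J + 1)"

lemma excess_int: "6 * excess J = of_int (6 * (\<Sum>i=1..J. int i * weight_sum (J div i)) - 5 * int J * (int J + 1))"
  by (simp add: excess_def log_coeff_sum_eq algebra_simps)

text \<open>The quadratic part of the estimate is positive; 22 is the first integer at which it
  outweighs the losses from rounding the quotients.\<close>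

lemma excess_large:
  assumes "22 \<le> J"
  shows "0 \<le> excess J"
proof -
  define x where "x = real J"
  have x: "22 \<le> x" using assms by (simp add: x_def)
  have "x * (x + 1) / 2 + 3 * ((x - 1) * (x + 1) / 8) - 2 * (x * (x + 3) / 18) + 3 * ((x - 3) * (x + 1) / 32) + (x - 4) * (x + 1) / 50
    \<le> log_coeff_sum J"
    using log_coeff_sum_ge_tri[of J] tri_div_lower[of 2 J] tri_div_upper[of 3 J] tri_div_lower[of 4 J] tri_div_lower[of 5 J]
      tri_real[of J] assms by (simp add: x_def)
  moreover have "5 / 6 * x * (x + 1) \<le> x * (x + 1) / 2 + 3 * ((x - 1) * (x + 1) / 8) - 2 * (x * (x + 3) / 18) + 3 * ((x - 3) * (x + 1) / 32) + (x - 4) * (x + 1) / 50"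
  proof -
    define t where "t = x - 22"
    have "x = t + 22" "0 \<le> t" using x by (auto simp: t_def)
    then show ?thesis by (simp add: field_simps)
  qed
  ultimately show ?thesis unfolding excess_def x_def by linarith
qed

lemma excess_small:
  "excess 1 = - 2 / 3" "excess 2 = 1" "excess 3 = - 3" "excess 4 = 10 / 3" "excess 5 = 1" "excess 6 = 2"
  "excess 7 = - 5 / 3" "excess 8 = 14"
proof -
  have e: "6 * (\<Sum>i=1..J. int i * weight_sum (J div i)) - 5 * int J * (int J + 1) = v \<Longrightarrow> excess J = of_int v / 6" for J v
    using excess_int[of J] by simp
  have "6 * (\<Sum>i=1..1. int i * weight_sum (1 div i)) - 5 * int 1 * (int 1 + 1) = - 4"
    "6 * (\<Sum>i=1..2. int i * weight_sum (2 div i)) - 5 * int 2 * (int 2 + 1) = 6"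
    "6 * (\<Sum>i=1..3. int i * weight_sum (3 div i)) - 5 * int 3 * (int 3 + 1) = - 18"
    "6 * (\<Sum>i=1..4. int i * weight_sum (4 div i)) - 5 * int 4 * (int 4 + 1) = 20"
    "6 * (\<Sum>i=1..5. int i * weight_sum (5 div i)) - 5 * int 5 * (int 5 + 1) = 6"
    "6 * (\<Sum>i=1..6. int i * weight_sum (6 div i)) - 5 * int 6 * (int 6 + 1) = 12"
    "6 * (\<Sum>i=1..7. int i * weight_sum (7 div i)) - 5 * int 7 * (int 7 + 1) = - 10"
    "6 * (\<Sum>i=1..8. int i * weight_sum (8 div i)) - 5 * int 8 * (int 8 + 1) = 84"
    by code_simp+
  note this[THEN e]
  then show "excess 1 = - 2 / 3" "excess 2 = 1" "excess 3 = - 3" "excess 4 = 10 / 3" "excess 5 = 1" "excess 6 = 2"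
    "excess 7 = - 5 / 3" "excess 8 = 14" by simp_all
qed

lemma excess_nonneg:
  assumes "9 \<le> J"
  shows "0 \<le> excess J"
proof (cases "22 \<le> J")
  case False
  have "\<forall>J\<in>set [9..<22]. 0 \<le> 6 * (\<Sum>i=1..J. int i * weight_sum (J div i)) - 5 * int J * (int J + 1)"
    by code_simp
  moreover have "J \<in> set [9..<22]" unfolding set_upt using assms False by (auto simp only: atLeastLessThan_iff not_le)
  ultimately have "0 \<le> 6 * (\<Sum>i=1..J. int i * weight_sum (J div i)) - 5 * int J * (int J + 1)" by blast
  then have "0 \<le> 6 * excess J" unfolding excess_int by (simp only: of_int_0_le_iff)
  then show ?thesis by simp
qed (rule excess_large)

text \<open>The coefficients of \<open>exp (5/3 \<cdot> x / (1 - x))\<close>. The factor \<open>5/3\<close> exceeds \<open>\<pi>\<^sup>2 / 6\<close>, so they grow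
  faster than the partition numbers.\<close>

fun part_minorant :: "nat \<Rightarrow> real" where
  "part_minorant 0 = 1"
| "part_minorant (Suc 0) = 5 / 3"
| "part_minorant (Suc (Suc k)) =
    ((2 * real k + 11 / 3) * part_minorant (Suc k) - real k * part_minorant k) / (real k + 2)"

text \<open>For \<open>B(x) = exp (5/3 * x / (1 - x))\<close> one has
  \<open>x B' = 5/3 * x / (1 - x)^2 * B\<close>, whose coefficients give this convolution. The
  three-term recurrence defining \<open>part_minorant\<close> is its second difference.\<close>

lemma part_minorant_convolution:
  "real k * part_minorant k = 5 / 3 * (\<Sum>i<k. real (k - i) * part_minorant i)"
proof -
  define D where "D k = (\<Sum>i<k. real (k - i) * part_minorant i)" for k
  have E: "D (Suc k) = D k + (\<Sum>i<Suc k. part_minorant i)" for k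
  proof -
    have "D (Suc k) = (\<Sum>i<k. real (k - i) * part_minorant i + part_minorant i) + part_minorant k"
      unfolding D_def by (auto simp: Suc_diff_le algebra_simps intro!: sum.cong)
    then show ?thesis by (simp add: D_def sum.distrib)
  qed
  have step: "D (Suc (Suc k)) = 2 * D (Suc k) - D k + part_minorant (Suc k)" for k
    using E[of k] E[of "Suc k"] by simp
  have "real k * part_minorant k = 5 / 3 * D k"
  proof (induction k rule: part_minorant.induct)
    case (3 k)
    have "real (Suc (Suc k)) * part_minorant (Suc (Suc k))
        = 2 * (real (Suc k) * part_minorant (Suc k)) + 5 / 3 * part_minorant (Suc k) - real k * part_minorant k"
      by (simp add: field_simps)
    also have "\<dots> = 5 / 3 * D (Suc (Suc k))" unfolding 3 step by (simp add: algebra_simps)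
    finally show ?case .
  qed (simp_all add: D_def)
  then show ?thesis by (simp add: D_def)
qed

text \<open>The coefficients of \<open>(1 - x) * B(x)\<close> for the generating function
  \<open>B\<close> of \<open>part_minorant\<close>; the value at 0 is the difference with the
  convention that the minorant vanishes at -1.\<close>

definition pm_diff :: "nat \<Rightarrow> real" where
  "pm_diff k = (if k = 0 then 1 else part_minorant k - part_minorant (k - 1))"

lemma pm_diff_recurrence:
  assumes "2 \<le> k"
  shows "real k * pm_diff k = (real k - 2) * pm_diff (k - 1) + 5 / 3 * part_minorant (k - 1)"
proof -
  obtain l where "k = Suc (Suc l)" using assms by (metis add_2_eq_Suc le_Suc_ex)
  then show ?thesis by (simp add: pm_diff_def field_simps)
qed

lemma pm_diff_pos: "0 < pm_diff k \<and> 0 < part_minorant k"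
proof (induction k)
  case (Suc k)
  show ?case
  proof (cases "k = 0")
    case False
    have "0 < real (Suc k) * pm_diff (Suc k)"
      using pm_diff_recurrence[of "Suc k"] Suc False by (auto intro!: add_nonneg_pos mult_nonneg_nonneg)
    then have "0 < pm_diff (Suc k)" by (simp add: zero_less_mult_iff)
    then show ?thesis using Suc by (simp add: pm_diff_def)
  qed (simp add: pm_diff_def)
qed (simp add: pm_diff_def)

lemma part_minorant_rec:
  assumes "2 \<le> k"
  shows "part_minorant k = ((2 * real k - 1 / 3) * part_minorant (k - 1) - (real k - 2) * part_minorant (k - 2)) / real k"
proof -
  obtain l where "k = Suc (Suc l)" using assms by (metis add_2_eq_Suc le_Suc_ex)
  then show ?thesis by (simp add: field_simps)
qed

lemma part_minorant_2: "part_minorant 2 = 55 / 18"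
  by (subst part_minorant_rec) (simp_all)

lemma part_minorant_3: "part_minorant 3 = 845 / 162"
  by (subst part_minorant_rec) (simp_all add: part_minorant_2)

lemma part_minorant_4: "part_minorant 4 = 16465 / 1944"
  by (subst part_minorant_rec) (simp_all add: part_minorant_3 part_minorant_2)

lemma part_minorant_5: "part_minorant 5 = 77245 / 5832"
  by (subst part_minorant_rec) (simp_all add: part_minorant_4 part_minorant_3)

lemma part_minorant_6: "part_minorant 6 = 2110835 / 104976"
  by (subst part_minorant_rec) (simp_all add: part_minorant_5 part_minorant_4)

lemma part_minorant_7: "part_minorant 7 = 65688085 / 2204496"
  by (subst part_minorant_rec) (simp_all add: part_minorant_6 part_minorant_5)

lemma part_minorant_8: "part_minorant 8 = 2289444365 / 52907904"
  by (subst part_minorant_rec) (simp_all add: part_minorant_7 part_minorant_6)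

lemma part_minorant_9: "part_minorant 9 = 88233756505 / 1428513408"
  by (subst part_minorant_rec) (simp_all add: part_minorant_8 part_minorant_7)

lemma part_minorant_10: "part_minorant 10 = 744446337055 / 8571080448"
  by (subst part_minorant_rec) (simp_all add: part_minorant_9 part_minorant_8)

lemma part_minorant_11: "part_minorant 11 = 34095143354765 / 282845654784"
  by (subst part_minorant_rec) (simp_all add: part_minorant_10 part_minorant_9)

lemma part_minorant_0_1: "part_minorant 0 = 1" "part_minorant 1 = 5 / 3"
  by simp_all

lemmas part_minorant_values = part_minorant_0_1 part_minorant_2 part_minorant_3 part_minorant_4 part_minorant_5
  part_minorant_6 part_minorant_7 part_minorant_8 part_minorant_9 part_minorant_10 part_minorant_11

text \<open>Asymptotically the relative increment of the minorant is sqrt (5/3) / sqrt k, while that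
  of \<open>HR\<close> is (pi / sqrt 6) / sqrt k. The constant 9/7 separates the two: pi / sqrt 6 is
  about 1.2825, 9/7 about 1.2857 and sqrt (5/3) about 1.2910.\<close>

lemma pm_diff_growth:
  assumes "11 \<le> k"
  shows "9 / 7 * part_minorant (k - 1) \<le> pm_diff k * sqrt (real k)"
  using assms
proof (induction k rule: dec_induct)
  case base
  have "sqrt ((33166 / 10000)\<^sup>2) \<le> sqrt 11" by (simp add: power2_eq_square del: real_sqrt_abs)
  then have s: "33166 / 10000 \<le> sqrt 11" by simp
  have "9 / 7 * part_minorant 10 \<le> pm_diff 11 * (33166 / 10000)"
    by (simp add: pm_diff_def part_minorant_10 part_minorant_11)
  also have "\<dots> \<le> pm_diff 11 * sqrt 11"
    using s pm_diff_pos[of 11] by (intro mult_left_mono) auto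
  finally show ?case by simp
next
  case (step k)
  define t where "t = sqrt (real k)"
  have t2: "t * t = real k" by (simp add: t_def)
  have "sqrt ((33 / 10)\<^sup>2) \<le> t" unfolding t_def using step.hyps by (intro real_sqrt_le_mono) (simp add: power2_eq_square)
  then have t: "33 / 10 \<le> t" by simp
  let ?b = "part_minorant k" and ?d = "pm_diff k"
  have pos: "0 < ?b" "0 < ?d" using pm_diff_pos by auto
  have "part_minorant (k - 1) = ?b - ?d" using step.hyps by (simp add: pm_diff_def)
  then have d: "9 / 7 * ?b \<le> ?d * (t + 9 / 7)" using step.IH by (simp add: t_def algebra_simps)
  have "real (Suc k) * pm_diff (Suc k) = (real k - 1) * ?d + 5 / 3 * ?b"
    using pm_diff_recurrence[of "Suc k"] step.hyps by simp
  then have rec: "(t * t + 1) * pm_diff (Suc k) = (t * t - 1) * ?d + 5 / 3 * ?b" by (simp add: t2 add.commute)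
  have factor: "x * (d * c) + c * y = c * (x * d + y)" for x d c y :: real by (simp add: algebra_simps)
  have s: "sqrt (real (Suc k)) \<le> t + 1 / (2 * t)"
  proof (rule real_le_lsqrt)
    have "real (Suc k) \<le> t * t + 1 + 1 / (4 * (t * t))" using t by (simp add: t2)
    also have "\<dots> = (t + 1 / (2 * t))\<^sup>2" using t by (simp add: power2_eq_square field_simps)
    finally show "real (Suc k) \<le> (t + 1 / (2 * t))\<^sup>2" .
  qed (use t in auto)
  have ss: "sqrt (real (Suc k)) * sqrt (real (Suc k)) = t * t + 1" by (simp add: t2)
  \<comment> \<open>The coefficient 4/147 is \<open>2 * (5/3 - (9/7)^2)\<close>; it is positive
    exactly because 9/7 is below sqrt (5/3).\<close>
  have "0 \<le> 4 / 147 * (t * t) + 3 / 7 * t - 81 / (49 :: real)"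
  proof -
    have "(33 / 10) * (33 / 10) \<le> t * t" using t by (intro mult_mono) auto
    then show ?thesis using t by linarith
  qed
  moreover have "(2 * t) * ((9 / 7) * (t * t - 1) + (5 / 3) * (t + 9 / 7)) - 9 / 7 * (2 * (t * t) + 1) * (t + 9 / 7)
      = 4 / 147 * (t * t) + 3 / 7 * t - 81 / 49"
    by (simp add: field_simps)
  ultimately have poly: "9 / 7 * (2 * (t * t) + 1) * (t + 9 / 7) \<le> (2 * t) * ((9 / 7) * (t * t - 1) + (5 / 3) * (t + 9 / 7))"
    by linarith
  have "9 / 7 * (t + 1 / (2 * t)) * (t + 9 / 7) \<le> (9 / 7) * (t * t - 1) + (5 / 3) * (t + 9 / 7)"
  proof -
    have "9 / 7 * (t + 1 / (2 * t)) * (t + 9 / 7) = 9 / 7 * (2 * (t * t) + 1) * (t + 9 / 7) / (2 * t)"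
      using t by (simp add: field_simps)
    also have "\<dots> \<le> (2 * t) * ((9 / 7) * (t * t - 1) + (5 / 3) * (t + 9 / 7)) / (2 * t)"
      using poly t by (intro divide_right_mono) auto
    finally show ?thesis using t by simp
  qed
  then have "9 / 7 * (t + 1 / (2 * t)) * (t + 9 / 7) * ?b \<le> ((9 / 7) * (t * t - 1) + (5 / 3) * (t + 9 / 7)) * ?b"
    using pos by (intro mult_right_mono) auto
  also have "\<dots> = (t * t - 1) * (9 / 7 * ?b) + (t + 9 / 7) * (5 / 3 * ?b)" by (simp add: algebra_simps)
  also have "\<dots> \<le> (t * t - 1) * (?d * (t + 9 / 7)) + (t + 9 / 7) * (5 / 3 * ?b)"
  proof -
    have "1 \<le> t * t" using t mult_mono[of 1 t 1 t] by simp
    then show ?thesis using d by (intro add_right_mono mult_left_mono) auto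
  qed
  also have "\<dots> = (t + 9 / 7) * ((t * t + 1) * pm_diff (Suc k))" unfolding rec by (rule factor)
  finally have "(t + 9 / 7) * (9 / 7 * (t + 1 / (2 * t)) * ?b) \<le> (t + 9 / 7) * ((t * t + 1) * pm_diff (Suc k))"
    by (simp only: ac_simps)
  then have "9 / 7 * (t + 1 / (2 * t)) * ?b \<le> (t * t + 1) * pm_diff (Suc k)" using t by simp
  moreover have "9 / 7 * sqrt (real (Suc k)) * ?b \<le> 9 / 7 * (t + 1 / (2 * t)) * ?b"
    using s pos by (intro mult_right_mono mult_left_mono) auto
  ultimately have "sqrt (real (Suc k)) * (9 / 7 * ?b) \<le> sqrt (real (Suc k)) * (pm_diff (Suc k) * sqrt (real (Suc k)))"
    using ss by (simp add: algebra_simps)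
  moreover have "0 < sqrt (real (Suc k))" by simp
  ultimately show ?case by (simp only: mult_le_cancel_left_pos diff_Suc_1)
qed

text \<open>With this bound the terms with negative \<open>excess\<close> can be paid for by those
  that follow them. For large \<open>i\<close>, \<open>pm_diff_growth\<close> bounds the minorant by
  its difference, and the recurrence then bounds the next difference.\<close>

lemma pm_diff_ratio:
  assumes "5 \<le> i"
  shows "pm_diff i \<le> 3 / 2 * pm_diff (i - 1)"
proof (cases "i \<le> 11")
  case True
  then have "i \<in> {5, 6, 7, 8, 9, 10, 11}" using assms by auto
  then show ?thesis by (elim insertE) (simp_all add: pm_diff_def part_minorant_values)
next
  case False
  define t where "t = sqrt (real (i - 1))"
  have i: "real i = t * t + 1" using assms by (simp add: t_def)
  have "sqrt ((33 / 10)\<^sup>2) \<le> t" unfolding t_def using False by (intro real_sqrt_le_mono) (simp add: power2_eq_square)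
  then have t: "33 / 10 \<le> t" by simp
  let ?b = "part_minorant (i - 1)" and ?d = "pm_diff (i - 1)"
  have "part_minorant (i - 1 - 1) = ?b - ?d" using False by (simp add: pm_diff_def)
  moreover have "9 / 7 * part_minorant (i - 1 - 1) \<le> ?d * t"
    unfolding t_def by (rule pm_diff_growth) (use False in linarith)
  ultimately have d: "9 / 7 * ?b \<le> ?d * (t + 9 / 7)" by (simp only:) (simp add: algebra_simps)
  \<comment> \<open>The right-hand factor is \<open>3 / 2 * i - (i - 2)\<close> with
    \<open>i = t * t + 1\<close>: what the recurrence leaves of the claim.\<close>
  have "5 / 3 * ?b \<le> (t * t / 2 + 5 / 2) * ?d"
  proof -
    have tt: "33 / 10 * t \<le> t * t" using t by (intro mult_right_mono) auto
    have "5 / 3 * ?b \<le> 35 / 27 * (?d * (t + 9 / 7))" using d by linarith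
    also have "\<dots> = (35 / 27 * (t + 9 / 7)) * ?d" by simp
    also have "\<dots> \<le> (t * t / 2 + 5 / 2) * ?d"
    proof (rule mult_right_mono)
      have "35 / 27 * (t + 9 / 7) = 35 / 27 * t + 5 / 3" by simp
      then show "35 / 27 * (t + 9 / 7) \<le> t * t / 2 + 5 / 2" using tt t by linarith
    qed (use pm_diff_pos[of "i - 1"] in simp)
    finally show ?thesis .
  qed
  then have "real i * pm_diff i \<le> real i * (3 / 2 * ?d)"
    using pm_diff_recurrence[of i] assms unfolding i by (simp add: algebra_simps)
  then show ?thesis using assms by simp
qed

text \<open>Abel summation, applied both to \<open>log_coeff\<close> and to the convolution formula
  of the minorant. It replaces the fluctuating coefficients by their partial sums.\<close>

lemma sum_by_parts_excess:
  "(\<Sum>j=1..k. log_coeff j * part_minorant (k - j))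
    = real k * part_minorant k + (\<Sum>J=1..k. excess J * pm_diff (k - J))"
proof -
  have diff: "pm_diff (k - J) = part_minorant (k - J) - (if J = k then 0 else part_minorant (k - Suc J))" if "J \<le> k" for J k
    using that by (auto simp: pm_diff_def)
  have telescope: "part_minorant (k - j) = (\<Sum>J=j..k. pm_diff (k - J))" if "j \<le> k" for j
    using that
  proof (induction j rule: inc_induct)
    case base
    show ?case by (simp add: pm_diff_def)
  next
    case (step j)
    then have "(\<Sum>J=j..k. pm_diff (k - J)) = pm_diff (k - j) + part_minorant (k - Suc j)"
      by (simp add: sum.atLeast_Suc_atMost)
    then show ?case using diff[of j k] step by simp
  qed
  have swap: "(\<Sum>j=1..k. f j * part_minorant (k - j)) = (\<Sum>J=1..k. (\<Sum>j=1..J. f j) * pm_diff (k - J))" for f :: "nat \<Rightarrow> real"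
  proof -
    have "(\<Sum>j=1..k. f j * part_minorant (k - j)) = (\<Sum>j=1..k. \<Sum>J=1..k. if j \<le> J then f j * pm_diff (k - J) else 0)"
    proof (rule sum.cong[OF refl])
      fix j assume j: "j \<in> {1..k}"
      have "f j * part_minorant (k - j) = (\<Sum>J=j..k. f j * pm_diff (k - J))"
        using telescope[of j] j by (simp add: sum_distrib_left)
      also have "\<dots> = (\<Sum>J=1..k. if j \<le> J then f j * pm_diff (k - J) else 0)"
        using j by (intro sum.mono_neutral_cong_left) auto
      finally show "f j * part_minorant (k - j) = (\<Sum>J=1..k. if j \<le> J then f j * pm_diff (k - J) else 0)" .
    qed
    also have "\<dots> = (\<Sum>J=1..k. \<Sum>j=1..k. if j \<le> J then f j * pm_diff (k - J) else 0)" by (rule sum.swap)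
    also have "\<dots> = (\<Sum>J=1..k. (\<Sum>j=1..J. f j) * pm_diff (k - J))"
    proof (rule sum.cong[OF refl])
      fix J assume J: "J \<in> {1..k}"
      have "(\<Sum>j=1..k. if j \<le> J then f j * pm_diff (k - J) else 0) = (\<Sum>j=1..J. f j * pm_diff (k - J))"
        using J by (intro sum.mono_neutral_cong_right) auto
      then show "(\<Sum>j=1..k. if j \<le> J then f j * pm_diff (k - J) else 0) = (\<Sum>j=1..J. f j) * pm_diff (k - J)"
        by (simp add: sum_distrib_right)
    qed
    finally show ?thesis .
  qed
  have lin: "real k * part_minorant k = (\<Sum>J=1..k. (5 / 6 * real J * (real J + 1)) * pm_diff (k - J))"
  proof -
    have "(\<Sum>i<k. real (k - i) * part_minorant i) = (\<Sum>j=1..k. real j * part_minorant (k - j))"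
      by (rule sum.reindex_bij_witness[of _ "\<lambda>j. k - j" "\<lambda>i. k - i"]) auto
    then have "real k * part_minorant k = 5 / 3 * (\<Sum>j=1..k. real j * part_minorant (k - j))"
      using part_minorant_convolution[of k] by simp
    also have "\<dots> = (\<Sum>J=1..k. (5 / 3 * (\<Sum>j=1..J. real j)) * pm_diff (k - J))"
      unfolding swap by (subst sum_distrib_left) (simp only: mult.assoc)
    also have "\<dots> = (\<Sum>J=1..k. (5 / 6 * real J * (real J + 1)) * pm_diff (k - J))"
    proof (rule sum.cong[OF refl])
      fix J
      have "(\<Sum>j=1..J. real j) = real J * (real J + 1) / 2" using tri_real[of J] by (simp add: tri_def)
      then show "5 / 3 * (\<Sum>j=1..J. real j) * pm_diff (k - J) = 5 / 6 * real J * (real J + 1) * pm_diff (k - J)" by simp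
    qed
    finally show ?thesis .
  qed
  show ?thesis
    unfolding lin swap sum.distrib[symmetric]
    by (rule sum.cong[OF refl]) (simp add: excess_def log_coeff_sum_def algebra_simps)
qed

text \<open>\<open>excess\<close> is negative only at 1, 3 and 7. By \<open>pm_diff_ratio\<close>
  the deficit at 1 is covered by the term at 2, that at 3 by the terms at 4, 5 and 6, and that at 7
  by the term at 8. The condition \<open>12 <= k\<close> keeps every index used there at least
  5.\<close>

lemma excess_sum_nonneg:
  assumes "12 \<le> k"
  shows "0 \<le> (\<Sum>J=1..k. excess J * pm_diff (k - J))"
proof -
  let ?f = "\<lambda>J. excess J * pm_diff (k - J)"
  have "(\<Sum>J=1..k. ?f J) = (\<Sum>J=1..8. ?f J) + (\<Sum>J=9..k. ?f J)"
    using assms by (subst sum.union_disjoint[symmetric]) (auto intro!: sum.cong)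
  moreover have "0 \<le> (\<Sum>J=9..k. ?f J)"
    using excess_nonneg pm_diff_pos by (intro sum_nonneg mult_nonneg_nonneg) (auto intro: less_imp_le)
  moreover have "0 \<le> (\<Sum>J=1..8. ?f J)"
  proof -
    have "(\<Sum>J=1..8. ?f J) = - 2 / 3 * pm_diff (k - 1) + pm_diff (k - 2) - 3 * pm_diff (k - 3) + 10 / 3 * pm_diff (k - 4)
      + pm_diff (k - 5) + 2 * pm_diff (k - 6) - 5 / 3 * pm_diff (k - 7) + 14 * pm_diff (k - 8)"
    proof -
      have "{1..8} = {1, 2, 3, 4, 5, 6, 7, 8 :: nat}" by auto
      then show ?thesis by (simp add: excess_small del: One_nat_def)
    qed
    moreover have "pm_diff (k - 1) \<le> 3 / 2 * pm_diff (k - 2)" "pm_diff (k - 3) \<le> 3 / 2 * pm_diff (k - 4)"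
      "pm_diff (k - 4) \<le> 3 / 2 * pm_diff (k - 5)" "pm_diff (k - 5) \<le> 3 / 2 * pm_diff (k - 6)"
      "pm_diff (k - 7) \<le> 3 / 2 * pm_diff (k - 8)"
      using pm_diff_ratio[of "k - 1"] pm_diff_ratio[of "k - 3"] pm_diff_ratio[of "k - 4"]
        pm_diff_ratio[of "k - 5"] pm_diff_ratio[of "k - 7"] assms
      by (simp_all add: numeral_eq_Suc)
    moreover have "0 < pm_diff (k - 8)" "0 < pm_diff (k - 6)" using pm_diff_pos by auto
    ultimately show ?thesis by linarith
  qed
  ultimately show ?thesis by linarith
qed

lemma num_codes_num_types_values:
  "num_codes num_types 0 0 = 1" "num_codes num_types 1 1 = 1" "num_codes num_types 2 2 = 3"
  "num_codes num_types 3 3 = 3" "num_codes num_types 4 4 = 8" "num_codes num_types 5 5 = 9"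
  "num_codes num_types 6 6 = 18" "num_codes num_types 7 7 = 21" "num_codes num_types 8 8 = 39"
  "num_codes num_types 9 9 = 46" "num_codes num_types 10 10 = 78" "num_codes num_types 11 11 = 93"
  by code_simp+

text \<open>Both sequences obey recurrences with non-negative weights, so once
  \<open>excess_sum_nonneg\<close> applies the inequality propagates. The constant is dictated by
  \<open>k = 3\<close>, where the ratio is 486/845, about 0.575.\<close>

lemma type_codes_ge_part_minorant: "57 / 100 * part_minorant k \<le> type_codes k"
proof (induction k rule: less_induct)
  case (less k)
  show ?case
  proof (cases "k < 12")
    case True
    then have "k = 0 \<or> k = 1 \<or> k = 2 \<or> k = 3 \<or> k = 4 \<or> k = 5 \<or> k = 6 \<or> k = 7 \<or> k = 8 \<or> k = 9 \<or> k = 10 \<or> k = 11"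
      by arith
    then have "k \<in> {0, 1, 2, 3, 4, 5, 6, 7, 8, 9, 10, 11}" by blast
    then show ?thesis
      unfolding type_codes_def
      by (elim insertE) (simp_all only: num_codes_num_types_values part_minorant_values, simp_all)
  next
    case False
    have "57 / 100 * (real k * part_minorant k)
        \<le> 57 / 100 * (real k * part_minorant k + (\<Sum>J=1..k. excess J * pm_diff (k - J)))"
      using excess_sum_nonneg[of k] False by simp
    also have "\<dots> = (\<Sum>j=1..k. log_coeff j * (57 / 100 * part_minorant (k - j)))"
      unfolding sum_by_parts_excess[symmetric] by (simp add: sum_distrib_left mult.left_commute)
    also have "\<dots> \<le> (\<Sum>j=1..k. log_coeff j * type_codes (k - j))"
      using log_coeff_nonneg less False by (intro sum_mono mult_left_mono) auto
    also have "\<dots> = real k * type_codes k" by (rule type_codes_recurrence[symmetric])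
    finally have "real k * (57 / 100 * part_minorant k) \<le> real k * type_codes k" by simp
    then show ?thesis using False by simp
  qed
qed

text \<open>The main term of the Hardy-Ramanujan formula for the number of partitions of
  \<open>k\<close>.\<close>

definition HR :: "nat \<Rightarrow> real" where
  "HR k = 1 / (4 * sqrt 3 * real k) * exp (pi * sqrt (2 * real k / 3))"

section \<open>Growth and small values of the Hardy-Ramanujan term\<close>

lemma one_plus_ge_exp:
  assumes "0 \<le> (z :: real)"
  shows "exp (z - z\<^sup>2 / 2) \<le> 1 + z"
proof -
  have "0 \<le> ln (1 + z) - (z - z\<^sup>2 / 2)"
  proof (rule nonneg_if_deriv_nonneg[where f = "\<lambda>z. ln (1 + z) - (z - z\<^sup>2 / 2)" and f' = "\<lambda>t. t\<^sup>2 / (1 + t)"])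
    show "((\<lambda>z. ln (1 + z) - (z - z\<^sup>2 / 2)) has_real_derivative t\<^sup>2 / (1 + t)) (at t)" if "0 \<le> t" for t
    proof -
      have "t\<^sup>2 / (1 + t) = 1 / (1 + t) - (1 - t)" using that by (simp add: field_simps power2_eq_square)
      then show ?thesis using that by (auto intro!: derivative_eq_intros)
    qed
  qed (use assms in auto)
  then have "exp (z - z\<^sup>2 / 2) \<le> exp (ln (1 + z))" by simp
  then show ?thesis using assms by simp
qed

lemma pi_sqrt_two_thirds_le: "pi * sqrt (2 / 3) \<le> 25652 / 10000"
proof -
  have "pi\<^sup>2 * (2 / 3) \<le> (31417 / 10000)\<^sup>2 * (2 / 3)"
    using pi_bounds by (intro mult_right_mono power_mono) auto
  also have "\<dots> \<le> (25652 / 10000)\<^sup>2" by (simp add: power2_eq_square)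
  finally have "sqrt (pi\<^sup>2 * (2 / 3)) \<le> 25652 / 10000" by (intro real_le_lsqrt) auto
  then show ?thesis by (simp only: real_sqrt_mult real_sqrt_abs) simp
qed

text \<open>The quotient of the exponentials has exponent about (pi / sqrt 6) / sqrt k, and pi /
  sqrt 6 is below 9/7. The prefactor contributes \<open>1 - 1 / k\<close>, at most exp (-1/k), which
  pays for the second-order term of the logarithm of the right-hand factor.\<close>

lemma HR_step:
  assumes "6 \<le> k"
  shows "HR k \<le> HR (k - 1) * (1 + 9 / 7 / sqrt (real k))"
proof -
  define s where "s = sqrt (real k)"
  define r where "r = sqrt (real (k - 1))"
  define a where "a = pi * sqrt (2 / 3)"
  have s2: "s * s = real k" by (simp add: s_def)
  have "sqrt ((244 / 100)\<^sup>2) \<le> s" unfolding s_def using assms by (intro real_sqrt_le_mono) (simp add: power2_eq_square)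
  then have s: "244 / 100 \<le> s" by simp
  have k6: "6 \<le> s * s" using assms s2 by simp
  have r2: "r * r = s * s - 1" using assms by (simp add: r_def s2)
  have a: "0 \<le> a" "a \<le> 25652 / 10000" using pi_sqrt_two_thirds_le by (auto simp: a_def)
  have ak: "pi * sqrt (2 * real m / 3) = a * sqrt (real m)" for m
    by (simp add: a_def mult.assoc flip: real_sqrt_mult)
  \<comment> \<open>With \<open>q = 1 / k\<close> this is
    \<open>sqrt (1 - q) >= 1 - q / 2 - q^2 / 7\<close>: the Taylor coefficient 1/8 is enlarged to
    1/7 to absorb the higher terms, which suffices for \<open>q <= 1/6\<close>.\<close>
  have sr: "s - r \<le> 1 / (2 * s) + 1 / (7 * (s * s * s))"
  proof -
    define q where "q = 1 / (s * s)"
    have q: "0 < q" "q \<le> 1 / 6" using k6 by (auto simp: q_def field_simps)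
    have sq: "s * s * q = 1" using s by (simp add: q_def)
    have "(s * (1 - q / 2 - q * q / 7))\<^sup>2 = s * s - (s * s * q) + (s * s * q) * q * (1 / 4 - 2 / 7) + (s * s * q) * q * q / 7 + (s * s * q) * q * q * q / 49"
      by (simp add: power2_eq_square algebra_simps)
    also have "\<dots> = s * s - 1 + q * (- 1 / 28 + q / 7 + q * q / 49)" unfolding sq by (simp add: algebra_simps)
    also have "\<dots> \<le> s * s - 1"
    proof -
      have "q * q \<le> 1 / 6 * (1 / 6)" using q by (intro mult_mono) auto
      then have "- 1 / 28 + q / 7 + q * q / 49 \<le> 0" using q by linarith
      then have "q * (- 1 / 28 + q / 7 + q * q / 49) \<le> 0" using q by (simp add: mult_le_0_iff)
      then show ?thesis by simp
    qed
    finally have "s * (1 - q / 2 - q * q / 7) \<le> sqrt (s * s - 1)" by (rule real_le_rsqrt)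
    moreover have "sqrt (s * s - 1) = r" using assms by (simp add: r_def s2)
    moreover have "s * (1 - q / 2 - q * q / 7) = s - (1 / (2 * s) + 1 / (7 * (s * s * s)))"
      using s by (simp add: q_def field_simps)
    ultimately show ?thesis by linarith
  qed
  have rs: "r \<le> s" by (simp add: r_def s_def)
  define z where "z = 9 / 7 / s"
  have z: "0 \<le> z" using s by (simp add: z_def)
  have "a * (s - r) \<le> 25652 / 10000 * (1 / (2 * s) + 1 / (7 * (s * s * s)))"
    using a sr s rs by (intro mult_mono) auto
  also have "\<dots> \<le> z - z\<^sup>2 / 2 + 1 / (s * s)"
  proof -
    \<comment> \<open>The difference of the two sides multiplied by \<open>s^3\<close>; 1.2826 is
      half the upper bound for pi sqrt (2/3), and its leading coefficient is positive as 9/7 is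
      larger.\<close>
    have "0 \<le> (9 / 7 - 12826 / 10000) * (s * s) + (1 - 81 / 98) * s - 25652 / 70000"
    proof -
      have "(244 / 100) * (244 / 100) \<le> s * s" using s by (intro mult_mono) auto
      then show ?thesis using s by (simp add: field_simps)
    qed
    then have "0 \<le> ((9 / 7 - 12826 / 10000) * (s * s) + (1 - 81 / 98) * s - 25652 / 70000) / (s * s * s)"
      using s by simp
    also have "\<dots> = (z - z\<^sup>2 / 2 + 1 / (s * s)) - 25652 / 10000 * (1 / (2 * s) + 1 / (7 * (s * s * s)))"
      using s by (simp add: z_def field_simps power2_eq_square)
    finally show ?thesis by simp
  qed
  finally have "exp (a * (s - r)) \<le> exp (z - z\<^sup>2 / 2) * exp (1 / real k)"
    by (simp add: s2 flip: exp_add)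
  also have "\<dots> \<le> (1 + z) * exp (1 / real k)"
    using one_plus_ge_exp[OF z] by (intro mult_right_mono) auto
  finally have 1: "exp (a * (s - r)) * (1 - 1 / real k) \<le> (1 + z) * exp (1 / real k) * exp (- (1 / real k))"
    using exp_ge_add_one_self[of "- (1 / real k)"] assms z by (intro mult_mono) auto
  then have 2: "exp (a * (s - r)) * (1 - 1 / real k) \<le> 1 + z" by (simp add: mult.assoc flip: exp_add)
  have "HR k = 1 / (4 * sqrt 3 * real k) * (exp (a * r) * exp (a * (s - r)))"
    unfolding HR_def ak s_def[symmetric] by (simp add: algebra_simps flip: exp_add)
  also have "\<dots> = HR (k - 1) * (exp (a * (s - r)) * (1 - 1 / real k))"
    unfolding HR_def ak r_def[symmetric] using assms by (simp add: field_simps of_nat_diff)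
  also have "\<dots> \<le> HR (k - 1) * (1 + z)"
    using 2 by (intro mult_left_mono) (auto simp: HR_def)
  finally show ?thesis by (simp add: z_def s_def)
qed

text \<open>A scheme for rational certificates: \<open>q\<close> bounds
  \<open>sqrt (2 * k / 3)\<close> from above, \<open>p\<close> bounds \<open>sqrt 3\<close> from
  below, and the exponent is at most \<open>n - u\<close>. Then 68/25 bounds e, and the Taylor
  polynomial of degree 4 bounds the exponential of \<open>u\<close>.\<close>

lemma HR_le:
  assumes "0 < k" "0 < n" "31417 / 10000 * q \<le> real n - u" "0 \<le> u" "2 * real k / 3 \<le> q\<^sup>2" "0 \<le> q" "p\<^sup>2 \<le> 3" "0 \<le> p"
    and "(68 / 25) ^ n \<le> v * (4 * p * real k) * (1 + u + u\<^sup>2 / 2 + u ^ 3 / 6 + u ^ 4 / 24)" "0 \<le> v"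
  shows "HR k \<le> v"
proof -
  have "sqrt (2 * real k / 3) \<le> q" using assms by (intro real_le_lsqrt) auto
  then have "pi * sqrt (2 * real k / 3) \<le> 31417 / 10000 * q"
    using pi_bounds assms by (intro mult_mono) auto
  then have "exp (pi * sqrt (2 * real k / 3)) \<le> exp (real n - u)" using assms(3) by simp
  also have "\<dots> = exp 1 ^ n / exp u" by (simp add: exp_diff flip: exp_of_nat_mult)
  also have "\<dots> \<le> (68 / 25) ^ n / exp u" using exp_1_le by (intro divide_right_mono power_mono) auto
  also have "\<dots> \<le> (68 / 25) ^ n / (1 + u + u\<^sup>2 / 2 + u ^ 3 / 6 + u ^ 4 / 24)"
  proof (intro divide_left_mono)
    show "1 + u + u\<^sup>2 / 2 + u ^ 3 / 6 + u ^ 4 / 24 \<le> exp u"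
      using exp_ge_partial_sum[OF assms(4), of "{0, 1, 2, 3, 4}"] by (simp add: fact_numeral field_simps)
    show "0 < exp u * (1 + u + u\<^sup>2 / 2 + u ^ 3 / 6 + u ^ 4 / 24)"
      using assms(4) by (intro mult_pos_pos) (auto intro!: add_pos_nonneg)
  qed simp
  also have "\<dots> \<le> v * (4 * p * real k)"
  proof -
    have "0 < 1 + u + u\<^sup>2 / 2 + u ^ 3 / 6 + u ^ 4 / 24" using assms(4) by (auto intro!: add_pos_nonneg)
    then show ?thesis using assms(9) by (simp add: pos_divide_le_eq)
  qed
  also have "\<dots> \<le> v * (4 * sqrt 3 * real k)"
    using assms real_le_rsqrt[of p 3] by (intro mult_left_mono mult_right_mono) auto
  finally show ?thesis using assms(1) by (simp add: HR_def field_simps)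
qed

text \<open>The narrowest case is \<open>k = 5\<close>, where the value is about 8.94 and the number
  of types is 9; its certificate needs the most digits.\<close>

lemma HR_values: "HR 1 \<le> 2" "HR 2 \<le> 3" "HR 3 \<le> 5" "HR 4 \<le> 8" "HR 5 \<le> 9" "HR 11 \<le> 57 / 100 * part_minorant 11"
proof -
  show "HR 1 \<le> 2"
    by (rule HR_le[of _ 3 "8165 / 10000" "43 / 100" "173 / 100"]) (simp_all add: eval_nat_numeral)
  show "HR 2 \<le> 3"
    by (rule HR_le[of _ 4 "11548 / 10000" "37 / 100" "173 / 100"]) (simp_all add: eval_nat_numeral)
  show "HR 3 \<le> 5"
    by (rule HR_le[of _ 5 "14143 / 10000" "55 / 100" "173 / 100"]) (simp_all add: eval_nat_numeral)
  show "HR 4 \<le> 8"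
    by (rule HR_le[of _ 6 "16330 / 10000" "86 / 100" "173 / 100"]) (simp_all add: eval_nat_numeral)
  show "HR 5 \<le> 9"
    by (rule HR_le[of _ 6 "182575 / 100000" "2639 / 10000" "1732 / 1000"]) (simp_all add: eval_nat_numeral)
  show "HR 11 \<le> 57 / 100 * part_minorant 11"
    unfolding part_minorant_11
    by (rule HR_le[of _ 9 "27081 / 10000" "49 / 100" "173 / 100"]) (simp_all add: eval_nat_numeral)
qed

lemma HR_le_part_minorant:
  assumes "11 \<le> k"
  shows "HR k \<le> 57 / 100 * part_minorant k"
  using assms
proof (induction k rule: dec_induct)
  case base
  show ?case by (rule HR_values)
next
  case (step k)
  have "HR (Suc k) \<le> HR k * (1 + 9 / 7 / sqrt (real (Suc k)))" using HR_step[of "Suc k"] step.hyps by simp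
  also have "\<dots> \<le> 57 / 100 * part_minorant k * (1 + 9 / 7 / sqrt (real (Suc k)))"
    using step.IH by (intro mult_right_mono) auto
  also have "\<dots> \<le> 57 / 100 * part_minorant (Suc k)"
  proof -
    have "9 / 7 * part_minorant k \<le> pm_diff (Suc k) * sqrt (real (Suc k))"
      using pm_diff_growth[of "Suc k"] step.hyps by simp
    then have "part_minorant k * (9 / 7 / sqrt (real (Suc k))) \<le> pm_diff (Suc k)"
      by (simp add: field_simps)
    then have "part_minorant k * (1 + 9 / 7 / sqrt (real (Suc k))) \<le> part_minorant (Suc k)"
      by (simp add: pm_diff_def algebra_simps)
    then have "57 / 100 * (part_minorant k * (1 + 9 / 7 / sqrt (real (Suc k)))) \<le> 57 / 100 * part_minorant (Suc k)"
      by (intro mult_left_mono) auto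
    then show ?thesis by (simp only: mult.assoc)
  qed
  finally show ?case .
qed

lemma HR_le_num_codes:
  assumes "0 < k" "k \<noteq> 1" "k \<noteq> 3"
  shows "HR k \<le> real (num_codes num_types k k)"
proof (cases "11 \<le> k")
  case True
  then show ?thesis
    using HR_le_part_minorant[OF True] type_codes_ge_part_minorant[of k] by (simp add: type_codes_def)
next
  case False
  \<comment> \<open>The values from 6 to 10 are reached from \<open>HR 5\<close> by
    \<open>HR_step\<close>, with \<open>q\<close> a rational lower bound of the square root.\<close>
  have step: "HR (Suc k) \<le> w" if "HR k \<le> v" "5 \<le> k" "q\<^sup>2 \<le> real (Suc k)" "0 < q" "v * (1 + 9 / 7 / q) \<le> w" "0 \<le> v" for k v w q
  proof -
    have "HR (Suc k) \<le> HR k * (1 + 9 / 7 / sqrt (real (Suc k)))" using HR_step[of "Suc k"] that by simp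
    also have "\<dots> \<le> v * (1 + 9 / 7 / q)"
      using that real_le_rsqrt[OF that(3)]
      by (intro mult_mono add_left_mono divide_left_mono mult_pos_pos) (auto intro: less_le_trans)
    finally show ?thesis using that by linarith
  qed
  have 6: "HR 6 \<le> 138 / 10" using step[OF HR_values(5), of "244 / 100" "138 / 10"] by (simp add: power2_eq_square)
  have 7: "HR 7 \<le> 2056 / 100" using step[OF 6, of "264 / 100" "2056 / 100"] by (simp add: power2_eq_square)
  have 8: "HR 8 \<le> 30" using step[OF 7, of "282 / 100" "30"] by (simp add: power2_eq_square)
  have 9: "HR 9 \<le> 43" using step[OF 8, of "3" "43"] by (simp add: power2_eq_square)
  have 10: "HR 10 \<le> 61" using step[OF 9, of "316 / 100" "61"] by (simp add: power2_eq_square)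
  have "k = 2 \<or> k = 4 \<or> k = 5 \<or> k = 6 \<or> k = 7 \<or> k = 8 \<or> k = 9 \<or> k = 10" using False assms by arith
  then have "k \<in> {2, 4, 5, 6, 7, 8, 9, 10}" by blast
  then show ?thesis
    using HR_values 6 7 8 9 10 by (elim insertE) (simp_all add: num_codes_num_types_values)
qed

section \<open>Lower bound for the number of classes\<close>

lemma L2_lower:
  assumes fin: "finite (z2_lattices n D // z2_isometry_rel n D)"
    and mem: "\<And>s. s \<in> S \<Longrightarrow> blocks_mat (f s) \<in> z2_lattices n D"
    and inj: "\<And>s t. s \<in> S \<Longrightarrow> t \<in> S \<Longrightarrow> f s \<approx> f t \<Longrightarrow> s = t"
  shows "card S \<le> L2 n D"
  unfolding L2_def
proof (rule card_inj_on_le[OF _ _ fin])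
  let ?R = "z2_isometry_rel n D"
  show "inj_on (\<lambda>s. ?R `` {blocks_mat (f s)}) S"
  proof (rule inj_onI)
    fix s t assume st: "s \<in> S" "t \<in> S" "?R `` {blocks_mat (f s)} = ?R `` {blocks_mat (f t)}"
    then have "(blocks_mat (f s), blocks_mat (f t)) \<in> ?R"
      using eq_equiv_class[OF _ equiv_z2_isometry_rel] mem by blast
    then show "s = t" using inj st by (simp add: z2_isometry_rel_def blocks_isometric_def)
  qed
  show "(\<lambda>s. ?R `` {blocks_mat (f s)}) ` S \<subseteq> z2_lattices n D // ?R" using mem by (auto intro: quotientI)
qed

section \<open>Lattices with prescribed ranks and types\<close>

definition type_canon :: "nat \<Rightarrow> nat \<Rightarrow> nat \<Rightarrow> z2_block list" where
  "type_canon e m c = (if even m \<and> c = 0 then replicate (m div 2) (Hyp e) else replicate m (Unary e 1))"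

lemma blocks_rank_replicate: "blocks_rank (replicate m b) = m * block_rank b"
  by (induction m) auto

lemma blocks_rank_type_canon: "blocks_rank (type_canon e m c) = m"
  by (auto simp: type_canon_def blocks_rank_replicate)

lemma type_canon_blocks: "b \<in> set (type_canon e m c) \<Longrightarrow> split_block b \<and> block_scale b = e"
  by (auto simp: type_canon_def split: if_splits)

lemma assemble_rank:
  assumes "\<And>e m c. blocks_rank (f e m c) = m"
  shows "blocks_rank (assemble f cs) = code_rank cs"
proof (induction cs rule: rev_induct)
  case (snoc x cs)
  then show ?case by (cases x) (simp add: assemble_snoc assms code_rank_def)
qed (simp add: code_rank_def)

lemma assemble_valuation:
  assumes "\<And>e m c. blocks_rank (f e m c) = m" "\<And>e m c b. b \<in> set (f e m c) \<Longrightarrow> block_scale b = e"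
    and "cs \<in> codes d N k"
  shows "blocks_valuation (assemble f cs) = k \<and> code_rank cs \<le> k"
  using assms(3)
proof (induction N arbitrary: cs k)
  case 0
  then show ?case by (auto simp: blocks_valuation_def code_rank_def split: if_splits)
next
  case (Suc N)
  then obtain m c cs' where m: "m \<le> k div Suc N" and cs': "cs' \<in> codes d N (k - Suc N * m)" and cs: "cs = cs' @ [(m, c)]"
    by auto
  have le: "Suc N * m \<le> k" using m by (metis less_eq_div_iff_mult_less_eq mult.commute zero_less_Suc)
  have IH: "blocks_valuation (assemble f cs') = k - Suc N * m" "code_rank cs' \<le> k - Suc N * m" using Suc.IH[OF cs'] by auto
  have "blocks_valuation (f (Suc N) m c) = Suc N * m"
    using blocks_valuation_scale[of "f (Suc N) m c" "Suc N"] assms(1,2) by simp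
  then have "blocks_valuation (assemble f cs) = k"
    using IH le by (simp add: cs assemble_snoc length_codes[OF cs'])
  moreover have "code_rank cs = code_rank cs' + m" by (simp add: cs code_rank_def)
  then have "code_rank cs \<le> k" using IH(2) le by simp
  ultimately show ?case by blast
qed

lemma set_assemble: "set (assemble f cs) = (\<Union>i<length cs. set (f (Suc i) (fst (cs ! i)) (snd (cs ! i))))"
  by (auto simp: assemble_def)

lemma filter_scale_assemble:
  assumes "\<And>e m c b. b \<in> set (f e m c) \<Longrightarrow> block_scale b = e" "j < length cs"
  shows "filter (\<lambda>b. block_scale b = Suc j) (assemble f cs) = f (Suc j) (fst (cs ! j)) (snd (cs ! j))"
  using assms(2)
proof (induction cs rule: rev_induct)
  case (snoc x cs)
  obtain m c where x: "x = (m, c)" by fastforce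
  show ?case
  proof (cases "j = length cs")
    case True
    have "filter (\<lambda>b. block_scale b = Suc j) (assemble f cs) = []"
      using assms(1) True by (auto simp: filter_empty_conv set_assemble)
    moreover have "filter (\<lambda>b. block_scale b = Suc j) (f (Suc (length cs)) m c) = f (Suc (length cs)) m c"
      using assms(1) True by (auto intro: filter_True)
    ultimately show ?thesis using True by (simp add: x assemble_snoc)
  next
    case False
    then have "filter (\<lambda>b. block_scale b = Suc j) (f (Suc (length cs)) m c) = []"
      using assms(1) by (auto simp: filter_empty_conv)
    then show ?thesis using False snoc by (simp add: x assemble_snoc nth_append)
  qed
qed simp

lemma codes_snd_less:
  assumes "cs \<in> codes d N k" "j < N"
  shows "snd (cs ! j) < d (fst (cs ! j))"
  using assms
proof (induction N arbitrary: cs k)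
  case (Suc N)
  then obtain m c cs' where m: "c < d m" and cs': "cs' \<in> codes d N (k - Suc N * m)" and cs: "cs = cs' @ [(m, c)]" by auto
  show ?case
  proof (cases "j = N")
    case True
    then show ?thesis using m length_codes[OF cs'] by (simp add: cs nth_append)
  next
    case False
    then show ?thesis using Suc.IH[OF cs'] Suc.prems(2) length_codes[OF cs'] by (simp add: cs nth_append)
  qed
qed simp

lemma rank_from_step:
  "rank_from i xs = blocks_rank (filter (\<lambda>b. block_scale b = i) xs) + rank_from (Suc i) xs"
  by (induction xs) (auto simp: rank_from_def)

lemma odd_square_mod_8: "odd (R :: int) \<Longrightarrow> 8 dvd R * R - 1"
proof -
  assume "odd R"
  then obtain r where r: "R = 2 * r + 1" by (rule oddE)
  have "even (r * r + r)" by simp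
  then obtain t where "r * r + r = 2 * t" by (rule evenE)
  then have "R * R - 1 = 8 * t" by (simp add: r algebra_simps)
  then show ?thesis by (rule dvdI)
qed

text \<open>The first entry adjusts the determinant.\<close>

definition complete_blocks :: "nat \<Rightarrow> int \<Rightarrow> z2_block list \<Rightarrow> z2_block list" where
  "complete_blocks n D ys =
    Unary 0 (odd_part D * blocks_unit ys) # replicate (n - 1 - blocks_rank ys) (Unary 0 1) @ ys"

lemma complete_blocks_split:
  assumes "D \<noteq> 0" "\<forall>b\<in>set ys. split_block b"
  shows "\<forall>b\<in>set (complete_blocks n D ys). split_block b"
proof -
  have "odd (blocks_unit ys)" using assms(2) split_block_good odd_blocks_unit by blast
  then show ?thesis using assms odd_part(2)[OF assms(1)] by (auto simp: complete_blocks_def)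
qed

text \<open>The unit of the completed list is \<open>odd_part D\<close> times the square of an odd
  number, hence \<open>odd_part D\<close> modulo 8. A rank of \<open>ys\<close> below
  \<open>n\<close> leaves room for the adjusting entry.\<close>

lemma complete_blocks_lattice:
  assumes D: "D \<noteq> 0" and ys: "\<forall>b\<in>set ys. split_block b" "blocks_rank ys < n"
    and val: "blocks_valuation ys = multiplicity 2 D"
  shows "blocks_mat (complete_blocks n D ys) \<in> z2_lattices n D"
proof (rule blocks_mat_in_z2_lattices[OF _ D])
  show "\<forall>b\<in>set (complete_blocks n D ys). good_block b"
    using complete_blocks_split[OF D ys(1)] split_block_good by blast
  show "blocks_rank (complete_blocks n D ys) = n"
    using ys(2) by (simp add: complete_blocks_def blocks_rank_replicate)
  have "blocks_valuation (replicate r (Unary 0 1)) = 0" for r by (simp add: blocks_valuation_def sum_list_replicate)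
  then show "blocks_valuation (complete_blocks n D ys) = multiplicity 2 D"
    using val by (simp add: complete_blocks_def blocks_valuation_def)
  have unit: "blocks_unit (complete_blocks n D ys) = odd_part D * (blocks_unit ys * blocks_unit ys)"
    by (simp add: complete_blocks_def blocks_unit_def)
  have "odd (blocks_unit ys)" using ys(1) split_block_good odd_blocks_unit by blast
  then have "8 dvd odd_part D * (blocks_unit ys * blocks_unit ys - 1)" using odd_square_mod_8 by (intro dvd_mult) blast
  then show "blocks_unit (complete_blocks n D ys) mod 8 = odd_part D mod 8"
    unfolding unit mod_eq_dvd_iff by (simp add: algebra_simps)
qed

text \<open>The added entries have scale 1, so they affect neither \<open>rank_from\<close> nor the
  parity type at the larger scales.\<close>

lemma complete_blocks_isometric:
  assumes iso: "complete_blocks n D ys \<approx> complete_blocks n D zs" and D: "D \<noteq> 0"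
    and ys: "\<forall>b\<in>set ys. split_block b" and zs: "\<forall>b\<in>set zs. split_block b"
  shows "rank_from (Suc i) ys = rank_from (Suc i) zs"
    "(\<exists>u. Unary (Suc i) u \<in> set ys) \<longleftrightarrow> (\<exists>u. Unary (Suc i) u \<in> set zs)"
proof -
  have iso': "z2_isometric (blocks_mat (complete_blocks n D ys)) (blocks_mat (complete_blocks n D zs))"
    using iso unfolding blocks_isometric_def .
  note inv = z2_isometric_invariants[OF blocks_mat_carrier iso']
  note sy = complete_blocks_split[OF D ys, of n] and sz = complete_blocks_split[OF D zs, of n]
  have rf: "rank_from (Suc i) (complete_blocks n D xs) = rank_from (Suc i) xs" for xs
    by (simp add: rank_from_def complete_blocks_def)
  have "(2 :: nat) ^ rank_from (Suc i) ys = 2 ^ rank_from (Suc i) zs"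
    using inv(1)[of "Suc i"] unfolding dual_count_blocks[OF sy] dual_count_blocks[OF sz] rf .
  then show "rank_from (Suc i) ys = rank_from (Suc i) zs" by simp
  have un: "(\<exists>u. Unary (Suc i) u \<in> set (complete_blocks n D xs)) \<longleftrightarrow> (\<exists>u. Unary (Suc i) u \<in> set xs)" for xs
    by (auto simp: complete_blocks_def)
  have "even_at (Suc i) (blocks_mat (complete_blocks n D ys)) \<longleftrightarrow> even_at (Suc i) (blocks_mat (complete_blocks n D zs))"
    unfolding even_at_def inv(2) ..
  then show "(\<exists>u. Unary (Suc i) u \<in> set ys) \<longleftrightarrow> (\<exists>u. Unary (Suc i) u \<in> set zs)"
    unfolding even_at_blocks[OF sy] even_at_blocks[OF sz] un by blast
qed

text \<open>Consecutive values of \<open>rank_from\<close> recover the rank of each constituent, and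
  the presence of a unary block recovers its type. The total rank of the constituents is at most
  \<open>k\<close>, hence below \<open>n\<close>.\<close>

lemma L2_lower_types:
  assumes D: "D \<noteq> 0" and k: "k = multiplicity 2 D" and n: "k < n"
  shows "num_codes num_types k k \<le> L2 n D"
proof -
  let ?f = "\<lambda>cs. assemble type_canon cs"
  have split: "\<forall>b\<in>set (?f cs). split_block b" for cs using type_canon_blocks by (auto simp: set_assemble)
  have scale: "block_scale b = e" if "b \<in> set (type_canon e m c)" for b e m c using type_canon_blocks that by blast
  have "card (codes num_types k k) \<le> L2 n D"
  proof (rule L2_lower[OF L2_upper(1)[OF D k], of _ "\<lambda>cs. complete_blocks n D (?f cs)"])
    fix cs assume cs: "cs \<in> codes num_types k k"
    have "blocks_valuation (?f cs) = k" "code_rank cs \<le> k"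
      using assemble_valuation[OF blocks_rank_type_canon scale cs] by auto
    then show "blocks_mat (complete_blocks n D (?f cs)) \<in> z2_lattices n D"
      using k n assemble_rank[of type_canon, OF blocks_rank_type_canon] by (intro complete_blocks_lattice[OF D split]) auto
  next
    fix cs cs' assume cs: "cs \<in> codes num_types k k" and cs': "cs' \<in> codes num_types k k"
      and iso: "complete_blocks n D (?f cs) \<approx> complete_blocks n D (?f cs')"
    note inv = complete_blocks_isometric[OF iso D split split]
    note len = length_codes[OF cs] length_codes[OF cs']
    show "cs = cs'"
    proof (rule nth_equalityI)
      show "length cs = length cs'" using len by simp
      fix j assume "j < length cs"
      then have j: "j < k" using len by simp
      have filt: "filter (\<lambda>b. block_scale b = Suc j) (?f as) = type_canon (Suc j) (fst (as ! j)) (snd (as ! j))" if "length as = k" for as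
        by (rule filter_scale_assemble) (use scale j that in auto)
      have "blocks_rank (filter (\<lambda>b. block_scale b = Suc j) (?f cs)) = blocks_rank (filter (\<lambda>b. block_scale b = Suc j) (?f cs'))"
        using inv(1)[of j] inv(1)[of "Suc j"] rank_from_step[of "Suc j"] by simp
      then have m: "fst (cs ! j) = fst (cs' ! j)"
        unfolding filt[OF len(1)] filt[OF len(2)] blocks_rank_type_canon .
      have un: "(\<exists>u. Unary (Suc j) u \<in> set (?f as)) \<longleftrightarrow> (\<exists>u. Unary (Suc j) u \<in> set (type_canon (Suc j) (fst (as ! j)) (snd (as ! j))))"
        if "length as = k" for as
        unfolding filt[OF that, symmetric] by auto
      have pres: "(\<exists>u. Unary (Suc j) u \<in> set (type_canon (Suc j) m c)) \<longleftrightarrow> 0 < m \<and> (odd m \<or> c \<noteq> 0)" for m c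
        by (auto simp: type_canon_def)
      have "0 < fst (cs ! j) \<and> (odd (fst (cs ! j)) \<or> snd (cs ! j) \<noteq> 0) \<longleftrightarrow> 0 < fst (cs' ! j) \<and> (odd (fst (cs' ! j)) \<or> snd (cs' ! j) \<noteq> 0)"
        using inv(2)[of j] unfolding un[OF len(1)] un[OF len(2)] pres .
      moreover have "snd (cs ! j) < num_types (fst (cs ! j))" "snd (cs' ! j) < num_types (fst (cs' ! j))"
        using codes_snd_less cs cs' j by blast+
      ultimately have "snd (cs ! j) = snd (cs' ! j)"
        unfolding m num_types_def by (cases "fst (cs' ! j) = 0 \<or> odd (fst (cs' ! j))") auto
      then show "cs ! j = cs' ! j" using m by (rule prod_eqI[rotated])
    qed
  qed
  then show ?thesis by (simp add: card_codes)
qed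

section \<open>The valuations 1 and 3\<close>

lemma z2adic_of_int_dvd: "2 ^ i dvd (of_int a :: z2adic) \<longleftrightarrow> 2 ^ i dvd a"
  unfolding residue_eq_0_iff_dvd[symmetric] residue_of_int by (simp add: dvd_eq_mod_eq_0)

lemma odd_square_8: "\<not> 2 dvd (x :: z2adic) \<Longrightarrow> 8 dvd x * x - 1"
proof -
  assume "\<not> 2 dvd x"
  then obtain t where t: "x - 1 = 2 * t" using z2adic_two_dvd_or by (blast elim: dvdE)
  have "2 dvd t * (t + 1)"
  proof (cases "2 dvd t")
    case False
    then have "2 dvd t - 1" using z2adic_two_dvd_or by blast
    then have "2 dvd (t - 1) + 2" by (rule dvd_add) simp
    then show ?thesis by (intro dvd_mult) (simp add: algebra_simps)
  qed simp
  then obtain r where r: "t * (t + 1) = 2 * r" by (blast elim: dvdE)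
  have x: "x = 1 + 2 * t" using t by (simp add: algebra_simps)
  have "x * x - 1 = 4 * (t * (t + 1))" by (simp add: x algebra_simps)
  also have "\<dots> = 8 * r" by (simp add: r)
  finally show "8 dvd x * x - 1" by (rule dvdI)
qed

text \<open>The characteristic vectors of \<open><a>\<close> are the odd ones, and odd squares are 1
  modulo 8.\<close>

lemma char_value_Unary_0:
  assumes "odd a"
  shows "char_value (block_mat (Unary 0 a)) s \<longleftrightarrow> 8 dvd s - of_int a"
proof -
  have unit: "\<not> 2 dvd (of_int a :: z2adic)" using assms of_int_unit_iff z2adic_unit_iff by blast
  have bil: "x \<bullet> (block_mat (Unary 0 a) *\<^sub>v y) = x $ 0 * y $ 0 * of_int a" if "x \<in> carrier_vec 1" "y \<in> carrier_vec 1" for x y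
    using Unary_mult_vec(2)[OF that, of 0 a] by (simp add: ac_simps)
  have val: "8 dvd quad (block_mat (Unary 0 a)) w - of_int a" if "w \<in> carrier_vec 1" "\<not> 2 dvd w $ 0" for w
  proof -
    have "8 dvd (w $ 0 * w $ 0 - 1) * of_int a" using odd_square_8[OF that(2)] by (rule dvd_mult2)
    then show ?thesis unfolding bil[OF that(1,1)] by (simp add: algebra_simps)
  qed
  show ?thesis
  proof
    assume "char_value (block_mat (Unary 0 a)) s"
    then obtain w where w: "char_vec (block_mat (Unary 0 a)) w" "8 dvd quad (block_mat (Unary 0 a)) w - s"
      unfolding char_value_def by blast
    have wn: "w \<in> carrier_vec 1" using w(1) unfolding char_vec_def by simp
    have "vec 1 (\<lambda>_. 1) \<in> carrier_vec (dim_row (block_mat (Unary 0 a)))" by simp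
    then have "2 dvd quad (block_mat (Unary 0 a)) (vec 1 (\<lambda>_. 1)) - vec 1 (\<lambda>_. 1) \<bullet> (block_mat (Unary 0 a) *\<^sub>v w)"
      using w(1) unfolding char_vec_def by blast
    then have "2 dvd (1 - w $ 0) * of_int a" by (subst (asm) (1 2) bil) (use wn in \<open>auto simp: algebra_simps\<close>)
    then have "2 dvd 1 - w $ 0" using unit by (simp add: z2adic_odd_mult)
    then have "\<not> 2 dvd w $ 0" using z2adic_two_not_unit by (metis diff_add_cancel dvd_add)
    note dvd_diff[OF val[OF wn this] w(2)]
    then show "8 dvd s - of_int a" by (simp add: algebra_simps)
  next
    assume s: "8 dvd s - of_int a"
    define w :: "z2adic vec" where "w = vec 1 (\<lambda>_. 1)"
    have wn: "w \<in> carrier_vec 1" by (simp add: w_def)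
    have "2 dvd quad (block_mat (Unary 0 a)) x - x \<bullet> (block_mat (Unary 0 a) *\<^sub>v w)" if "x \<in> carrier_vec 1" for x
    proof -
      have "2 dvd x $ 0 * (x $ 0 - 1)" using z2adic_two_dvd_or[of "x $ 0"] by (auto simp: z2adic_odd_mult)
      then have "2 dvd x $ 0 * (x $ 0 - 1) * of_int a" by (rule dvd_mult2)
      then show ?thesis unfolding bil[OF that that] bil[OF that wn] by (simp add: w_def algebra_simps)
    qed
    then have "char_vec (block_mat (Unary 0 a)) w" unfolding char_vec_def using wn by simp
    moreover have "8 dvd quad (block_mat (Unary 0 a)) w - s"
    proof -
      have "\<not> 2 dvd w $ 0" using z2adic_two_not_unit by (simp add: w_def)
      note dvd_diff[OF val[OF wn this] s]
      then show ?thesis by simp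
    qed
    ultimately show "char_value (block_mat (Unary 0 a)) s" unfolding char_value_def by blast
  qed
qed

text \<open>On \<open><2 * b>\<close> all inner products are even, so every vector is
  characteristic; modulo 8 an even coordinate gives norm 0 and an odd one gives
  \<open>2 * b\<close>.\<close>

lemma char_value_Unary_1:
  "char_value (block_mat (Unary 1 b)) 0"
  "char_value (block_mat (Unary 1 b)) s \<Longrightarrow> 8 dvd s \<or> 8 dvd s - 2 * of_int b"
proof -
  have bil: "x \<bullet> (block_mat (Unary 1 b) *\<^sub>v y) = 2 * (x $ 0 * y $ 0 * of_int b)" if "x \<in> carrier_vec 1" "y \<in> carrier_vec 1" for x y
    using Unary_mult_vec(2)[OF that, of 1 b] by (simp add: ac_simps)
  define w :: "z2adic vec" where "w = vec 1 (\<lambda>_. 0)"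
  have wn: "w \<in> carrier_vec 1" by (simp add: w_def)
  have "2 dvd quad (block_mat (Unary 1 b)) x - x \<bullet> (block_mat (Unary 1 b) *\<^sub>v w)" if "x \<in> carrier_vec 1" for x
    unfolding bil[OF that that] bil[OF that wn] by simp
  then have "char_vec (block_mat (Unary 1 b)) w" unfolding char_vec_def using wn by simp
  moreover have "8 dvd quad (block_mat (Unary 1 b)) w - 0" unfolding bil[OF wn wn] by (simp add: w_def)
  ultimately show "char_value (block_mat (Unary 1 b)) 0" unfolding char_value_def by blast
  assume "char_value (block_mat (Unary 1 b)) s"
  then obtain v where v: "char_vec (block_mat (Unary 1 b)) v" "8 dvd quad (block_mat (Unary 1 b)) v - s"
    unfolding char_value_def by blast
  have vn: "v \<in> carrier_vec 1" using v(1) unfolding char_vec_def by simp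
  show "8 dvd s \<or> 8 dvd s - 2 * of_int b"
  proof (cases "2 dvd v $ 0")
    case True
    then obtain t where "v $ 0 = 2 * t" by (blast elim: dvdE)
    then have "8 dvd quad (block_mat (Unary 1 b)) v" unfolding bil[OF vn vn] by simp
    then have "8 dvd quad (block_mat (Unary 1 b)) v - (quad (block_mat (Unary 1 b)) v - s)" using v(2) by (rule dvd_diff)
    then show ?thesis by simp
  next
    case False
    have "8 dvd (v $ 0 * v $ 0 - 1) * (2 * of_int b)" using odd_square_8[OF False] by (rule dvd_mult2)
    then have "8 dvd quad (block_mat (Unary 1 b)) v - 2 * of_int b" unfolding bil[OF vn vn] by (simp add: algebra_simps)
    then have "8 dvd (quad (block_mat (Unary 1 b)) v - 2 * of_int b) - (quad (block_mat (Unary 1 b)) v - s)" using v(2) by (rule dvd_diff)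
    then show ?thesis by simp
  qed
qed

lemma char_value_ones: "char_value (blocks_mat (replicate r (Unary 0 1))) s \<longleftrightarrow> 8 dvd s - of_nat r"
proof (induction r arbitrary: s)
  case 0
  have "quad (blocks_mat []) x = 0" if "x \<in> carrier_vec 0" for x using that by (auto simp: scalar_prod_def)
  moreover have "char_vec (blocks_mat []) (0\<^sub>v 0)" by (auto simp: char_vec_def scalar_prod_def)
  ultimately show ?case unfolding char_value_def char_vec_def by (auto intro!: exI[of _ "0\<^sub>v 0"])
next
  case (Suc r)
  have "char_value (blocks_mat (replicate (Suc r) (Unary 0 1))) s \<longleftrightarrow>
      (\<exists>s1 s2. 8 dvd s1 - 1 \<and> 8 dvd s2 - of_nat r \<and> s = s1 + s2)"
    unfolding replicate_Suc blocks_mat_Cons char_value_dsum[OF block_mat_carrier blocks_mat_carrier] Suc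
    using char_value_Unary_0[of 1] by simp
  also have "\<dots> \<longleftrightarrow> 8 dvd s - of_nat (Suc r)"
  proof
    assume "\<exists>s1 s2. 8 dvd s1 - 1 \<and> 8 dvd s2 - of_nat r \<and> s = s1 + s2"
    then obtain s1 s2 where s: "8 dvd s1 - 1" "8 dvd s2 - of_nat r" "s = s1 + s2" by blast
    have "8 dvd (s1 - 1) + (s2 - of_nat r)" using s by (intro dvd_add)
    then show "8 dvd s - of_nat (Suc r)" using s(3) by (simp add: algebra_simps)
  next
    assume "8 dvd s - of_nat (Suc r)"
    then show "\<exists>s1 s2. 8 dvd s1 - 1 \<and> 8 dvd s2 - of_nat r \<and> s = s1 + s2"
      by (intro exI[of _ 1] exI[of _ "s - 1"]) (simp add: algebra_simps)
  qed
  finally show ?case .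
qed

text \<open>The lattices \<open><u * b, 1, ..., 1, 2 * b>\<close> with \<open>b = 1\<close> and
  \<open>b = 5\<close> are distinguished by \<open>char_value\<close>. The norm
  \<open>5 * u + (n - 2)\<close> occurs for \<open>b = 5\<close>; for \<open>b = 1\<close> it would
  require \<open>4 * u\<close> to be 0 or 2 modulo 8, which is impossible for odd
  \<open>u\<close>.\<close>

lemma L2_lower_1:
  assumes D: "D \<noteq> 0" and k: "multiplicity 2 D = 1" and n: "2 \<le> n"
  shows "2 \<le> L2 n D"
proof -
  let ?u = "odd_part D"
  define f where "f b = complete_blocks n D [Unary 1 b]" for b
  have u: "odd ?u" using odd_part(2)[OF D] .
  have f: "f b = Unary 0 (?u * b) # replicate (n - 2) (Unary 0 1) @ [Unary 1 b]" for b
    using n by (simp add: f_def complete_blocks_def blocks_unit_def numeral_2_eq_2)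
  have val: "char_value (blocks_mat (f b)) s \<longleftrightarrow> (\<exists>s1 s2 s3. 8 dvd s1 - of_int (?u * b) \<and> 8 dvd s2 - of_nat (n - 2) \<and>
      char_value (block_mat (Unary 1 b)) s3 \<and> s = s1 + (s2 + s3))" if "odd b" for b s
  proof -
    have odd: "odd (?u * b)" using u that by simp
    have tail: "char_value (blocks_mat (replicate (n - 2) (Unary 0 1) @ [Unary 1 b])) t \<longleftrightarrow>
      (\<exists>s2 s3. 8 dvd s2 - of_nat (n - 2) \<and> char_value (block_mat (Unary 1 b)) s3 \<and> t = s2 + s3)" for t
      unfolding blocks_mat_append blocks_mat_singleton char_value_dsum[OF blocks_mat_carrier block_mat_carrier] char_value_ones ..
    show ?thesis
      unfolding f blocks_mat_Cons[of "Unary 0 (?u * b)"] char_value_dsum[OF block_mat_carrier blocks_mat_carrier]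
        char_value_Unary_0[OF odd] tail by blast
  qed
  have five: "odd (5 :: int)" and one: "odd (1 :: int)" by simp_all
  have not_iso: "\<not> z2_isometric (blocks_mat (f 1)) (blocks_mat (f 5))"
  proof
    assume "z2_isometric (blocks_mat (f 1)) (blocks_mat (f 5))"
    note inv = z2_isometric_invariants(3)[OF blocks_mat_carrier this]
    have "char_value (blocks_mat (f 5)) (of_int (?u * 5) + (of_nat (n - 2) + 0))"
      unfolding val[OF five] using char_value_Unary_1(1)[of 5]
      by (intro exI[of _ "of_int (?u * 5)"] exI[of _ "of_nat (n - 2)"] exI[of _ 0] conjI) (simp_all del: block_mat.simps)
    then have "char_value (blocks_mat (f 1)) (of_int (?u * 5) + (of_nat (n - 2) + 0))" using inv by blast
    then obtain s1 s2 s3 where s: "8 dvd s1 - of_int (?u * 1)" "8 dvd s2 - of_nat (n - 2)"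
      "char_value (block_mat (Unary 1 1)) s3" "of_int (?u * 5) + (of_nat (n - 2) + 0) = s1 + (s2 + s3)"
      unfolding val[OF one] by blast
    have "8 dvd (s1 - of_int (?u * 1)) + (s2 - of_nat (n - 2))" using s(1,2) by (rule dvd_add)
    moreover have "(s1 - of_int (?u * 1)) + (s2 - of_nat (n - 2)) = of_int (4 * ?u) - s3"
      using s(4) by (simp add: algebra_simps)
    ultimately have 1: "8 dvd of_int (4 * ?u) - s3" by (simp only:)
    from char_value_Unary_1(2)[OF s(3)] show False
    proof
      assume "8 dvd s3"
      with 1 have "8 dvd (of_int (4 * ?u) - s3) + s3" by (rule dvd_add)
      then have "2 ^ 3 dvd (of_int (4 * ?u) :: z2adic)" by simp
      then have "2 ^ 3 dvd 4 * ?u" unfolding z2adic_of_int_dvd .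
      then obtain t where "4 * ?u = 8 * t" by (auto elim: dvdE)
      then have "?u = 2 * t" by simp
      then show False using u by simp
    next
      assume "8 dvd s3 - 2 * of_int 1"
      with 1 have "8 dvd (of_int (4 * ?u) - s3) + (s3 - 2 * of_int 1)" by (rule dvd_add)
      then have "2 ^ 3 dvd (of_int (4 * ?u - 2) :: z2adic)" by simp
      then have "2 ^ 3 dvd 4 * ?u - 2" unfolding z2adic_of_int_dvd .
      then obtain t where "4 * ?u - 2 = 8 * t" by (auto elim: dvdE)
      then show False by presburger
    qed
  qed
  have "card {1, 5 :: int} \<le> L2 n D"
  proof (rule L2_lower[OF L2_upper(1)[OF D k[symmetric]], of _ f])
    fix b assume "b \<in> {1, 5 :: int}"
    then show "blocks_mat (f b) \<in> z2_lattices n D"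
      unfolding f_def using n k by (intro complete_blocks_lattice[OF D]) (auto simp: blocks_valuation_def)
  next
    fix b c assume bc: "b \<in> {1, 5 :: int}" "c \<in> {1, 5 :: int}" "f b \<approx> f c"
    then show "b = c"
      using not_iso z2_isometric_sym[OF blocks_mat_carrier] unfolding blocks_isometric_def by auto
  qed
  then show ?thesis by simp
qed

lemma dual_value_Unary_0:
  assumes "odd a" "dual_value 3 6 (block_mat (Unary 0 a)) s"
  shows "64 dvd s"
proof -
  obtain x where x: "x \<in> scaled_dual 3 (block_mat (Unary 0 a))" "2 ^ 6 dvd quad (block_mat (Unary 0 a)) x - s"
    using assms(2) unfolding dual_value_def by blast
  have xn: "x \<in> carrier_vec 1" "8 dvd x $ 0" using x(1) unfolding scaled_dual_Unary[OF assms(1)] by auto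
  have "8 * 8 dvd x $ 0 * (x $ 0 * of_int a)" using xn(2) by (intro mult_dvd_mono dvd_mult2)
  then have "64 dvd quad (block_mat (Unary 0 a)) x" using Unary_mult_vec(2)[OF xn(1,1), of 0 a] by (simp add: ac_simps)
  moreover have "64 dvd quad (block_mat (Unary 0 a)) x - s" using x(2) by simp
  ultimately have "64 dvd quad (block_mat (Unary 0 a)) x - (quad (block_mat (Unary 0 a)) x - s)" by (rule dvd_diff)
  then show ?thesis by simp
qed

lemma dual_value_Unary_0_list:
  assumes "\<forall>a\<in>set as. odd a" "dual_value 3 6 (blocks_mat (map (Unary 0) as)) s"
  shows "64 dvd s"
  using assms
proof (induction as arbitrary: s)
  case Nil
  then obtain x where x: "x \<in> carrier_vec 0" "2 ^ 6 dvd quad (blocks_mat []) x - s"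
    unfolding dual_value_def scaled_dual_def by auto
  have "quad (blocks_mat []) x = 0" using x(1) by (auto simp: scalar_prod_def)
  then show ?case using x(2) by simp
next
  case (Cons a as)
  then obtain s1 s2 where s: "dual_value 3 6 (block_mat (Unary 0 a)) s1" "dual_value 3 6 (blocks_mat (map (Unary 0) as)) s2" "s = s1 + s2"
    unfolding list.map blocks_mat_Cons dual_value_dsum[OF block_mat_carrier blocks_mat_carrier] by blast
  have "64 dvd s1" using dual_value_Unary_0[OF _ s(1)] Cons.prems by simp
  moreover have "64 dvd s2" using Cons s by simp
  ultimately show ?case unfolding s(3) by (rule dvd_add)
qed

text \<open>The norm of a vector with coordinate \<open>w\<close> is \<open>8 * u * w^2\<close>: for
  odd \<open>w\<close> it is \<open>8 * u\<close> modulo 64, for even \<open>w\<close> a multiple of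
  32. Modulo 64 the norms thus remember \<open>u\<close> modulo 8.\<close>

lemma dual_value_Unary_3:
  assumes "odd u"
  shows "dual_value 3 6 (block_mat (Unary 3 u)) (of_int (8 * u))"
    "dual_value 3 6 (block_mat (Unary 3 u)) s \<Longrightarrow> 64 dvd s - of_int (8 * u) \<or> 32 dvd s"
proof -
  have quad: "quad (block_mat (Unary 3 u)) x = 8 * (x $ 0 * x $ 0) * of_int u" if "x \<in> carrier_vec 1" for x
    using Unary_mult_vec(2)[OF that that, of 3 u] by (simp add: ac_simps)
  define w :: "z2adic vec" where "w = vec 1 (\<lambda>_. 1)"
  have wn: "w \<in> carrier_vec 1" by (simp add: w_def)
  then have "w \<in> scaled_dual 3 (block_mat (Unary 3 u))" unfolding scaled_dual_Unary[OF assms] by simp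
  moreover have "2 ^ 6 dvd quad (block_mat (Unary 3 u)) w - of_int (8 * u)" unfolding quad[OF wn] by (simp add: w_def)
  ultimately show "dual_value 3 6 (block_mat (Unary 3 u)) (of_int (8 * u))" unfolding dual_value_def by blast
  assume "dual_value 3 6 (block_mat (Unary 3 u)) s"
  then obtain x where x: "x \<in> scaled_dual 3 (block_mat (Unary 3 u))" "64 dvd quad (block_mat (Unary 3 u)) x - s"
    unfolding dual_value_def by auto
  have xn: "x \<in> carrier_vec 1" using x(1) unfolding scaled_dual_Unary[OF assms] by simp
  show "64 dvd s - of_int (8 * u) \<or> 32 dvd s"
  proof (cases "2 dvd x $ 0")
    case True
    then obtain t where "x $ 0 = 2 * t" by (blast elim: dvdE)
    then have "quad (block_mat (Unary 3 u)) x = 32 * (t * t * of_int u)" unfolding quad[OF xn] by (simp add: ac_simps)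
    then have "32 dvd quad (block_mat (Unary 3 u)) x" by simp
    moreover have "32 dvd quad (block_mat (Unary 3 u)) x - s"
    proof -
      have "(32 :: z2adic) dvd 64" by (rule dvdI[of _ _ 2]) simp
      then show ?thesis using x(2) dvd_trans by blast
    qed
    ultimately have "32 dvd quad (block_mat (Unary 3 u)) x - (quad (block_mat (Unary 3 u)) x - s)" by (rule dvd_diff)
    then show ?thesis by simp
  next
    case False
    have "8 * 8 dvd 8 * (x $ 0 * x $ 0 - 1)" using odd_square_8[OF False] by (rule mult_dvd_mono[OF dvd_refl])
    then have "64 dvd 8 * (x $ 0 * x $ 0 - 1) * of_int u" using dvd_mult2 by fastforce
    then have "64 dvd quad (block_mat (Unary 3 u)) x - of_int (8 * u)" unfolding quad[OF xn] by (simp add: algebra_simps)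
    then have "64 dvd (quad (block_mat (Unary 3 u)) x - of_int (8 * u)) - (quad (block_mat (Unary 3 u)) x - s)"
      using x(2) by (rule dvd_diff)
    then show ?thesis by simp
  qed
qed

text \<open>Four of the five lattices have the block \<open><8 * u>\<close> with
  \<open>u = 1, 3, 5, 7\<close>. On the scaled dual of level 3 the unimodular part has norms
  divisible by 64, so that \<open>dual_value\<close> recovers \<open>u\<close>. The fifth has three
  blocks \<open><2>\<close> and none of scale 8.\<close>

lemma L2_lower_3:
  assumes D: "D \<noteq> 0" and k: "multiplicity 2 D = 3" and n: "4 \<le> n"
  shows "5 \<le> L2 n D"
proof -
  define T where "T = {[Unary 3 1], [Unary 3 3], [Unary 3 5], [Unary 3 7], replicate 3 (Unary 1 1)}"
  have inj3: "u = v" if uv: "u \<in> {1, 3, 5, 7}" "v \<in> {1, 3, 5, 7}" and iso: "complete_blocks n D [Unary 3 u] \<approx> complete_blocks n D [Unary 3 v]" for u v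
  proof -
    have odd: "odd u" "odd v" "0 < u" "u < 8" "0 < v" "v < 8" using uv by auto
    define as where "as w = (odd_part D * w) # replicate (n - 2) 1" for w :: int
    have as: "\<forall>a\<in>set (as w). odd a" if "odd w" for w using odd_part(2)[OF D] that by (auto simp: as_def)
    have eq: "blocks_mat (complete_blocks n D [Unary 3 w]) = dsum (blocks_mat (map (Unary 0) (as w))) (block_mat (Unary 3 w))" for w
      unfolding blocks_mat_singleton[symmetric] blocks_mat_append[symmetric]
      using n by (simp add: complete_blocks_def as_def blocks_unit_def numeral_2_eq_2)
    have "dual_value 3 6 (blocks_mat (complete_blocks n D [Unary 3 u])) (of_int (8 * u))"
      unfolding eq dual_value_dsum[OF blocks_mat_carrier block_mat_carrier]
      using dual_value_0[OF blocks_mat_carrier] dual_value_Unary_3(1)[OF odd(1)]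
      by (intro exI[of _ 0] exI[of _ "of_int (8 * u)"]) simp
    then have "dual_value 3 6 (blocks_mat (complete_blocks n D [Unary 3 v])) (of_int (8 * u))"
      using z2_isometric_invariants(2)[OF blocks_mat_carrier iso[unfolded blocks_isometric_def]] by blast
    then obtain s1 s2 where s: "dual_value 3 6 (blocks_mat (map (Unary 0) (as v))) s1" "dual_value 3 6 (block_mat (Unary 3 v)) s2"
      "of_int (8 * u) = s1 + s2"
      unfolding eq dual_value_dsum[OF blocks_mat_carrier block_mat_carrier] by blast
    have s1: "64 dvd s1" by (rule dual_value_Unary_0_list[OF as[OF odd(2)] s(1)])
    from dual_value_Unary_3(2)[OF odd(2) s(2)] show ?thesis
    proof
      assume "64 dvd s2 - of_int (8 * v)"
      with s1 have "64 dvd s1 + (s2 - of_int (8 * v))" by (rule dvd_add)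
      also have "s1 + (s2 - of_int (8 * v)) = of_int (8 * u - 8 * v)" using s(3) by (simp add: algebra_simps)
      finally have "2 ^ 6 dvd (of_int (8 * u - 8 * v) :: z2adic)" by simp
      then have "2 ^ 6 dvd 8 * u - 8 * v" unfolding z2adic_of_int_dvd .
      then obtain t where "8 * u - 8 * v = 64 * t" by (auto elim: dvdE)
      then have "u - v = 8 * t" by simp
      then show ?thesis using odd by presburger
    next
      assume 32: "32 dvd s2"
      have "(32 :: z2adic) dvd 64" by (rule dvdI[of _ _ 2]) simp
      then have "32 dvd s1" using s1 dvd_trans by blast
      then have "32 dvd s1 + s2" using 32 by (rule dvd_add)
      then have "2 ^ 5 dvd (of_int (8 * u) :: z2adic)" using s(3) by simp
      then have "2 ^ 5 dvd 8 * u" unfolding z2adic_of_int_dvd .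
      then obtain t where "8 * u = 32 * t" by (auto elim: dvdE)
      then have "u = 2 * (2 * t)" by simp
      then show ?thesis using odd(1) by simp
    qed
  qed
  have split: "\<forall>b\<in>set ys. split_block b" if "ys \<in> T" for ys using that by (auto simp: T_def)
  have "card T \<le> L2 n D"
  proof (rule L2_lower[OF L2_upper(1)[OF D k[symmetric]], of _ "complete_blocks n D"])
    fix ys assume ys: "ys \<in> T"
    then have "blocks_rank ys < n" "blocks_valuation ys = multiplicity 2 D"
      using n k by (auto simp: T_def blocks_valuation_def numeral_3_eq_3)
    then show "blocks_mat (complete_blocks n D ys) \<in> z2_lattices n D"
      by (intro complete_blocks_lattice[OF D split[OF ys]])
  next
    fix ys zs assume yz: "ys \<in> T" "zs \<in> T" and iso: "complete_blocks n D ys \<approx> complete_blocks n D zs"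
    have "(\<exists>u. Unary 3 u \<in> set ys) \<longleftrightarrow> (\<exists>u. Unary 3 u \<in> set zs)"
      using complete_blocks_isometric(2)[OF iso D split[OF yz(1)] split[OF yz(2)], of 2] by (simp add: numeral_3_eq_3 numeral_2_eq_2)
    note unary = this
    have cases: "(\<exists>u\<in>{1, 3, 5, 7}. ys = [Unary 3 u]) \<or> ys = replicate 3 (Unary 1 1)" if "ys \<in> T" for ys
      using that by (auto simp: T_def)
    from cases[OF yz(1)] show "ys = zs"
    proof
      assume "\<exists>u\<in>{1, 3, 5, 7}. ys = [Unary 3 u]"
      then obtain u where u: "u \<in> {1, 3, 5, 7}" "ys = [Unary 3 u]" by blast
      then have "zs \<noteq> replicate 3 (Unary 1 1)" using unary by auto
      then obtain v where v: "v \<in> {1, 3, 5, 7}" "zs = [Unary 3 v]" using cases[OF yz(2)] by blast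
      show ?thesis using inj3[OF u(1) v(1)] iso unfolding u(2) v(2) by simp
    next
      assume ys: "ys = replicate 3 (Unary 1 1)"
      then have "\<nexists>u. Unary 3 u \<in> set zs" using unary by auto
      then show ?thesis using cases[OF yz(2)] ys by auto
    qed
  qed
  moreover have "card T = 5" by (simp add: T_def numeral_3_eq_3)
  ultimately show ?thesis by simp
qed

theorem theorem6p2:
  fixes n k :: nat and D :: int
  assumes "n > 0"
    and "D \<noteq> 0"
    and "k = multiplicity 2 D"
    and "k > 0"
    and "k < n"
  shows "1 / (4 * sqrt 3 * real k) * exp (pi * sqrt (2 * real k / 3)) \<le> real (L2 n D)
    \<and> real (L2 n D) \<le>
      3 / (2 * sqrt 51 * real k) * ((3 + sqrt 17) / 2) ^ k * exp (pi * sqrt (2 * real k / 3))"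
proof -
  have "HR k \<le> real (L2 n D)"
  proof (cases "k = 1 \<or> k = 3")
    case True
    then show ?thesis
    proof
      assume k: "k = 1"
      then have "2 \<le> L2 n D" using assms by (intro L2_lower_1) auto
      then have "2 \<le> real (L2 n D)" by simp
      then show ?thesis using HR_values(1) unfolding k by linarith
    next
      assume k: "k = 3"
      then have "5 \<le> L2 n D" using assms by (intro L2_lower_3) auto
      then have "5 \<le> real (L2 n D)" by simp
      then show ?thesis using HR_values(3) unfolding k by linarith
    qed
  next
    case False
    have "real (num_codes num_types k k) \<le> real (L2 n D)"
      using L2_lower_types[OF assms(2,3,5)] by (simp only: of_nat_le_iff)
    then show ?thesis using HR_le_num_codes[of k] assms(4) False by fastforce
  qed
  moreover have "real (L2 n D) \<le> upper_bound k"
  proof (cases "k = 1")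
    case True
    \<comment> \<open>The general bound would give \<open>3 * 4 = 12\<close>, while
      \<open>upper_bound 1\<close> is about 9.7.\<close>
    have "L2 n D \<le> 8" using assms True by (intro L2_upper_1) auto
    then have "real (L2 n D) \<le> 8" by simp
    also have "\<dots> \<le> 21 / 100 / real k * (89 / 25) ^ k * (329 / 200) ^ 5"
      unfolding True by (simp add: eval_nat_numeral)
    also have "\<dots> \<le> upper_bound k"
    proof (rule upper_bound_ge)
      have "(329 / 200) ^ 5 \<le> exp (1 / 2 :: real) ^ 5" using exp_half_ge by (intro power_mono) auto
      also have "\<dots> = exp (5 / 2 :: real)" by (simp flip: exp_of_nat_mult)
      also have "\<dots> \<le> exp (pi * sqrt (2 * real k / 3))" using pi_sqrt_ge[of k] True by simp
      finally show "(329 / 200) ^ 5 \<le> exp (pi * sqrt (2 * real k / 3))" .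
    qed (use assms in auto)
    finally show ?thesis .
  next
    case False
    have "real (L2 n D) \<le> real (3 * num_codes num_local_codes k k)"
      using L2_upper(2)[OF assms(2,3)] by (simp only: of_nat_le_iff)
    then show ?thesis using num_codes_le_upper_bound[of k] assms(4) False by simp
  qed
  ultimately show ?thesis unfolding HR_def upper_bound_def by blast
qed

end
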